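(* Let $\mathbb{K}$ be a field, let $\Gamma$ be a finite, connected, simple graph with adjacency matrix $A$, and let $i$ be a vertex of $\Gamma$. If the Chebyshev algorithm with input $(\Gamma,i)$ (described in the context) does not terminate, then it produces a minimal linear projective resolution of the simple $Z(\Gamma)$-module $L_i$: the complex $\cdots\to q^{2}Q_2\to qQ_1\to Q_0$ associated to the output of the algorithm, together with the projection $Q_0=P_i\to L_i$, is such a resolution. Its multiplicities are given by the Chebyshev recursion: for every $t\geq 0$, the vector of multiplicities of the indecomposable projectives $P_j$ in $Q_t$ is $\underline{a}_t=U_t(A)\,\underline{a}-U_{t-1}(A)\,\underline{b}$ with $\underline{a}$ the $i$-th unit vector and $\underline{b}=0$, i.e. it is the $i$-th column of $U_t(A)$.
   Context: Zigzag algebra. Let $Q$ be the double quiver of $\Gamma$: same vertices, and for each edge between $i$ and $j$ two arrows $i\to j$ and $j\to i$. Paths are composed from left to right; $e_i$ denotes the length-zero path at $i$. If $\Gamma$ has at least three vertices, $Z(\Gamma)$ is the quotient of the path algebra $\mathbb{K}Q$ by the relations $i\to j\to k=0$ for $i\neq k$, and $i\to j\to i=i\to k\to i$ for all neighbors $j,k$ of $i$. If $\Gamma$ has two vertices, $Z(\Gamma)$ is $\mathbb{K}Q$ modulo all paths of length three; if $\Gamma$ has one vertex, $Z(\Gamma)=\mathbb{K}[x]/(x^2)$ with $x$ in degree $2$. Otherwise $Z(\Gamma)$ is graded by path length. Modules are graded left modules. $P_i=Z(\Gamma)e_i$ are the indecomposable projectives (generated in degree $0$), $q^t$ denotes a shift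 so that a module generated in degree $0$ becomes generated in degree $t$, and $L_i$ is the one-dimensional simple module in degree $0$ on which $e_i$ acts as the identity and all other $e_j$ and all elements of positive degree act as zero. A linear projective resolution of a graded module $M$ is an exact sequence $\cdots\to q^2Q_2\to qQ_1\to Q_0\to M\to 0$ with degree $0$ maps and with each $q^tQ_t$ graded projective and generated in degree $t$. It is minimal if, for all $t\geq 0$, no indecomposable summand of $Q_t$ lies in the kernel of the map going out of $Q_t$. Chebyshev polynomials: $U_{-1}(X)=0$, $U_0(X)=1$, $U_t(X)=X\,U_{t-1}(X)-U_{t-2}(X)$ for $t\geq 1$. Chebyshev algorithm. Input: $\Gamma$ and a vertex $i$ of $\Gamma$. Output: a resolution graph, i.e. a graph whose vertex set is a disjoint union of finite sets $V_t$ ($t\geq 0$), each vertex being labeled by a vertex of $\Gamma$, and whose edge set is a disjoint union of finite sets $E_t$ ($t\geq 1$), where the edges in $E_t$ go from $V_t$ to $V_{t-1}$ and are labeled by elements of $\mathbb{K}$. Initialization: $V_0$ consists of one vertex, labeled $i$; all other $V_t$ and all $E_t$ are empty. Step $s=1,2,3,\dots$ constructs $V_s$ and $E_s$ from the previous levels as follows. (Fork moves; none for $s=1$.) For each vertex $k$ of $\Gamma$ consider the graph formed by the vertices of $V_{s-2}$ labeled $k$, all edges in $E_{s-1}$ incident with them, and the endpoints of these edges in $V_{s-1}$. For each connected component of it, with vertex set $W\cup W'$, $W\subset V_{s-2}$, $W'\subset V_{s-1}$, choose a basis of the $\mathbb{K}$-vector space of weightings, i.e. of families $(b_{w'})_{w'\in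 W'}$ in $\mathbb{K}$ such that for each $w\in W$ one has $\sum_{w'}z_{w'}b_{w'}=0$, where the sum runs over all $w'\in W'$ joined to $w$ and $z_{w'}$ is the label of the edge joining $w'$ and $w$. For each basis element $(b_{w'})$ add to $V_s$ a new vertex labeled $k$, and to $E_s$ edges from this new vertex to each $w'\in W'$ with label $b_{w'}$. (Singleton moves.) For each $v\in V_{s-1}$, with label $j$ say, and each neighbor $k$ of $j$ in $\Gamma$ such that $v$ is not joined in the resolution graph to a vertex labeled $k$, add to $V_s$ a new vertex labeled $k$, and to $E_s$ an edge with label $1$ from this new vertex to $v$. The algorithm terminates if at some step no new vertices are added; otherwise it does not terminate, and the output is understood as the levels obtained up to any chosen step. Associated complex. $Q_t=\bigoplus_{v\in V_t}P_{\mathrm{label}(v)}$, and the map from $Q_t$ to $Q_{t-1}$ is the matrix of maps whose entry for an edge in $E_t$ with label $z$, from a vertex labeled $k$ to a vertex labeled $j$, is right multiplication by $z\,(k\to j)$, as a map $P_k\to P_j$. *)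

theory Defs
  imports
    "HOL-Analysis.Cartesian_Space"
    "HOL-Computational_Algebra.Polynomial"
    "HOL-Library.Function_Algebras"
    "Graph_Theory.Graph_Theory"
    "HOL-Algebra.QuotRing"
    "HOL-Algebra.Module"
begin

section \<open>Graded left modules over a graded ring\<close>

text \<open>The library's \<open>module\<close> locale needs a commutative ring. Its record is reused here for left modules
  over an arbitrary ring; the inherited fields \<open>mult\<close> and \<open>one\<close> of a module carry no meaning.\<close>

record 'a gring = "'a ring" +
  gr_comp :: "int \<Rightarrow> 'a set"

record ('a, 'm) gmodule = "('a, 'm) module" +
  gm_comp :: "int \<Rightarrow> 'm set"

definition graded_by :: "('m, 'x) ring_scheme \<Rightarrow> (int \<Rightarrow> 'm set) \<Rightarrow> bool" where
  "graded_by M D \<longleftrightarrow>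
     (\<forall>n. subgroup (D n) (add_monoid M)) \<and>
     (\<forall>x\<in>carrier M. \<exists>!c. (\<forall>n. c n \<in> D n) \<and> finite {n. c n \<noteq> \<zero>\<^bsub>M\<^esub>} \<and>
                        x = finsum M c {n. c n \<noteq> \<zero>\<^bsub>M\<^esub>})"

definition graded_ring :: "'a gring \<Rightarrow> bool" where
  "graded_ring A \<longleftrightarrow> ring A \<and> graded_by A (gr_comp A) \<and>
     (\<forall>m n. \<forall>a\<in>gr_comp A m. \<forall>b\<in>gr_comp A n. a \<otimes>\<^bsub>A\<^esub> b \<in> gr_comp A (m + n))"

locale left_module = R?: ring R + M?: abelian_group M
  for R :: "('a, 'x) ring_scheme" (structure) and M :: "('a, 'm, 'y) module_scheme" (structure) +
  assumes smult_closed: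
      "\<lbrakk>a \<in> carrier R; x \<in> carrier M\<rbrakk> \<Longrightarrow> a \<odot>\<^bsub>M\<^esub> x \<in> carrier M"
    and smult_l_distr:
      "\<lbrakk>a \<in> carrier R; b \<in> carrier R; x \<in> carrier M\<rbrakk> \<Longrightarrow>
       (a \<oplus>\<^bsub>R\<^esub> b) \<odot>\<^bsub>M\<^esub> x = a \<odot>\<^bsub>M\<^esub> x \<oplus>\<^bsub>M\<^esub> b \<odot>\<^bsub>M\<^esub> x"
    and smult_r_distr:
      "\<lbrakk>a \<in> carrier R; x \<in> carrier M; y \<in> carrier M\<rbrakk> \<Longrightarrow>
       a \<odot>\<^bsub>M\<^esub> (x \<oplus>\<^bsub>M\<^esub> y) = a \<odot>\<^bsub>M\<^esub> x \<oplus>\<^bsub>M\<^esub> a \<odot>\<^bsub>M\<^esub> y"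
    and smult_assoc:
      "\<lbrakk>a \<in> carrier R; b \<in> carrier R; x \<in> carrier M\<rbrakk> \<Longrightarrow>
       (a \<otimes>\<^bsub>R\<^esub> b) \<odot>\<^bsub>M\<^esub> x = a \<odot>\<^bsub>M\<^esub> (b \<odot>\<^bsub>M\<^esub> x)"
    and smult_one:
      "x \<in> carrier M \<Longrightarrow> \<one>\<^bsub>R\<^esub> \<odot>\<^bsub>M\<^esub> x = x"

definition graded_module :: "'a gring \<Rightarrow> ('a, 'm) gmodule \<Rightarrow> bool" where
  "graded_module A M \<longleftrightarrow> graded_ring A \<and> left_module A M \<and> graded_by M (gm_comp M) \<and>
     (\<forall>m n. \<forall>a\<in>gr_comp A m. \<forall>x\<in>gm_comp M n. a \<odot>\<^bsub>M\<^esub> x \<in> gm_comp M (m + n))"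

text \<open>Homomorphisms are of degree 0. The algebra contains the ground field, so linearity over the
  algebra includes linearity over the field.\<close>

definition graded_hom :: "'a gring \<Rightarrow> ('a, 'm) gmodule \<Rightarrow> ('a, 'n) gmodule \<Rightarrow> ('m \<Rightarrow> 'n) set" where
  "graded_hom A M N = {f \<in> carrier M \<rightarrow> carrier N.
     (\<forall>x\<in>carrier M. \<forall>y\<in>carrier M. f (x \<oplus>\<^bsub>M\<^esub> y) = f x \<oplus>\<^bsub>N\<^esub> f y) \<and>
     (\<forall>a\<in>carrier A. \<forall>x\<in>carrier M. f (a \<odot>\<^bsub>M\<^esub> x) = a \<odot>\<^bsub>N\<^esub> f x) \<and>
     (\<forall>n. f ` gm_comp M n \<subseteq> gm_comp N n)}"

definition graded_iso :: "'a gring \<Rightarrow> ('a, 'm) gmodule \<Rightarrow> ('a, 'n) gmodule \<Rightarrow> bool" where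
  "graded_iso A M N \<longleftrightarrow> (\<exists>f\<in>graded_hom A M N. bij_betw f (carrier M) (carrier N))"

text \<open>The shift \<open>q^t\<close>: generators of degree 0 become generators of degree \<open>t\<close>.\<close>

definition gshift :: "int \<Rightarrow> ('a, 'm) gmodule \<Rightarrow> ('a, 'm) gmodule" where
  "gshift t M = M\<lparr>gm_comp := (\<lambda>n. gm_comp M (n - t))\<rparr>"

definition gdirect_sum :: "'i set \<Rightarrow> ('i \<Rightarrow> ('a, 'm) gmodule) \<Rightarrow> ('a, 'i \<Rightarrow> 'm) gmodule" where
  "gdirect_sum I M =
     (let C = {x \<in> (\<Pi>\<^sub>E v\<in>I. carrier (M v)). finite {v\<in>I. x v \<noteq> \<zero>\<^bsub>M v\<^esub>}} in
      \<lparr>carrier = C, mult = undefined, one = undefined,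
       zero = (\<lambda>v\<in>I. \<zero>\<^bsub>M v\<^esub>),
       add = (\<lambda>x y. \<lambda>v\<in>I. x v \<oplus>\<^bsub>M v\<^esub> y v),
       smult = (\<lambda>a x. \<lambda>v\<in>I. a \<odot>\<^bsub>M v\<^esub> x v),
       gm_comp = (\<lambda>n. {x \<in> C. \<forall>v\<in>I. x v \<in> gm_comp (M v) n})\<rparr>)"

text \<open>Projectivity is the lifting property, tested against graded modules with carriers in the types
  \<open>'m\<close> and \<open>'n\<close>. In a theorem that is polymorphic in \<open>'m\<close> and \<open>'n\<close> this is the lifting property
  against all graded modules.\<close>

definition graded_projective ::
  "'m itself \<Rightarrow> 'n itself \<Rightarrow> 'a gring \<Rightarrow> ('a, 'p) gmodule \<Rightarrow> bool" where
  "graded_projective TM TN A P \<longleftrightarrow> graded_module A P \<and>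
     (\<forall>(M :: ('a, 'm) gmodule) (N :: ('a, 'n) gmodule) g f.
        graded_module A M \<and> graded_module A N \<and>
        g \<in> graded_hom A M N \<and> g ` carrier M = carrier N \<and> f \<in> graded_hom A P N \<longrightarrow>
        (\<exists>h\<in>graded_hom A P M. \<forall>x\<in>carrier P. g (h x) = f x))"

definition generated_in_degree :: "'a gring \<Rightarrow> int \<Rightarrow> ('a, 'm) gmodule \<Rightarrow> bool" where
  "generated_in_degree A t M \<longleftrightarrow>
     (\<forall>N. submodule N A M \<and> gm_comp M t \<subseteq> N \<longrightarrow> N = carrier M)"

definition gsub :: "('a, 'm) gmodule \<Rightarrow> 'm set \<Rightarrow> ('a, 'm) gmodule" where
  "gsub M N = M\<lparr>carrier := N, gm_comp := (\<lambda>n. gm_comp M n \<inter> N)\<rparr>"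

definition graded_submodule :: "'a gring \<Rightarrow> ('a, 'm) gmodule \<Rightarrow> 'm set \<Rightarrow> bool" where
  "graded_submodule A M N \<longleftrightarrow> submodule N A M \<and> graded_module A (gsub M N)"

definition complementary :: "'a gring \<Rightarrow> ('a, 'm) gmodule \<Rightarrow> 'm set \<Rightarrow> 'm set \<Rightarrow> bool" where
  "complementary A M N N' \<longleftrightarrow> graded_submodule A M N \<and> graded_submodule A M N' \<and>
     N \<inter> N' = {\<zero>\<^bsub>M\<^esub>} \<and> N <+>\<^bsub>M\<^esub> N' = carrier M"

definition indecomposable :: "'a gring \<Rightarrow> ('a, 'm) gmodule \<Rightarrow> bool" where
  "indecomposable A M \<longleftrightarrow> carrier M \<noteq> {\<zero>\<^bsub>M\<^esub>} \<and>
     (\<forall>N N'. complementary A M N N' \<longrightarrow> N = {\<zero>\<^bsub>M\<^esub>} \<or> N' = {\<zero>\<^bsub>M\<^esub>})"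

definition indecomposable_summand :: "'a gring \<Rightarrow> ('a, 'm) gmodule \<Rightarrow> 'm set \<Rightarrow> bool" where
  "indecomposable_summand A M N \<longleftrightarrow>
     (\<exists>N'. complementary A M N N') \<and> indecomposable A (gsub M N)"

text \<open>\<open>M\<close> is a finite direct sum of indecomposable graded submodules, exactly \<open>m\<close> of which are
  isomorphic to \<open>P\<close>. For modules of finite length \<open>m\<close> does not depend on the decomposition, by the
  Krull-Schmidt theorem.\<close>

definition has_multiplicity ::
  "'a gring \<Rightarrow> ('a, 'p) gmodule \<Rightarrow> ('a, 'm) gmodule \<Rightarrow> nat \<Rightarrow> bool" where
  "has_multiplicity A P M m \<longleftrightarrow>
     (\<exists>\<N>. finite \<N> \<and>
        (\<forall>N\<in>\<N>. graded_submodule A M N \<and> indecomposable A (gsub M N)) \<and>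
        (\<forall>x\<in>carrier M. \<exists>!c. c \<in> (\<Pi>\<^sub>E N\<in>\<N>. N) \<and> x = finsum M c \<N>) \<and>
        card {N\<in>\<N>. graded_iso A (gsub M N) P} = m)"

text \<open>The sequence \<open>\<dots> \<rightarrow> q^2 Q\<^sub>2 \<rightarrow> q Q\<^sub>1 \<rightarrow> Q\<^sub>0 \<rightarrow> M \<rightarrow> 0\<close>; here \<open>d t\<close> is the map from \<open>Q (Suc t)\<close> to \<open>Q t\<close> and
  \<open>\<epsilon>\<close> is the map from \<open>Q 0\<close> to \<open>M\<close>.\<close>

definition linear_projective_resolution ::
  "'m itself \<Rightarrow> 'n itself \<Rightarrow> 'a gring \<Rightarrow> ('a, 'l) gmodule \<Rightarrow> (nat \<Rightarrow> ('a, 'q) gmodule) \<Rightarrow>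
   (nat \<Rightarrow> 'q \<Rightarrow> 'q) \<Rightarrow> ('q \<Rightarrow> 'l) \<Rightarrow> bool" where
  "linear_projective_resolution TM TN A M Q d \<epsilon> \<longleftrightarrow>
     graded_module A M \<and>
     (\<forall>t. graded_projective TM TN A (gshift (int t) (Q t)) \<and>
          generated_in_degree A (int t) (gshift (int t) (Q t))) \<and>
     (\<forall>t. d t \<in> graded_hom A (gshift (int (Suc t)) (Q (Suc t))) (gshift (int t) (Q t))) \<and>
     \<epsilon> \<in> graded_hom A (Q 0) M \<and>
     \<epsilon> ` carrier (Q 0) = carrier M \<and>
     d 0 ` carrier (Q 1) = a_kernel (Q 0) M \<epsilon> \<and>
     (\<forall>t. d (Suc t) ` carrier (Q (Suc (Suc t))) = a_kernel (Q (Suc t)) (Q t) (d t))"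

definition minimal_linear_projective_resolution ::
  "'m itself \<Rightarrow> 'n itself \<Rightarrow> 'a gring \<Rightarrow> ('a, 'l) gmodule \<Rightarrow> (nat \<Rightarrow> ('a, 'q) gmodule) \<Rightarrow>
   (nat \<Rightarrow> 'q \<Rightarrow> 'q) \<Rightarrow> ('q \<Rightarrow> 'l) \<Rightarrow> bool" where
  "minimal_linear_projective_resolution TM TN A M Q d \<epsilon> \<longleftrightarrow>
     linear_projective_resolution TM TN A M Q d \<epsilon> \<and>
     (\<forall>N. indecomposable_summand A (Q 0) N \<longrightarrow> \<not> N \<subseteq> a_kernel (Q 0) M \<epsilon>) \<and>
     (\<forall>t N. indecomposable_summand A (Q (Suc t)) N \<longrightarrow>
            \<not> N \<subseteq> a_kernel (Q (Suc t)) (Q t) (d t))"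


section \<open>Path algebras and zigzag algebras\<close>

text \<open>A path in a quiver without parallel arrows is the nonempty list of its vertices; the elements of
  the path algebra are the finitely supported functions on paths. In the product, \<open>k\<close> ranges over the
  positions at which the path \<open>p\<close> can be cut into two paths (read from left to right).\<close>

definition path_algebra :: "'v pair_pre_digraph \<Rightarrow> ('v list \<Rightarrow> 'k::field) ring" where
  "path_algebra Q =
     \<lparr>carrier = {f. finite {p. f p \<noteq> 0} \<and> (\<forall>p. f p \<noteq> 0 \<longrightarrow> vwalk p (with_proj Q))},
      mult = (\<lambda>f g p. \<Sum>k<length p. f (take (Suc k) p) * g (drop k p)),
      one = (\<lambda>p. if \<exists>v\<in>pverts Q. p = [v] then 1 else 0),
      zero = (\<lambda>p. 0),
      add = (\<lambda>f g p. f p + g p)\<rparr>"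

definition scaled_path :: "'k::field \<Rightarrow> 'v list \<Rightarrow> 'v list \<Rightarrow> 'k" where
  "scaled_path z p = (\<lambda>q. if q = p then z else 0)"

text \<open>A symmetric digraph \<open>G\<close> is its own double quiver. If \<open>G\<close> has a single vertex, then \<open>K[x]\<close> is
  the path algebra of the quiver with one vertex and one loop \<open>x\<close>, which gets degree 2.\<close>

definition zigzag_quiver :: "'v pair_pre_digraph \<Rightarrow> 'v pair_pre_digraph" where
  "zigzag_quiver G =
     (if card (pverts G) = 1 then \<lparr>pverts = pverts G, parcs = pverts G \<times> pverts G\<rparr> else G)"

definition arrow_degree :: "'v pair_pre_digraph \<Rightarrow> nat" where
  "arrow_degree G = (if card (pverts G) = 1 then 2 else 1)"

definition zigzag_relations :: "'v pair_pre_digraph \<Rightarrow> ('v list \<Rightarrow> 'k::field) set" where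
  "zigzag_relations G =
     (if card (pverts G) = 1 then {scaled_path 1 [v, v, v] | v. v \<in> pverts G}
      else if card (pverts G) = 2 then
        {scaled_path 1 p | p. vwalk p (with_proj G) \<and> vwalk_length p = 3}
      else
        {scaled_path 1 [i, j, k] | i j k. (i, j) \<in> parcs G \<and> (j, k) \<in> parcs G \<and> i \<noteq> k} \<union>
        {(\<lambda>p. scaled_path 1 [i, j, i] p - scaled_path 1 [i, k, i] p) | i j k.
           (i, j) \<in> parcs G \<and> (i, k) \<in> parcs G})"

definition zigzag_ideal :: "'v pair_pre_digraph \<Rightarrow> ('v list \<Rightarrow> 'k::field) set" where
  "zigzag_ideal G = Idl\<^bsub>path_algebra (zigzag_quiver G)\<^esub> (zigzag_relations G)"

definition zigzag_class ::
  "'v pair_pre_digraph \<Rightarrow> ('v list \<Rightarrow> 'k::field) \<Rightarrow> ('v list \<Rightarrow> 'k) set" where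
  "zigzag_class G f = zigzag_ideal G +>\<^bsub>path_algebra (zigzag_quiver G)\<^esub> f"

definition zigzag_algebra :: "'v pair_pre_digraph \<Rightarrow> ('v list \<Rightarrow> 'k::field) set gring" where
  "zigzag_algebra G =
     (let KQ = path_algebra (zigzag_quiver G); Z = KQ Quot zigzag_ideal G in
      \<lparr>carrier = carrier Z, mult = mult Z, one = one Z, zero = zero Z, add = add Z,
       gr_comp = (\<lambda>n. zigzag_class G `
         {f \<in> carrier KQ. \<forall>p. f p \<noteq> 0 \<longrightarrow> int (arrow_degree G * vwalk_length p) = n})\<rparr>)"

definition proj_module ::
  "'v pair_pre_digraph \<Rightarrow> 'v \<Rightarrow>
   (('v list \<Rightarrow> 'k::field) set, ('v list \<Rightarrow> 'k) set) gmodule" where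
  "proj_module G i =
     (let Z = zigzag_algebra G;
          C = {a \<otimes>\<^bsub>Z\<^esub> zigzag_class G (scaled_path 1 [i]) | a. a \<in> carrier Z} in
      \<lparr>carrier = C, mult = undefined, one = undefined, zero = zero Z, add = add Z,
       smult = mult Z, gm_comp = (\<lambda>n. gr_comp Z n \<inter> C)\<rparr>)"

text \<open>The simple module is the ground field; an algebra element acts by its coefficient at \<open>e\<^sub>i\<close>. This
  coefficient is the same for all representatives, as the relations involve only longer paths.\<close>

definition simple_module ::
  "'v pair_pre_digraph \<Rightarrow> 'v \<Rightarrow> (('v list \<Rightarrow> 'k::field) set, 'k) gmodule" where
  "simple_module G i =
     \<lparr>carrier = UNIV, mult = undefined, one = undefined, zero = 0, add = (+),
      smult = (\<lambda>a x. the_elem ((\<lambda>f. f [i]) ` a) * x),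
      gm_comp = (\<lambda>n. if n = 0 then UNIV else {0})\<rparr>"


section \<open>The Chebyshev algorithm\<close>

text \<open>An edge \<open>(x, y) \<in> edges t\<close> goes from \<open>x \<in> level t\<close> to \<open>y \<in> level (t - 1)\<close>, and has label
  \<open>elabel x y\<close>. Edges with label 0 are allowed and count as edges.\<close>

record ('w, 'v, 'k) resolution_graph =
  level :: "nat \<Rightarrow> 'w set"
  edges :: "nat \<Rightarrow> ('w \<times> 'w) set"
  vlabel :: "'w \<Rightarrow> 'v"
  elabel :: "'w \<Rightarrow> 'w \<Rightarrow> 'k"

definition resolution_graph ::
  "'v pair_pre_digraph \<Rightarrow> ('w, 'v, 'k::field) resolution_graph \<Rightarrow> bool" where
  "resolution_graph G R \<longleftrightarrow>
     (\<forall>t. finite (level R t)) \<and> disjoint_family (level R) \<and>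
     (\<forall>t. vlabel R ` level R t \<subseteq> pverts G) \<and>
     edges R 0 = {} \<and> (\<forall>t. edges R (Suc t) \<subseteq> level R (Suc t) \<times> level R t)"

text \<open>The graph considered in the fork moves of step \<open>s \<ge> 2\<close> for the vertex \<open>k\<close>.\<close>

definition fork_edges :: "('w, 'v, 'k) resolution_graph \<Rightarrow> nat \<Rightarrow> 'v \<Rightarrow> ('w \<times> 'w) set" where
  "fork_edges R s k = {(w', w) \<in> edges R (s - 1). w \<in> level R (s - 2) \<and> vlabel R w = k}"

definition fork_vertices :: "('w, 'v, 'k) resolution_graph \<Rightarrow> nat \<Rightarrow> 'v \<Rightarrow> 'w set" where
  "fork_vertices R s k = {w \<in> level R (s - 2). vlabel R w = k} \<union> Domain (fork_edges R s k)"

definition fork_components :: "('w, 'v, 'k) resolution_graph \<Rightarrow> nat \<Rightarrow> 'v \<Rightarrow> 'w set set" where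
  "fork_components R s k =
     fork_vertices R s k // (fork_edges R s k \<union> (fork_edges R s k)\<inverse>)\<^sup>*"

text \<open>Weightings of a component \<open>C\<close>, extended by 0 outside \<open>C \<inter> level R (s - 1)\<close>.\<close>

definition weightings ::
  "('w, 'v, 'k::field) resolution_graph \<Rightarrow> nat \<Rightarrow> 'w set \<Rightarrow> ('w \<Rightarrow> 'k) set" where
  "weightings R s C =
     {b. (\<forall>w'. w' \<notin> C \<inter> level R (s - 1) \<longrightarrow> b w' = 0) \<and>
         (\<forall>w \<in> C \<inter> level R (s - 2).
            (\<Sum>w' | w' \<in> C \<inter> level R (s - 1) \<and> (w', w) \<in> edges R (s - 1). elabel R w' w * b w') = 0)}"

definition fscale :: "'k::field \<Rightarrow> ('w \<Rightarrow> 'k) \<Rightarrow> 'w \<Rightarrow> 'k" where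
  "fscale c b = (\<lambda>w. c * b w)"

interpretation fun_vector_space: vector_space "fscale :: 'k::field \<Rightarrow> ('w \<Rightarrow> 'k) \<Rightarrow> 'w \<Rightarrow> 'k"
  by unfold_locales (auto simp: fscale_def fun_eq_iff algebra_simps)

definition is_basis :: "('w \<Rightarrow> 'k::field) set \<Rightarrow> ('w \<Rightarrow> 'k) set \<Rightarrow> bool" where
  "is_basis B V \<longleftrightarrow> fun_vector_space.independent B \<and> fun_vector_space.span B = V"

text \<open>The labels of the edges in \<open>edges R s\<close> out of \<open>x\<close>, extended by 0.\<close>

definition out_labels ::
  "('w, 'v, 'k::field) resolution_graph \<Rightarrow> nat \<Rightarrow> 'w \<Rightarrow> 'w \<Rightarrow> 'k" where
  "out_labels R s x = (\<lambda>w'. if (x, w') \<in> edges R s then elabel R x w' else 0)"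

definition forks :: "'v pair_pre_digraph \<Rightarrow> ('w, 'v, 'k) resolution_graph \<Rightarrow> nat \<Rightarrow> ('v \<times> 'w set) set" where
  "forks G R s = (if s \<ge> 2 then {(k, C). k \<in> pverts G \<and> C \<in> fork_components R s k} else {})"

text \<open>Being joined is tested on the edges to \<open>level (s - 2)\<close> only. This suffices: a fork move of step
  \<open>s\<close> with label \<open>k\<close> attaches its vertices only to vertices already joined to one labeled \<open>k\<close>.\<close>

definition singletons :: "'v pair_pre_digraph \<Rightarrow> ('w, 'v, 'k) resolution_graph \<Rightarrow> nat \<Rightarrow> ('w \<times> 'v) set" where
  "singletons G R s =
     {(v, k). v \<in> level R (s - 1) \<and> (vlabel R v, k) \<in> parcs G \<and>
              \<not> (\<exists>w. (v, w) \<in> edges R (s - 1) \<and> vlabel R w = k)}"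

text \<open>\<open>F (k, C)\<close> is the set of vertices added by the fork move for \<open>k\<close> and the component \<open>C\<close>, and
  \<open>S (v, k)\<close> is the vertex added by the singleton move for \<open>v\<close> and \<open>k\<close>.\<close>

definition chebyshev_step ::
  "'v pair_pre_digraph \<Rightarrow> ('w, 'v, 'k::field) resolution_graph \<Rightarrow> nat \<Rightarrow> bool" where
  "chebyshev_step G R s \<longleftrightarrow>
     (\<exists>F S.
        level R s = (\<Union>c\<in>forks G R s. F c) \<union> S ` singletons G R s \<and>
        disjoint_family_on F (forks G R s) \<and>
        inj_on S (singletons G R s) \<and>
        (\<Union>c\<in>forks G R s. F c) \<inter> S ` singletons G R s = {} \<and>
        (\<forall>(k, C) \<in> forks G R s.
           (\<forall>x \<in> F (k, C). vlabel R x = k \<and> edges R s `` {x} = C \<inter> level R (s - 1)) \<and>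
           inj_on (out_labels R s) (F (k, C)) \<and>
           is_basis (out_labels R s ` F (k, C)) (weightings R s C)) \<and>
        (\<forall>(v, k) \<in> singletons G R s.
           vlabel R (S (v, k)) = k \<and> edges R s `` {S (v, k)} = {v} \<and> elabel R (S (v, k)) v = 1))"

text \<open>\<open>R\<close> collects all levels of a run of the algorithm, for some choice of bases. After a step that adds
  no vertices, all further levels are empty as well.\<close>

definition chebyshev_run ::
  "'v pair_pre_digraph \<Rightarrow> 'v \<Rightarrow> ('w, 'v, 'k::field) resolution_graph \<Rightarrow> bool" where
  "chebyshev_run G i R \<longleftrightarrow>
     resolution_graph G R \<and> (\<exists>v. level R 0 = {v} \<and> vlabel R v = i) \<and>
     (\<forall>s\<ge>1. chebyshev_step G R s)"

definition chebyshev_terminates :: "('w, 'v, 'k) resolution_graph \<Rightarrow> bool" where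
  "chebyshev_terminates R \<longleftrightarrow> (\<exists>s\<ge>1. level R s = {})"


section \<open>The associated complex\<close>

definition complex_module ::
  "'v pair_pre_digraph \<Rightarrow> ('w, 'v, 'k::field) resolution_graph \<Rightarrow> nat \<Rightarrow>
   (('v list \<Rightarrow> 'k) set, 'w \<Rightarrow> ('v list \<Rightarrow> 'k) set) gmodule" where
  "complex_module G R t = gdirect_sum (level R t) (\<lambda>v. proj_module G (vlabel R v))"

definition complex_map ::
  "'v pair_pre_digraph \<Rightarrow> ('w, 'v, 'k::field) resolution_graph \<Rightarrow> nat \<Rightarrow>
   ('w \<Rightarrow> ('v list \<Rightarrow> 'k) set) \<Rightarrow> 'w \<Rightarrow> ('v list \<Rightarrow> 'k) set" where
  "complex_map G R t q =
     (\<lambda>y\<in>level R t.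
        finsum (zigzag_algebra G)
          (\<lambda>x. q x \<otimes>\<^bsub>zigzag_algebra G\<^esub>
               zigzag_class G (scaled_path (elabel R x y) [vlabel R x, vlabel R y]))
          {x \<in> level R (Suc t). (x, y) \<in> edges R (Suc t)})"

text \<open>The projection sends \<open>a = a e\<^sub>i\<close> to \<open>a \<cdot> 1\<close>.\<close>

definition augmentation ::
  "'v pair_pre_digraph \<Rightarrow> 'v \<Rightarrow> ('w, 'v, 'k::field) resolution_graph \<Rightarrow>
   ('w \<Rightarrow> ('v list \<Rightarrow> 'k) set) \<Rightarrow> 'k" where
  "augmentation G i R q = q (the_elem (level R 0)) \<odot>\<^bsub>simple_module G i\<^esub> 1"


section \<open>Chebyshev polynomials and adjacency matrices\<close>

text \<open>The index is an integer because of \<open>U\<^bsub>-1\<^esub> = 0\<close>; the value 0 at indices below \<open>-1\<close> is never used.\<close>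

function cheb_U :: "int \<Rightarrow> int poly" where
  "cheb_U t = (if t < 0 then 0 else if t = 0 then 1
               else [:0, 1:] * cheb_U (t - 1) - cheb_U (t - 2))"
  by pat_completeness auto
termination by (relation "Wellfounded.measure (\<lambda>t. nat (t + 1))") auto

declare cheb_U.simps [simp del]

definition adjacency_matrix :: "'v pair_pre_digraph \<Rightarrow> int ^ 'v ^ 'v" where
  "adjacency_matrix G = (\<chi> j k. if (j, k) \<in> parcs G then 1 else 0)"

definition poly_matrix :: "int poly \<Rightarrow> int ^ 'v ^ 'v \<Rightarrow> int ^ 'v::finite ^ 'v" where
  "poly_matrix p A = (\<Sum>n\<le>degree p. \<chi> j k. coeff p n * (((**) A ^^ n) (mat 1)) $ j $ k)"

end

theory Submission
  imports Defs
begin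

text \<open>Let \<open>z\<^sub>t\<close> be the matrix of edge labels between levels \<open>t + 1\<close> and \<open>t\<close>. Choosing bases of weightings, together
  with the singleton moves, makes the rows of \<open>z\<^sub>t\<close> with a given label \<open>k\<close> a basis of the solutions \<open>b\<close>,
  supported on neighbours of \<open>k\<close>, of the equations given by the columns of \<open>z\<^bsub>t-1\<^esub>\<close> with label \<open>k\<close>. In the
  basis of the zigzag algebra given by the idempotents, the arrows and one loop per vertex, exactness of
  the complex in the first two kinds of coordinates says just this. Exactness in the loop coordinates says
  that the columns of \<open>z\<^sub>t\<close> with a given label are independent, which is where nontermination enters.

  A nonzero relation \<open>c\<close> among these columns, with a nonzero entry \<open>c\<^sub>x\<close>, gives an endomorphism of level
  \<open>t\<close> (sending \<open>x\<close> to \<open>c\<close> and the other vertices to 0) that extends downwards to all lower levels,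
  compatibly with the \<open>z\<^sub>s\<close>. As level 0 is one-dimensional, the endomorphism is scalar there, hence on
  all levels up to \<open>t\<close> because rows are independent. So level \<open>t\<close> consists of \<open>x\<close> alone, \<open>z\<^sub>t = 0\<close>,
  and level \<open>t + 1\<close> is empty. With both kinds of independence, rank-nullity gives the Chebyshev recursion.\<close>

section \<open>Linear algebra over finite index sets\<close>

text \<open>Independence of the columns is a global fact: no single step of the algorithm enforces
  it. Endomorphisms extend downwards because the spanning property of the rows dualizes: a vector
  supported on the neighbours of a label and orthogonal to the rows of that label is a combination
  of columns of that label of the preceding matrix. The relations of the algebra change shape for
  one or two vertices. On such graphs the algorithm stops by step 2, so nontermination leaves only
  the quadratic relations. A third vertex then provides, for every edge, a further neighbour at one
  of its ends, and this kills all paths of length three. Right multiplication by an arrow moves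
  idempotent coordinates to arrow coordinates, these to loop coordinates, and loops to 0. Hence a
  preimage is found by solving two linear systems with disjoint unknowns. Minimality is a degree
  argument: a nonzero graded summand meets the degree of the generators, where the differential is
  injective.\<close>

lemma combination_if_annihilates:
  fixes f :: "'y \<Rightarrow> 'x \<Rightarrow> 'k::field"
  assumes "finite X" and "finite Y"
    and "\<And>b. (\<And>y. y \<in> Y \<Longrightarrow> (\<Sum>x\<in>X. f y x * b x) = 0) \<Longrightarrow> (\<Sum>x\<in>X. u x * b x) = 0"
  obtains d where "\<And>x. x \<in> X \<Longrightarrow> u x = (\<Sum>y\<in>Y. d y * f y x)"
proof -
  have "\<exists>d. \<forall>x\<in>X. u x = (\<Sum>y\<in>Y. d y * f y x)"
    using assms(2,3)
  proof (induction Y arbitrary: u rule: finite_induct)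
    case empty
    have "u x = 0" if "x \<in> X" for x
      using empty[of "\<lambda>x'. if x' = x then 1 else 0"] that assms(1) by (simp add: if_distrib cong: if_cong)
    then show ?case by auto
  next
    case (insert y Y)
    show ?case
    proof (cases "\<exists>b. (\<forall>y'\<in>Y. (\<Sum>x\<in>X. f y' x * b x) = 0) \<and> (\<Sum>x\<in>X. f y x * b x) \<noteq> 0")
      case False
      have "\<exists>d. \<forall>x\<in>X. u x = (\<Sum>y\<in>Y. d y * f y x)"
      proof (rule insert.IH)
        fix b assume "\<And>y. y \<in> Y \<Longrightarrow> (\<Sum>x\<in>X. f y x * b x) = 0"
        then show "(\<Sum>x\<in>X. u x * b x) = 0"
          using insert.prems[of b] False by blast
      qed
      then obtain d where d: "\<forall>x\<in>X. u x = (\<Sum>y\<in>Y. d y * f y x)" by blast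
      show ?thesis
        by (rule exI[of _ "d(y := 0)"])
          (use d insert.hyps in \<open>auto intro!: sum.cong\<close>)
    next
      case True
      then obtain b where b: "\<And>y'. y' \<in> Y \<Longrightarrow> (\<Sum>x\<in>X. f y' x * b x) = 0"
        and bnz: "(\<Sum>x\<in>X. f y x * b x) \<noteq> 0" by blast
      \<comment> \<open>\<open>b\<close> is a common zero of the functionals in \<open>Y\<close>
        that \<open>f y\<close> does not kill, and \<open>r\<close> makes \<open>u - r f y\<close>
        vanish at \<open>b\<close>. Subtracting \<open>q b\<close> turns a common zero
        \<open>a\<close> of \<open>Y\<close> into one of \<open>insert y Y\<close>, so
        \<open>u - r f y\<close> vanishes at \<open>a\<close> too.\<close>
      define r where "r = (\<Sum>x\<in>X. u x * b x) / (\<Sum>x\<in>X. f y x * b x)"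
      have "\<exists>d. \<forall>x\<in>X. u x - r * f y x = (\<Sum>y\<in>Y. d y * f y x)"
      proof (rule insert.IH)
        fix a assume a: "\<And>y. y \<in> Y \<Longrightarrow> (\<Sum>x\<in>X. f y x * a x) = 0"
        define q where "q = (\<Sum>x\<in>X. f y x * a x) / (\<Sum>x\<in>X. f y x * b x)"
        have lin: "(\<Sum>x\<in>X. g x * (a x - q * b x)) = (\<Sum>x\<in>X. g x * a x) - q * (\<Sum>x\<in>X. g x * b x)" for g
          by (simp add: sum_subtractf sum_distrib_left right_diff_distrib mult.left_commute)
        have "(\<Sum>x\<in>X. u x * (a x - q * b x)) = 0"
        proof (rule insert.prems)
          have "q * (\<Sum>x\<in>X. f y x * b x) = (\<Sum>x\<in>X. f y x * a x)" using bnz by (simp add: q_def)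
          then show "(\<Sum>x\<in>X. f y' x * (a x - q * b x)) = 0" if "y' \<in> insert y Y" for y'
            using a b that unfolding lin by auto
        qed
        then have "(\<Sum>x\<in>X. u x * a x) = r * (\<Sum>x\<in>X. f y x * a x)"
          unfolding lin by (simp add: q_def r_def)
        then show "(\<Sum>x\<in>X. (u x - r * f y x) * a x) = 0"
          by (simp add: left_diff_distrib sum_subtractf sum_distrib_left mult.assoc)
      qed
      then obtain d where d: "\<forall>x\<in>X. u x - r * f y x = (\<Sum>y\<in>Y. d y * f y x)" by blast
      show ?thesis
      proof (intro exI ballI)
        fix x assume "x \<in> X"
        have "(\<Sum>y'\<in>insert y Y. (d(y := r)) y' * f y' x) = r * f y x + (\<Sum>y'\<in>Y. d y' * f y' x)"
          using insert.hyps by (simp, intro sum.cong) auto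
        then show "u x = (\<Sum>y'\<in>insert y Y. (d(y := r)) y' * f y' x)"
          using d \<open>x \<in> X\<close> by (simp add: algebra_simps)
      qed
    qed
  qed
  then show thesis using that by blast
qed

text \<open>Dual vectors exist: if no \<open>b\<close> separated \<open>f y\<close> from the other
  rows, then \<open>f y\<close> would vanish on their common zeros and so be a combination of them.
  An arbitrary right-hand side is reached by combining the dual vectors.\<close>

lemma linear_system_solvable:
  fixes f :: "'y \<Rightarrow> 'x \<Rightarrow> 'k::field"
  assumes "finite X" and "finite Y"
    and indep: "\<And>c. (\<And>x. x \<in> X \<Longrightarrow> (\<Sum>y\<in>Y. c y * f y x) = 0) \<Longrightarrow> \<forall>y\<in>Y. c y = 0"
  obtains b where "\<And>y. y \<in> Y \<Longrightarrow> (\<Sum>x\<in>X. f y x * b x) = \<gamma> y"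
proof -
  have dual: "\<exists>b. \<forall>y'\<in>Y. (\<Sum>x\<in>X. f y' x * b x) = (if y' = y then 1 else 0)" if "y \<in> Y" for y
  proof (rule ccontr)
    assume no: "\<not> ?thesis"
    have van: "(\<Sum>x\<in>X. f y x * b x) = 0"
      if b: "\<And>y'. y' \<in> Y - {y} \<Longrightarrow> (\<Sum>x\<in>X. f y' x * b x) = 0" for b
    proof (rule ccontr)
      assume nz: "(\<Sum>x\<in>X. f y x * b x) \<noteq> 0"
      have "\<forall>y'\<in>Y. (\<Sum>x\<in>X. f y' x * (b x / (\<Sum>x\<in>X. f y x * b x))) = (if y' = y then 1 else 0)"
        using b nz by (auto simp: sum_divide_distrib[symmetric])
      with no show False by (elim notE) (rule exI[of _ "\<lambda>x. b x / (\<Sum>x\<in>X. f y x * b x)"])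
    qed
    obtain d where d: "\<And>x. x \<in> X \<Longrightarrow> f y x = (\<Sum>y'\<in>Y - {y}. d y' * f y' x)"
      by (rule combination_if_annihilates[of X "Y - {y}" f "f y"]) (use assms(1,2) van in auto)
    have "\<forall>y'\<in>Y. (d(y := -1)) y' = 0"
    proof (rule indep)
      fix x assume "x \<in> X"
      have "(\<Sum>y'\<in>Y. (d(y := -1)) y' * f y' x) = - f y x + (\<Sum>y'\<in>Y - {y}. (d(y := -1)) y' * f y' x)"
        by (subst sum.remove[OF assms(2) that]) simp
      also have "(\<Sum>y'\<in>Y - {y}. (d(y := -1)) y' * f y' x) = f y x"
        unfolding d[OF \<open>x \<in> X\<close>] by (intro sum.cong) auto
      finally show "(\<Sum>y'\<in>Y. (d(y := -1)) y' * f y' x) = 0" by simp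
    qed
    with that show False by (metis fun_upd_same neg_equal_0_iff_equal one_neq_zero)
  qed
  then obtain B where B: "\<And>y y'. y \<in> Y \<Longrightarrow> y' \<in> Y \<Longrightarrow> (\<Sum>x\<in>X. f y' x * B y x) = (if y' = y then 1 else 0)"
    by metis
  show thesis
  proof (rule that[of "\<lambda>x. \<Sum>y\<in>Y. \<gamma> y * B y x"])
    fix y assume "y \<in> Y"
    have "(\<Sum>x\<in>X. f y x * (\<Sum>y'\<in>Y. \<gamma> y' * B y' x)) = (\<Sum>y'\<in>Y. \<gamma> y' * (\<Sum>x\<in>X. f y x * B y' x))"
      by (simp add: sum_distrib_left mult.left_commute sum.swap[of _ X])
    also have "\<dots> = (\<Sum>y'\<in>Y. if y = y' then \<gamma> y' else 0)"
      using \<open>y \<in> Y\<close> by (intro sum.cong) (auto simp: B)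
    also have "\<dots> = \<gamma> y" using \<open>y \<in> Y\<close> assms(2) by simp
    finally show "(\<Sum>x\<in>X. f y x * (\<Sum>y'\<in>Y. \<gamma> y' * B y' x)) = \<gamma> y" .
  qed
qed

lemma sum_fscale_apply: "(\<Sum>a\<in>A. fscale (c a) (g a)) x = (\<Sum>a\<in>A. c a * g a x)"
  by (induction A rule: infinite_finite_induct) (auto simp: fscale_def)

text \<open>Passes from sets of vectors to families indexed by vertices; injectivity allows
  coefficients to be carried across by \<open>the_inv_into\<close>.\<close>

lemma independent_image_iff:
  fixes g :: "'i \<Rightarrow> 'x \<Rightarrow> 'k::field"
  assumes "finite I" and "inj_on g I"
  shows "fun_vector_space.independent (g ` I) \<longleftrightarrow>
    (\<forall>c. (\<forall>x. (\<Sum>i\<in>I. c i * g i x) = 0) \<longrightarrow> (\<forall>i\<in>I. c i = 0))" (is "_ \<longleftrightarrow> ?R")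
proof -
  have sum: "(\<Sum>v\<in>g ` I. fscale (c v) v) = 0 \<longleftrightarrow> (\<forall>x. (\<Sum>i\<in>I. c (g i) * g i x) = 0)" for c
    by (auto simp: sum.reindex[OF assms(2)] fun_eq_iff sum_fscale_apply zero_fun_def)
  have "fun_vector_space.independent (g ` I) \<longleftrightarrow>
    (\<forall>c. (\<forall>x. (\<Sum>i\<in>I. c (g i) * g i x) = 0) \<longrightarrow> (\<forall>i\<in>I. c (g i) = 0))"
    using assms(1) by (auto simp: fun_vector_space.dependent_finite sum)
  also have "\<dots> \<longleftrightarrow> ?R"
  proof (intro iffI allI impI)
    fix c assume L: "\<forall>c. (\<forall>x. (\<Sum>i\<in>I. c (g i) * g i x) = 0) \<longrightarrow> (\<forall>i\<in>I. c (g i) = 0)"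
      and c: "\<forall>x. (\<Sum>i\<in>I. c i * g i x) = 0"
    have "\<forall>x. (\<Sum>i\<in>I. c (the_inv_into I g (g i)) * g i x) = 0"
      using c by (simp add: the_inv_into_f_f[OF assms(2)])
    then have "\<forall>i\<in>I. c (the_inv_into I g (g i)) = 0"
      using L[rule_format, of "\<lambda>v. c (the_inv_into I g v)"] by blast
    then show "\<forall>i\<in>I. c i = 0" by (simp add: the_inv_into_f_f[OF assms(2)])
  next
    fix c assume "?R" "\<forall>x. (\<Sum>i\<in>I. c (g i) * g i x) = 0"
    then show "\<forall>i\<in>I. c (g i) = 0" by (auto dest!: spec[of _ "\<lambda>i. c (g i)"])
  qed
  finally show ?thesis .
qed

lemma in_span_image_iff:
  fixes g :: "'i \<Rightarrow> 'x \<Rightarrow> 'k::field"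
  assumes "finite I" and "inj_on g I"
  shows "b \<in> fun_vector_space.span (g ` I) \<longleftrightarrow> (\<exists>c. \<forall>x. b x = (\<Sum>i\<in>I. c i * g i x))"
proof -
  have "b \<in> fun_vector_space.span (g ` I) \<longleftrightarrow> (\<exists>u. b = (\<Sum>v\<in>g ` I. fscale (u v) v))"
    using assms(1) by (auto simp: fun_vector_space.span_finite)
  also have "\<dots> \<longleftrightarrow> (\<exists>u. \<forall>x. b x = (\<Sum>i\<in>I. u (g i) * g i x))"
    by (auto simp: sum.reindex[OF assms(2)] fun_eq_iff sum_fscale_apply)
  also have "\<dots> \<longleftrightarrow> (\<exists>c. \<forall>x. b x = (\<Sum>i\<in>I. c i * g i x))"
  proof
    assume "\<exists>c. \<forall>x. b x = (\<Sum>i\<in>I. c i * g i x)"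
    then obtain c where "\<forall>x. b x = (\<Sum>i\<in>I. c i * g i x)" by blast
    then have "\<forall>x. b x = (\<Sum>i\<in>I. c (the_inv_into I g (g i)) * g i x)"
      by (simp add: the_inv_into_f_f[OF assms(2)])
    then show "\<exists>u. \<forall>x. b x = (\<Sum>i\<in>I. u (g i) * g i x)" by (intro exI[of _ "\<lambda>v. c (the_inv_into I g v)"])
  next
    assume "\<exists>u. \<forall>x. b x = (\<Sum>i\<in>I. u (g i) * g i x)"
    then obtain u where "\<forall>x. b x = (\<Sum>i\<in>I. u (g i) * g i x)" by blast
    then show "\<exists>c. \<forall>x. b x = (\<Sum>i\<in>I. c i * g i x)" by (intro exI[of _ "\<lambda>i. u (g i)"])
  qed
  finally show ?thesis .
qed

text \<open>The family, cut off outside \<open>X\<close>, and the unit vectors are two independent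
  sets, each in the span of the other; the exchange bound applies in both directions.\<close>

lemma card_eq_if_basis_family:
  fixes g :: "'i \<Rightarrow> 'x \<Rightarrow> 'k::field"
  assumes "finite I" and "finite X"
    and indep: "\<And>c. (\<And>x. x \<in> X \<Longrightarrow> (\<Sum>i\<in>I. c i * g i x) = 0) \<Longrightarrow> \<forall>i\<in>I. c i = 0"
    and span: "\<And>b. \<exists>c. \<forall>x\<in>X. b x = (\<Sum>i\<in>I. c i * g i x)"
  shows "card I = card X"
proof -
  define h where "h i x = (if x \<in> X then g i x else 0)" for i x
  define e :: "'x \<Rightarrow> 'x \<Rightarrow> 'k" where "e x = (\<lambda>x'. if x' = x then 1 else 0)" for x
  have ind: "\<forall>i\<in>I. c i = 0" if "\<forall>x. (\<Sum>i\<in>I. c i * h i x) = 0" for c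
  proof (rule indep)
    fix x assume "x \<in> X"
    then show "(\<Sum>i\<in>I. c i * g i x) = 0" using that[THEN spec, of x] by (simp add: h_def)
  qed
  \<comment> \<open>A coincidence \<open>h i = h j\<close> would be a relation with coefficients 1
    and -1. Injectivity ensures that counting vectors counts indices.\<close>
  have inj_h: "inj_on h I"
  proof (rule inj_onI, rule ccontr)
    fix i j assume ij: "i \<in> I" "j \<in> I" "h i = h j" "i \<noteq> j"
    define c :: "'i \<Rightarrow> 'k" where "c = (\<lambda>_. 0)(i := 1, j := -1)"
    have "\<forall>i\<in>I. c i = 0"
    proof (rule ind, rule allI)
      fix x
      have "(\<Sum>k\<in>I. c k * h k x) = (\<Sum>k\<in>{i, j}. c k * h k x)"
        using ij assms(1) by (intro sum.mono_neutral_right) (auto simp: c_def)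
      then show "(\<Sum>k\<in>I. c k * h k x) = 0" using ij by (simp add: c_def)
    qed
    then show False using ij by (auto simp: c_def split: if_splits)
  qed
  have inj_e: "inj_on e X" by (rule inj_onI) (metis e_def one_neq_zero)
  have e_sum: "(\<Sum>x\<in>X. c x * e x x') = (if x' \<in> X then c x' else 0)" for c x'
    using assms(2) by (simp add: e_def if_distrib cong: if_cong)
  have ih: "fun_vector_space.independent (h ` I)"
    unfolding independent_image_iff[OF assms(1) inj_h] using ind by blast
  have ie: "fun_vector_space.independent (e ` X)"
    unfolding independent_image_iff[OF assms(2) inj_e] e_sum by (auto split: if_splits)
  have he: "h ` I \<subseteq> fun_vector_space.span (e ` X)"
    unfolding in_span_image_iff[OF assms(2) inj_e] subset_iff e_sum by (auto simp: h_def)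
  have eh: "e ` X \<subseteq> fun_vector_space.span (h ` I)"
  proof (rule image_subsetI)
    fix x assume x: "x \<in> X"
    obtain c where "\<forall>x'\<in>X. e x x' = (\<Sum>i\<in>I. c i * g i x')" using span[of "e x"] by blast
    moreover have "e x x' = 0" if "x' \<notin> X" for x'
      using that x by (auto simp: e_def)
    ultimately have "e x x' = (\<Sum>i\<in>I. c i * h i x')" for x'
      by (cases "x' \<in> X") (auto simp: h_def)
    then show "e x \<in> fun_vector_space.span (h ` I)"
      unfolding in_span_image_iff[OF assms(1) inj_h] by blast
  qed
  have "card (h ` I) \<le> card (e ` X)" "card (e ` X) \<le> card (h ` I)"
    using fun_vector_space.independent_span_bound[OF _ ih he]
      fun_vector_space.independent_span_bound[OF _ ie eh] assms(1,2) by auto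
  then show ?thesis by (simp add: card_image inj_h inj_e)
qed

text \<open>Rank-nullity in terms of families: independent rows make \<open>M\<close> surjective, so
  unit vectors have preimages \<open>B\<close>. Together with the kernel basis \<open>g\<close> they
  form a basis of all functions on \<open>X\<close>, indexed by the disjoint sum of \<open>W\<close>
  and \<open>Y\<close>.\<close>

lemma card_kernel_basis:
  fixes M :: "'y \<Rightarrow> 'x \<Rightarrow> 'k::field" and g :: "'w \<Rightarrow> 'x \<Rightarrow> 'k"
  assumes "finite X" "finite Y" "finite W"
    and M: "\<And>c. (\<And>x. x \<in> X \<Longrightarrow> (\<Sum>y\<in>Y. c y * M y x) = 0) \<Longrightarrow> \<forall>y\<in>Y. c y = 0"
    and g: "\<And>c. (\<And>x. x \<in> X \<Longrightarrow> (\<Sum>w\<in>W. c w * g w x) = 0) \<Longrightarrow> \<forall>w\<in>W. c w = 0"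
    and ker: "\<And>w y. w \<in> W \<Longrightarrow> y \<in> Y \<Longrightarrow> (\<Sum>x\<in>X. M y x * g w x) = 0"
    and span: "\<And>b. (\<And>y. y \<in> Y \<Longrightarrow> (\<Sum>x\<in>X. M y x * b x) = 0) \<Longrightarrow>
      \<exists>c. \<forall>x\<in>X. b x = (\<Sum>w\<in>W. c w * g w x)"
  shows "card W + card Y = card X"
proof -
  have "\<exists>b. \<forall>y\<in>Y. (\<Sum>x\<in>X. M y x * b x) = (if y = y0 then 1 else 0)" for y0
    using linear_system_solvable[of X Y M "\<lambda>y. if y = y0 then 1 else 0"] assms(1,2) M by metis
  then obtain B where B: "\<And>y y0. y \<in> Y \<Longrightarrow> (\<Sum>x\<in>X. M y x * B y0 x) = (if y = y0 then 1 else 0)"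
    by metis
  define h where "h = case_sum g B"
  have split: "(\<Sum>i\<in>Sum_Type.Plus W Y. c i * h i x) = (\<Sum>w\<in>W. c (Inl w) * g w x) + (\<Sum>y\<in>Y. c (Inr y) * B y x)" for c x
    using assms by (simp add: sum.Plus h_def)
  have MB: "(\<Sum>x\<in>X. M y x * (\<Sum>y'\<in>Y. c y' * B y' x)) = c y" if "y \<in> Y" for c y
  proof -
    have "(\<Sum>x\<in>X. M y x * (\<Sum>y'\<in>Y. c y' * B y' x)) = (\<Sum>y'\<in>Y. c y' * (\<Sum>x\<in>X. M y x * B y' x))"
      by (simp add: sum_distrib_left mult.left_commute sum.swap[of _ X])
    also have "\<dots> = c y"
      using that assms(2) by (simp add: B if_distrib cong: if_cong)
    finally show ?thesis .
  qed
  have Mg: "(\<Sum>x\<in>X. M y x * (\<Sum>w\<in>W. c w * g w x)) = 0" if "y \<in> Y" for c y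
  proof -
    have "(\<Sum>x\<in>X. M y x * (\<Sum>w\<in>W. c w * g w x)) = (\<Sum>w\<in>W. c w * (\<Sum>x\<in>X. M y x * g w x))"
      by (simp add: sum_distrib_left mult.left_commute sum.swap[of _ X])
    then show ?thesis using ker that by simp
  qed
  have "card (Sum_Type.Plus W Y) = card X"
  proof (rule card_eq_if_basis_family)
    show "finite (Sum_Type.Plus W Y)" "finite X" using assms by auto
  next
    fix c assume "\<And>x. x \<in> X \<Longrightarrow> (\<Sum>i\<in>Sum_Type.Plus W Y. c i * h i x) = 0"
    then have c: "(\<Sum>w\<in>W. c (Inl w) * g w x) + (\<Sum>y\<in>Y. c (Inr y) * B y x) = 0" if "x \<in> X" for x
      using that by (simp add: split)
    have Y0: "c (Inr y) = 0" if "y \<in> Y" for y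
    proof -
      have "0 = (\<Sum>x\<in>X. M y x * ((\<Sum>w\<in>W. c (Inl w) * g w x) + (\<Sum>y\<in>Y. c (Inr y) * B y x)))"
        using c by simp
      also have "\<dots> = c (Inr y)"
        unfolding distrib_left sum.distrib Mg[OF that] MB[OF that] by simp
      finally show ?thesis by simp
    qed
    have "\<forall>w\<in>W. c (Inl w) = 0"
      by (rule g) (use c Y0 in auto)
    then show "\<forall>i\<in>Sum_Type.Plus W Y. c i = 0" using Y0 by auto
  next
    fix b :: "'x \<Rightarrow> 'k"
    \<comment> \<open>The value of \<open>M\<close> at \<open>b\<close>; subtracting the same
      combination of the \<open>B y\<close> leaves a vector in the kernel.\<close>
    define r where "r y = (\<Sum>x\<in>X. M y x * b x)" for y
    have "\<exists>c. \<forall>x\<in>X. b x - (\<Sum>y\<in>Y. r y * B y x) = (\<Sum>w\<in>W. c w * g w x)"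
    proof (rule span)
      fix y assume "y \<in> Y"
      then show "(\<Sum>x\<in>X. M y x * (b x - (\<Sum>y\<in>Y. r y * B y x))) = 0"
        unfolding right_diff_distrib sum_subtractf by (simp add: MB) (simp add: r_def)
    qed
    then obtain c where "\<forall>x\<in>X. b x - (\<Sum>y\<in>Y. r y * B y x) = (\<Sum>w\<in>W. c w * g w x)" by blast
    then show "\<exists>c. \<forall>x\<in>X. b x = (\<Sum>i\<in>Sum_Type.Plus W Y. c i * h i x)"
      by (intro exI[of _ "case_sum c r"]) (simp add: split diff_eq_eq)
  qed
  then show ?thesis using assms by (simp add: card_Plus)
qed

section \<open>The matrices of the Chebyshev algorithm\<close>

locale chebyshev =
  fixes G :: "'v::finite pair_pre_digraph" and i :: 'v
    and R :: "('w, 'v, 'k::field) resolution_graph"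
  assumes pair_graph: "pair_graph G" and pverts_UNIV: "pverts G = UNIV"
    and run: "chebyshev_run G i R"
begin

abbreviation V :: "nat \<Rightarrow> 'w set" where "V \<equiv> level R"
abbreviation lab :: "'w \<Rightarrow> 'v" where "lab \<equiv> vlabel R"
abbreviation Z :: "nat \<Rightarrow> 'w \<Rightarrow> 'w \<Rightarrow> 'k" where "Z t \<equiv> out_labels R (Suc t)"

section \<open>Fork components and the choices made in one step\<close>

definition joined :: "nat \<Rightarrow> 'v \<Rightarrow> 'w set" where
  "joined t k = {x \<in> V t. \<exists>y. (x, y) \<in> edges R t \<and> lab y = k}"

text \<open>Index shift: these are the components treated in step \<open>t + 1\<close>, with upper
  vertices in level \<open>t\<close> and lower ones in level \<open>t - 1\<close>. Step 1 has no
  fork moves; there, truncated subtraction in \<open>fork_components\<close> would point at level 0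
  itself.\<close>

definition components :: "nat \<Rightarrow> 'v \<Rightarrow> 'w set set" where
  "components t k = (if t = 0 then {} else fork_components R (Suc t) k)"

lemma arcs_sym: "(u, v) \<in> parcs G \<longleftrightarrow> (v, u) \<in> parcs G"
proof -
  interpret pair_graph G by (rule pair_graph)
  show ?thesis using arcs_symmetric by blast
qed

lemma arcs_irrefl: "(v, v) \<notin> parcs G"
proof -
  interpret pair_graph G by (rule pair_graph)
  show ?thesis using pair_no_loops[of "(v, v)"] by auto
qed

lemma resolution_graph: "resolution_graph G R"
  using run by (simp add: chebyshev_run_def)

lemma finite_level: "finite (V t)"
  using resolution_graph by (simp add: resolution_graph_def)

lemma level_disjoint: "x \<in> V s \<Longrightarrow> x \<in> V t \<Longrightarrow> s = t"
  using resolution_graph by (auto simp: resolution_graph_def disjoint_family_on_def)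

lemma edges_0: "edges R 0 = {}"
  using resolution_graph by (simp add: resolution_graph_def)

lemma edges_level: "(x, y) \<in> edges R (Suc t) \<Longrightarrow> x \<in> V (Suc t) \<and> y \<in> V t"
  using resolution_graph by (auto simp: resolution_graph_def)

lemma level_0: obtains v where "V 0 = {v}" and "lab v = i"
  using run by (auto simp: chebyshev_run_def)

lemma Z_nonzero_edge: "Z t x y \<noteq> 0 \<Longrightarrow> (x, y) \<in> edges R (Suc t)"
  by (auto simp: out_labels_def split: if_splits)

lemma joined_Suc: "x \<in> joined (Suc t) k \<longleftrightarrow> x \<in> Domain (fork_edges R (Suc (Suc t)) k)"
  using edges_level by (auto simp: joined_def fork_edges_def)

lemma component_eq_iff:
  assumes "C \<in> components t k" and "x \<in> C" and "C' \<in> components t k" and "x \<in> C'"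
  shows "C = C'"
proof -
  let ?r = "(fork_edges R (Suc t) k \<union> (fork_edges R (Suc t) k)\<inverse>)\<^sup>*"
  have "equiv UNIV ?r"
    by (intro equivI refl_rtrancl trans_rtrancl sym_rtrancl) (auto simp: sym_def)
  obtain a b where "C = ?r `` {a}" "C' = ?r `` {b}"
    using assms by (auto simp: components_def fork_components_def quotient_def split: if_splits)
  then show ?thesis using assms(2,4) equiv_class_eq[OF \<open>equiv UNIV ?r\<close>] by (metis Image_singleton_iff)
qed

lemma ex_component:
  assumes "x \<in> joined t k"
  obtains C where "C \<in> components t k" and "x \<in> C"
proof -
  obtain s where [simp]: "t = Suc s" using assms edges_0 by (cases t) (auto simp: joined_def)
  show thesis
    by (rule that[of "(fork_edges R (Suc t) k \<union> (fork_edges R (Suc t) k)\<inverse>)\<^sup>* `` {x}"])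
      (use assms joined_Suc[of x s k] in
        \<open>auto simp: components_def fork_components_def fork_vertices_def intro: quotientI\<close>)
qed

text \<open>Only lower vertices can be isolated in a fork graph; a vertex of level \<open>t\<close>
  enters it through an edge. So fork moves for \<open>k\<close> attach to vertices already joined to
  \<open>k\<close>, singleton moves to the others, and the matrix of a step is block diagonal for
  each label.\<close>

lemma component_subset_joined:
  assumes C: "C \<in> components t k" and x: "x \<in> C" "x \<in> V t"
  shows "x \<in> joined t k"
proof -
  obtain s where t[simp]: "t = Suc s" using C by (cases t) (auto simp: components_def)
  let ?E = "fork_edges R (Suc t) k"
  obtain a where a: "a \<in> fork_vertices R (Suc t) k" and "C = (?E \<union> ?E\<inverse>)\<^sup>* `` {a}"
    using C by (auto simp: components_def fork_components_def quotient_def)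
  then have "(a, x) \<in> (?E \<union> ?E\<inverse>)\<^sup>*" using x by simp
  then have "x = a \<or> x \<in> Field ?E"
    by (induction rule: rtrancl_induct) (auto simp: Field_def)
  moreover have "y \<notin> V t" if "y \<in> V s" for y
    using level_disjoint[OF that, of t] t by auto
  ultimately have "x \<in> Domain ?E"
    using a x by (auto simp: fork_vertices_def Field_def fork_edges_def)
  then show ?thesis by (simp add: joined_Suc)
qed

lemma component_edge_iff:
  assumes C: "C \<in> components (Suc t) k" and e: "(x, y) \<in> edges R (Suc t)" "lab y = k"
  shows "x \<in> C \<longleftrightarrow> y \<in> C"
proof -
  let ?E = "fork_edges R (Suc (Suc t)) k"
  obtain a where "C = (?E \<union> ?E\<inverse>)\<^sup>* `` {a}"
    using C by (auto simp: components_def fork_components_def quotient_def)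
  moreover have "(x, y) \<in> ?E" using e edges_level by (auto simp: fork_edges_def)
  ultimately show ?thesis
    by (auto intro: rtrancl_into_rtrancl)
qed

text \<open>One step with its choices \<open>F\<close> and \<open>S\<close>, restated for the matrix
  \<open>Z t\<close>. The basis property is split into independence, membership and spanning by
  coefficient families. As a predicate it lets several lemmas refer to the same choice.\<close>

definition step_choice :: "nat \<Rightarrow> ('v \<Rightarrow> 'w set \<Rightarrow> 'w set) \<Rightarrow> ('w \<Rightarrow> 'v \<Rightarrow> 'w) \<Rightarrow> bool" where
  "step_choice t F S \<longleftrightarrow>
    (\<forall>k. {w \<in> V (Suc t). lab w = k} = (\<Union>C\<in>components t k. F k C) \<union>
      (\<lambda>v. S v k) ` {v \<in> V t - joined t k. (lab v, k) \<in> parcs G}) \<and>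
    (\<forall>k C w x. C \<in> components t k \<longrightarrow> w \<in> F k C \<longrightarrow> ((w, x) \<in> edges R (Suc t) \<longleftrightarrow> x \<in> C \<inter> V t)) \<and>
    (\<forall>k C \<alpha>. C \<in> components t k \<longrightarrow> (\<forall>x. (\<Sum>w\<in>F k C. \<alpha> w * Z t w x) = 0) \<longrightarrow> (\<forall>w\<in>F k C. \<alpha> w = 0)) \<and>
    (\<forall>k C w. C \<in> components t k \<longrightarrow> w \<in> F k C \<longrightarrow> Z t w \<in> weightings R (Suc t) C) \<and>
    (\<forall>k C b. C \<in> components t k \<longrightarrow> b \<in> weightings R (Suc t) C \<longrightarrow>
      (\<exists>\<alpha>. \<forall>x. b x = (\<Sum>w\<in>F k C. \<alpha> w * Z t w x))) \<and>
    (\<forall>k v x. v \<in> V t - joined t k \<longrightarrow> (lab v, k) \<in> parcs G \<longrightarrow>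
      ((S v k, x) \<in> edges R (Suc t) \<longleftrightarrow> x = v) \<and> Z t (S v k) v = 1)"

lemma ex_step_choice: obtains F S where "step_choice t F S"
proof -
  have "chebyshev_step G R (Suc t)" using run by (simp add: chebyshev_run_def)
  then obtain F S where
    lev: "V (Suc t) = (\<Union>c\<in>forks G R (Suc t). F c) \<union> S ` singletons G R (Suc t)"
    and F: "\<forall>(k, C) \<in> forks G R (Suc t).
         (\<forall>x \<in> F (k, C). lab x = k \<and> edges R (Suc t) `` {x} = C \<inter> V t) \<and>
         inj_on (Z t) (F (k, C)) \<and> is_basis (Z t ` F (k, C)) (weightings R (Suc t) C)"
    and S: "\<forall>(v, k) \<in> singletons G R (Suc t).
         lab (S (v, k)) = k \<and> edges R (Suc t) `` {S (v, k)} = {v} \<and> elabel R (S (v, k)) v = 1"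
    unfolding chebyshev_step_def by auto
  have forks: "(k, C) \<in> forks G R (Suc t) \<longleftrightarrow> C \<in> components t k" for k C
    by (auto simp: forks_def components_def pverts_UNIV)
  have sing: "(v, k) \<in> singletons G R (Suc t) \<longleftrightarrow> v \<in> V t - joined t k \<and> (lab v, k) \<in> parcs G" for v k
    by (auto simp: singletons_def joined_def)
  have F': "lab x = k" "edges R (Suc t) `` {x} = C \<inter> V t" if "C \<in> components t k" "x \<in> F (k, C)" for k C x
    using bspec[OF F, of "(k, C)"] that forks[of k C] by auto
  have F'': "inj_on (Z t) (F (k, C))" "is_basis (Z t ` F (k, C)) (weightings R (Suc t) C)"
    if "C \<in> components t k" for k C
    using bspec[OF F, of "(k, C)"] that forks[of k C] by auto
  have S': "lab (S (v, k)) = k" "edges R (Suc t) `` {S (v, k)} = {v}" "elabel R (S (v, k)) v = 1"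
    if "v \<in> V t - joined t k" "(lab v, k) \<in> parcs G" for v k
    using bspec[OF S, of "(v, k)"] that sing[of v k] by auto
  have fin: "finite (F (k, C))" if "C \<in> components t k" for k C
    by (rule finite_subset[OF _ finite_level[of "Suc t"]]) (use that lev forks in blast)
  show thesis
  proof (rule that[of "\<lambda>k C. F (k, C)" "\<lambda>v k. S (v, k)"], unfold step_choice_def, intro conjI allI impI)
    fix k
    show "{w \<in> V (Suc t). lab w = k} = (\<Union>C\<in>components t k. F (k, C)) \<union>
      (\<lambda>v. S (v, k)) ` {v \<in> V t - joined t k. (lab v, k) \<in> parcs G}" (is "?L = ?R")
    proof (intro equalityI subsetI)
      fix w assume w: "w \<in> ?L"
      then consider k' C where "C \<in> components t k'" "w \<in> F (k', C)"
        | v k' where "v \<in> V t - joined t k'" "(lab v, k') \<in> parcs G" "w = S (v, k')"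
        unfolding lev using forks sing by fastforce
      then show "w \<in> ?R"
      proof cases
        case 1
        then have "k' = k" using F'(1) w by auto
        then show ?thesis using 1 by blast
      next
        case 2
        then have "k' = k" using S'(1)[of v k'] w by auto
        then show ?thesis using 2 by blast
      qed
    next
      fix w assume "w \<in> ?R"
      then consider C where "C \<in> components t k" "w \<in> F (k, C)"
        | v where "v \<in> V t - joined t k" "(lab v, k) \<in> parcs G" "w = S (v, k)" by blast
      then show "w \<in> ?L"
      proof cases
        case 1
        then show ?thesis using F'(1)[OF 1] forks[of k C] by (auto simp: lev)
      next
        case 2
        then show ?thesis using S'(1)[OF 2(1,2)] sing[of v k] by (auto simp: lev)
      qed
    qed
  next
    fix k C w x assume "C \<in> components t k" "w \<in> F (k, C)"
    then show "(w, x) \<in> edges R (Suc t) \<longleftrightarrow> x \<in> C \<inter> V t" using F'(2) by blast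
  next
    fix k C \<alpha> assume C: "C \<in> components t k" and z: "\<forall>x. (\<Sum>w\<in>F (k, C). \<alpha> w * Z t w x) = 0"
    have "fun_vector_space.independent (Z t ` F (k, C))" using F''(2)[OF C] by (simp add: is_basis_def)
    then show "\<forall>w\<in>F (k, C). \<alpha> w = 0"
      using z by (simp add: independent_image_iff[OF fin[OF C] F''(1)[OF C]])
  next
    fix k C w assume C: "C \<in> components t k" and "w \<in> F (k, C)"
    then show "Z t w \<in> weightings R (Suc t) C"
      using F''(2)[OF C] fun_vector_space.span_superset[of "Z t ` F (k, C)"] by (auto simp: is_basis_def)
  next
    fix k C b assume C: "C \<in> components t k" and "b \<in> weightings R (Suc t) C"
    then have "b \<in> fun_vector_space.span (Z t ` F (k, C))" using F''(2)[OF C] by (simp add: is_basis_def)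
    then show "\<exists>\<alpha>. \<forall>x. b x = (\<Sum>w\<in>F (k, C). \<alpha> w * Z t w x)"
      by (simp add: in_span_image_iff[OF fin[OF C] F''(1)[OF C]])
  next
    fix k v x assume "v \<in> V t - joined t k" "(lab v, k) \<in> parcs G"
    then have "edges R (Suc t) `` {S (v, k)} = {v}" "elabel R (S (v, k)) v = 1" using S' by auto
    then show "(S (v, k), x) \<in> edges R (Suc t) \<longleftrightarrow> x = v" "Z t (S (v, k)) v = 1"
      by (auto simp: out_labels_def)
  qed
qed

lemma
  assumes "step_choice t F S"
  shows step_cover: "{w \<in> V (Suc t). lab w = k} = (\<Union>C\<in>components t k. F k C) \<union>
      (\<lambda>v. S v k) ` {v \<in> V t - joined t k. (lab v, k) \<in> parcs G}"
    and step_fork_edges: "C \<in> components t k \<Longrightarrow> w \<in> F k C \<Longrightarrow> (w, x) \<in> edges R (Suc t) \<longleftrightarrow> x \<in> C \<inter> V t"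
    and step_fork_independent: "C \<in> components t k \<Longrightarrow> \<forall>x. (\<Sum>w\<in>F k C. \<alpha> w * Z t w x) = 0 \<Longrightarrow> w \<in> F k C \<Longrightarrow> \<alpha> w = 0"
    and step_fork_weighting: "C \<in> components t k \<Longrightarrow> w \<in> F k C \<Longrightarrow> Z t w \<in> weightings R (Suc t) C"
    and step_fork_span: "C \<in> components t k \<Longrightarrow> b \<in> weightings R (Suc t) C \<Longrightarrow>
      \<exists>\<alpha>. \<forall>x. b x = (\<Sum>w\<in>F k C. \<alpha> w * Z t w x)"
    and step_singleton: "v \<in> V t - joined t k \<Longrightarrow> (lab v, k) \<in> parcs G \<Longrightarrow>
      ((S v k, x) \<in> edges R (Suc t) \<longleftrightarrow> x = v) \<and> Z t (S v k) v = 1"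
proof -
  note a1 = assms[unfolded step_choice_def]
  note a2 = a1[THEN conjunct2] note a3 = a2[THEN conjunct2] note a4 = a3[THEN conjunct2]
  note a5 = a4[THEN conjunct2] note a6 = a5[THEN conjunct2]
  show "{w \<in> V (Suc t). lab w = k} = (\<Union>C\<in>components t k. F k C) \<union>
      (\<lambda>v. S v k) ` {v \<in> V t - joined t k. (lab v, k) \<in> parcs G}"
    by (rule a1[THEN conjunct1, THEN spec])
  show "C \<in> components t k \<Longrightarrow> w \<in> F k C \<Longrightarrow> (w, x) \<in> edges R (Suc t) \<longleftrightarrow> x \<in> C \<inter> V t"
    by (rule a2[THEN conjunct1, rule_format])
  show "C \<in> components t k \<Longrightarrow> \<forall>x. (\<Sum>w\<in>F k C. \<alpha> w * Z t w x) = 0 \<Longrightarrow> w \<in> F k C \<Longrightarrow> \<alpha> w = 0"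
    by (rule a3[THEN conjunct1, THEN spec, THEN spec, THEN spec, THEN mp, THEN mp, THEN bspec])
  show "C \<in> components t k \<Longrightarrow> w \<in> F k C \<Longrightarrow> Z t w \<in> weightings R (Suc t) C"
    by (rule a4[THEN conjunct1, rule_format])
  show "C \<in> components t k \<Longrightarrow> b \<in> weightings R (Suc t) C \<Longrightarrow>
      \<exists>\<alpha>. \<forall>x. b x = (\<Sum>w\<in>F k C. \<alpha> w * Z t w x)"
    by (rule a5[THEN conjunct1, rule_format])
  show "v \<in> V t - joined t k \<Longrightarrow> (lab v, k) \<in> parcs G \<Longrightarrow>
      ((S v k, x) \<in> edges R (Suc t) \<longleftrightarrow> x = v) \<and> Z t (S v k) v = 1"
    by (rule a6[rule_format])
qed

lemma step_vertex_cases [consumes 2]: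
  assumes "step_choice t F S" and "w \<in> V (Suc t)"
  obtains (fork) C where "C \<in> components t (lab w)" and "w \<in> F (lab w) C"
  | (singleton) v where "v \<in> V t - joined t (lab w)" and "(lab v, lab w) \<in> parcs G" and "w = S v (lab w)"
proof -
  have "w \<in> {w' \<in> V (Suc t). lab w' = lab w}" using assms(2) by simp
  then show thesis unfolding step_cover[OF assms(1)] using that by blast
qed

text \<open>A fork vertex labeled \<open>k\<close> is attached only to vertices joined to some
  vertex labeled \<open>k\<close> one level further down, so its arc is the reverse of one known by
  induction. Singleton moves follow arcs by construction.\<close>

lemma edge_arc: "(x, y) \<in> edges R (Suc t) \<Longrightarrow> (lab x, lab y) \<in> parcs G"
proof (induction t arbitrary: x y)
  case (0 x y)
  obtain F S where st: "step_choice 0 F S" by (rule ex_step_choice)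
  have "x \<in> V (Suc 0)" using edges_level[OF 0] by simp
  with st show ?case
  proof (cases rule: step_vertex_cases)
    case (fork C)
    then show ?thesis by (simp add: components_def)
  next
    case (singleton v)
    then show ?thesis using step_singleton[OF st singleton(1,2), of y] 0 arcs_sym by auto
  qed
next
  case (Suc t x y)
  obtain F S where st: "step_choice (Suc t) F S" by (rule ex_step_choice)
  have "x \<in> V (Suc (Suc t))" using edges_level[OF Suc.prems] by simp
  with st show ?case
  proof (cases rule: step_vertex_cases)
    case (fork C)
    note 1 = fork
    then have "y \<in> joined (Suc t) (lab x)"
      using step_fork_edges[OF st 1] Suc.prems component_subset_joined by blast
    then obtain z where "(y, z) \<in> edges R (Suc t)" "lab z = lab x" by (auto simp: joined_def)
    then show ?thesis using Suc.IH arcs_sym by metis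
  next
    case (singleton v)
      note 2 = singleton
    then show ?thesis using step_singleton[OF st 2(1,2), of y] Suc.prems arcs_sym by auto
  qed
qed

lemma Z_nonzero_arc: "Z t x y \<noteq> 0 \<Longrightarrow> (lab x, lab y) \<in> parcs G"
  using Z_nonzero_edge edge_arc by blast

lemma Z_nonzero_level: "Z t x y \<noteq> 0 \<Longrightarrow> x \<in> V (Suc t) \<and> y \<in> V t"
  using Z_nonzero_edge edges_level by blast

section \<open>The rows with a fixed label, block by block\<close>

abbreviation Vl :: "nat \<Rightarrow> 'v \<Rightarrow> 'w set" where "Vl t k \<equiv> {x \<in> V t. lab x = k}"

lemma finite_Vl: "finite (Vl t k)"
  using finite_level by simp

lemma step_fork_support:
  assumes "step_choice t F S" and "C \<in> components t k" and "w \<in> F k C" and "Z t w x \<noteq> 0"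
  shows "x \<in> C \<inter> V t"
  using step_fork_edges assms Z_nonzero_edge by blast

lemma step_singleton_label:
  assumes "step_choice t F S" and "v \<in> V t - joined t k" and "(lab v, k) \<in> parcs G"
  shows "Z t (S v k) x = (if x = v then 1 else 0)"
  using step_singleton[OF assms, of x] Z_nonzero_edge[of t "S v k" x] by auto

text \<open>A row from another component has its support inside that component, and a singleton row
  has its only entry in a column not joined to \<open>k\<close>. So in a column from
  \<open>C\<close> only the rows added for \<open>C\<close> count.\<close>

lemma step_sum_joined:
  assumes st: "step_choice t F S" and C: "C \<in> components t k" and x: "x \<in> C \<inter> V t"
  shows "(\<Sum>w\<in>Vl (Suc t) k. g w * Z t w x) = (\<Sum>w\<in>F k C. g w * Z t w x)"
proof -
  have "Z t w x = 0" if w: "w \<in> Vl (Suc t) k - F k C" for w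
  proof (rule ccontr)
    assume nz: "Z t w x \<noteq> 0"
    have "w \<in> V (Suc t)" and k: "k = lab w" using w by auto
    from st this(1) show False
    proof (cases rule: step_vertex_cases)
      case (fork C')
      note 1 = fork
      from 1 have "C' = C" using component_eq_iff[of C' t k x C] C step_fork_support[OF st 1 nz] x k by blast
      then show False using 1 w k by blast
    next
      case (singleton v)
      note 2 = singleton
      then have "x = v" using step_singleton_label[OF st 2(1,2)] nz by (metis (full_types))
      then show False using 2 x component_subset_joined[OF C] k by blast
    qed
  qed
  moreover have "F k C \<subseteq> Vl (Suc t) k" using step_cover[OF st] C by blast
  ultimately show ?thesis
    by (intro sum.mono_neutral_right finite_Vl) auto
qed

text \<open>The complementary blocks: such a column meets no fork row and at most one singleton row,
  the one created for it, with entry 1.\<close>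

lemma step_sum_unjoined:
  assumes st: "step_choice t F S" and x: "x \<in> V t - joined t k"
  shows "(\<Sum>w\<in>Vl (Suc t) k. g w * Z t w x) = (if (lab x, k) \<in> parcs G then g (S x k) else 0)"
proof -
  have *: "w = S x k \<and> (lab x, k) \<in> parcs G" if w: "w \<in> Vl (Suc t) k" and nz: "Z t w x \<noteq> 0" for w
  proof -
    have "w \<in> V (Suc t)" and k: "k = lab w" using w by auto
    from st this(1) show ?thesis
    proof (cases rule: step_vertex_cases)
      case (fork C)
      note 1 = fork
      then show ?thesis using step_fork_support[OF st 1 nz] component_subset_joined[OF 1(1)] x k by blast
    next
      case (singleton v)
      note 2 = singleton
      then have "x = v" using step_singleton_label[OF st 2(1,2)] nz by (metis (full_types))
      then show ?thesis using 2 k by simp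
    qed
  qed
  show ?thesis
  proof (cases "(lab x, k) \<in> parcs G")
    case True
    have "S x k \<in> Vl (Suc t) k" using step_cover[OF st] x True by blast
    then have "(\<Sum>w\<in>Vl (Suc t) k. g w * Z t w x) = (\<Sum>w\<in>{S x k}. g w * Z t w x)"
      by (intro sum.mono_neutral_right finite_Vl) (use * in auto)
    then show ?thesis using step_singleton_label[OF st x True, of x] True by simp
  next
    case False
    then have "g w * Z t w x = 0" if "w \<in> Vl (Suc t) k" for w using * that by (metis mult_zero_right)
    then show ?thesis using False by (simp only: if_False) (intro sum.neutral ballI)
  qed
qed

text \<open>By the block structure a relation splits into one relation per fork component, whose
  rows are independent, and one equation per singleton row, which has the single entry 1.\<close>

lemma Z_rows_independent:
  assumes "\<And>y. y \<in> V t \<Longrightarrow> (\<Sum>x\<in>Vl (Suc t) k. \<alpha> x * Z t x y) = 0" and "w \<in> Vl (Suc t) k"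
  shows "\<alpha> w = 0"
proof -
  obtain F S where st: "step_choice t F S" by (rule ex_step_choice)
  have "w \<in> V (Suc t)" and k: "lab w = k" using assms(2) by auto
  from st this(1) show ?thesis
  proof (cases rule: step_vertex_cases)
    case (fork C)
    note 1 = fork
    have "(\<Sum>w\<in>F k C. \<alpha> w * Z t w x) = 0" for x
    proof (cases "x \<in> C \<inter> V t")
      case True
      then show ?thesis using step_sum_joined[OF st, of C k x \<alpha>] 1 k assms(1) by simp
    next
      case False
      then show ?thesis using step_fork_support[OF st, of C k] 1 k by (intro sum.neutral) auto
    qed
    then show ?thesis using step_fork_independent[OF st, of C k] 1 k by blast
  next
    case (singleton v)
      note 2 = singleton
    then show ?thesis using step_sum_unjoined[OF st, of v k \<alpha>] assms(1)[of v] k by simp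
  qed
qed

text \<open>Completeness of the moves: \<open>ker\<close> contains the weighting conditions of all
  components at once, so \<open>b\<close> restricted to a component is a weighting and a combination
  of the chosen basis. Off the joined vertices the singleton rows supply the value of
  \<open>b\<close>, which vanishes unless there is an arc to \<open>k\<close>.\<close>

lemma Z_rows_span:
  assumes b: "\<And>x. x \<in> V t \<Longrightarrow> (lab x, k) \<notin> parcs G \<Longrightarrow> b x = 0"
    and ker: "\<And>s y. t = Suc s \<Longrightarrow> y \<in> Vl s k \<Longrightarrow> (\<Sum>x\<in>V t. Z s x y * b x) = 0"
  obtains \<alpha> where "\<And>x. x \<in> V t \<Longrightarrow> b x = (\<Sum>w\<in>Vl (Suc t) k. \<alpha> w * Z t w x)"
proof -
  obtain F S where st: "step_choice t F S" by (rule ex_step_choice)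
  note spn = step_fork_span[OF st] and ZF = step_fork_support[OF st] and ZS = step_singleton_label[OF st]
    and sumF = step_sum_joined[OF st] and sumS = step_sum_unjoined[OF st]
  have "\<exists>\<alpha>. \<forall>x\<in>C \<inter> V t. b x = (\<Sum>w\<in>F k C. \<alpha> w * Z t w x)" if C: "C \<in> components t k" for C
  proof -
    obtain s where t: "t = Suc s" using C by (cases t) (auto simp: components_def)
    have "(\<lambda>x. if x \<in> C \<inter> V t then b x else 0) \<in> weightings R (Suc t) C"
      unfolding weightings_def mem_Collect_eq
    proof (intro conjI ballI)
      fix y assume "y \<in> C \<inter> V (Suc t - 2)"
      then have yC: "y \<in> C" and y: "y \<in> V s" by (auto simp: t)
      have "y \<notin> V t" using y level_disjoint[of y s t] t by auto
      \<comment> \<open>Needed to see that a lower vertex of the component is labeled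
        \<open>k\<close>: it is the starting vertex or an endpoint of a fork edge, and as a vertex
        of level \<open>s\<close> it cannot be an upper end.\<close>
      have "y \<in> fork_vertices R (Suc t) k \<or> y \<in> Range (fork_edges R (Suc t) k)"
      proof -
        let ?E = "fork_edges R (Suc t) k"
        obtain a where a: "a \<in> fork_vertices R (Suc t) k" and "C = (?E \<union> ?E\<inverse>)\<^sup>* `` {a}"
          using C by (auto simp: components_def fork_components_def quotient_def t)
        then have "(a, y) \<in> (?E \<union> ?E\<inverse>)\<^sup>*" using yC by simp
        then have "y = a \<or> y \<in> Field ?E"
          by (induction rule: rtrancl_induct) (auto simp: Field_def)
        then show ?thesis using a by (auto simp: fork_vertices_def Field_def)
      qed
      moreover have "y \<notin> Domain (fork_edges R (Suc t) k)"
        using \<open>y \<notin> V t\<close> edges_level by (auto simp: fork_edges_def t)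
      ultimately have laby: "lab y = k" by (auto simp: fork_vertices_def fork_edges_def)
      have "(\<Sum>w' | w' \<in> C \<inter> V t \<and> (w', y) \<in> edges R t. elabel R w' y * (if w' \<in> C \<inter> V t then b w' else 0))
        = (\<Sum>w' | w' \<in> C \<inter> V t \<and> (w', y) \<in> edges R t. Z s w' y * b w')"
        by (intro sum.cong) (auto simp: out_labels_def t)
      \<comment> \<open>All vertices with an edge to \<open>y\<close> lie in the component of
        \<open>y\<close>, so the sum over the component is the sum over the whole column.\<close>
      also have "\<dots> = (\<Sum>x\<in>V t. Z s x y * b x)"
      proof (rule sum.mono_neutral_left[OF finite_level])
        have "w' \<in> C" if "(w', y) \<in> edges R t" for w'
          using component_edge_iff[of C s k w' y] C that laby yC by (simp add: t)
        then show "\<forall>w'\<in>V t - {w' \<in> C \<inter> V t. (w', y) \<in> edges R t}. Z s w' y * b w' = 0"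
          using Z_nonzero_edge[of s _ y] unfolding t by fastforce
      qed auto
      also have "\<dots> = 0" using ker[of s y] t y laby by simp
      finally show "(\<Sum>w' | w' \<in> C \<inter> V (Suc t - 1) \<and> (w', y) \<in> edges R (Suc t - 1).
        elabel R w' y * (if w' \<in> C \<inter> V t then b w' else 0)) = 0" by simp
    qed auto
    then obtain \<alpha> where \<alpha>: "\<forall>x. (if x \<in> C \<inter> V t then b x else 0) = (\<Sum>w\<in>F k C. \<alpha> w * Z t w x)"
      using spn[OF C] by blast
    have "b x = (\<Sum>w\<in>F k C. \<alpha> w * Z t w x)" if "x \<in> C \<inter> V t" for x
      using \<alpha>[THEN spec, of x] that by simp
    then show ?thesis by blast
  qed
  then obtain A where A: "\<And>C x. C \<in> components t k \<Longrightarrow> x \<in> C \<inter> V t \<Longrightarrow> b x = (\<Sum>w\<in>F k C. A C w * Z t w x)"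
    by metis
  \<comment> \<open>Gluing the coefficients of the blocks: a fork row takes its coefficient from its
    component, a singleton row \<open>S v k\<close> takes \<open>b v\<close>, with \<open>v\<close>
    recovered as its only nonzero column. In a column where a fork row is nonzero its component is
    determined, so the choice in \<open>comp\<close> is harmless.\<close>
  define comp where "comp w = (SOME C. C \<in> components t k \<and> w \<in> F k C)" for w
  define \<alpha> where "\<alpha> w = (if \<exists>v. v \<in> V t - joined t k \<and> (lab v, k) \<in> parcs G \<and> w = S v k
    then b (THE v. Z t w v \<noteq> 0) else A (comp w) w)" for w
  show thesis
  proof (rule that[of \<alpha>])
    fix x assume x: "x \<in> V t"
    show "b x = (\<Sum>w\<in>Vl (Suc t) k. \<alpha> w * Z t w x)"
    proof (cases "x \<in> joined t k")
      case False
      have "b x = \<alpha> (S x k)" if "(lab x, k) \<in> parcs G"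
      proof -
        have "(THE v. Z t (S x k) v \<noteq> 0) = x" using ZS[of x k] x False that by auto
        then show ?thesis using x False that by (auto simp: \<alpha>_def)
      qed
      then show ?thesis using b[OF x] x False by (subst sumS) auto
    next
      case True
      then obtain C where C: "C \<in> components t k" "x \<in> C" by (rule ex_component)
      have "\<alpha> w * Z t w x = A C w * Z t w x" if w: "w \<in> F k C" for w
      proof (cases "Z t w x = 0")
        case nz: False
        have "comp w \<in> components t k \<and> w \<in> F k (comp w)"
          unfolding comp_def using C(1) w by (rule someI2[where a = C, OF conjI])
        then have "comp w = C" using component_eq_iff[of "comp w" t k x C] ZF[of "comp w" k w x] nz C by blast
        moreover have "\<not> (\<exists>v. v \<in> V t - joined t k \<and> (lab v, k) \<in> parcs G \<and> w = S v k)"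
          using ZS[of _ k x] nz True by (auto split: if_splits)
        ultimately show ?thesis by (simp only: \<alpha>_def if_False)
      qed simp
      then have "(\<Sum>w\<in>F k C. \<alpha> w * Z t w x) = (\<Sum>w\<in>F k C. A C w * Z t w x)" by (rule sum.cong[OF refl])
      then show ?thesis
        using A[OF C(1), of x] sumF[OF C(1), of x \<alpha>] C(2) x by simp
    qed
  qed
qed

text \<open>For a fork vertex this is the weighting equation at \<open>y\<close> if \<open>y\<close>
  lies in its component; otherwise no vertex with a nonzero entry at \<open>y\<close> does. A
  singleton vertex sits on a vertex without edges to its own label. In the complex this is
  \<open>d d = 0\<close>, seen in the loop coordinates.\<close>

lemma ZZ_zero:
  assumes "w \<in> V (Suc (Suc t))" and "lab w = lab y"
  shows "(\<Sum>x\<in>V (Suc t). Z (Suc t) w x * Z t x y) = 0"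
proof (cases "y \<in> V t")
  case False
  then have "Z t x y = 0" for x using Z_nonzero_level by blast
  then show ?thesis by simp
next
  case y: True
  obtain F S where st: "step_choice (Suc t) F S" by (rule ex_step_choice)
  note ZF = step_fork_support[OF st] and wt = step_fork_weighting[OF st] and ZS = step_singleton_label[OF st]
  from st assms(1) show ?thesis
  proof (cases rule: step_vertex_cases)
    case (fork C)
    note 1 = fork[unfolded assms(2)]
    have iff: "x \<in> C \<longleftrightarrow> y \<in> C" if "Z t x y \<noteq> 0" for x
      using component_edge_iff[OF 1(1) Z_nonzero_edge[OF that]] by simp
    show ?thesis
    proof (cases "y \<in> C")
      case False
      then have "Z (Suc t) w x * Z t x y = 0" for x
        using iff ZF[OF 1, of x] by (cases "Z t x y = 0") auto
      then show ?thesis by (intro sum.neutral ballI)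
    next
      case True
      have "(\<Sum>x\<in>V (Suc t). Z (Suc t) w x * Z t x y) =
        (\<Sum>x | x \<in> C \<inter> V (Suc t) \<and> (x, y) \<in> edges R (Suc t). elabel R x y * Z (Suc t) w x)"
      proof (rule sum.mono_neutral_cong_right[OF finite_level])
        show "\<forall>x\<in>V (Suc t) - {x \<in> C \<inter> V (Suc t). (x, y) \<in> edges R (Suc t)}. Z (Suc t) w x * Z t x y = 0"
        proof
          fix x assume x: "x \<in> V (Suc t) - {x \<in> C \<inter> V (Suc t). (x, y) \<in> edges R (Suc t)}"
          then have "Z t x y = 0" using iff[of x] True Z_nonzero_edge[of t x y] by blast
          then show "Z (Suc t) w x * Z t x y = 0" by simp
        qed
      qed (auto simp: out_labels_def)
      also have "\<dots> = 0"
        using wt[OF 1] True y by (auto simp: weightings_def)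
      finally show ?thesis .
    qed
  next
    case (singleton v)
    note 2 = singleton[unfolded assms(2)]
    have "Z t v y = 0" using 2 Z_nonzero_edge[of t v y] by (auto simp: joined_def)
    then have "Z (Suc t) w x * Z t x y = 0" for x using ZS[OF 2(1,2)] 2(3) by auto
    then show ?thesis by (intro sum.neutral ballI)
  qed
qed

text \<open>The dual of \<open>Z_rows_span\<close>: every \<open>b\<close> supported on neighbours
  of \<open>m\<close> and annihilated by the columns labeled \<open>m\<close> of \<open>Z t\<close>
  is a combination of rows labeled \<open>m\<close> of \<open>Z (Suc t)\<close>, hence annihilated
  by \<open>u\<close>. Then \<open>combination_if_annihilates\<close> expresses \<open>u\<close> by
  those columns.\<close>

lemma Z_columns_span:
  assumes u: "\<And>x. x \<in> V (Suc t) \<Longrightarrow> (lab x, m) \<notin> parcs G \<Longrightarrow> u x = 0"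
    and van: "\<And>w. w \<in> Vl (Suc (Suc t)) m \<Longrightarrow> (\<Sum>x\<in>V (Suc t). Z (Suc t) w x * u x) = 0"
  obtains d where "\<And>y. y \<notin> Vl t m \<Longrightarrow> d y = 0"
    and "\<And>x. x \<in> V (Suc t) \<Longrightarrow> u x = (\<Sum>y\<in>V t. Z t x y * d y)"
proof -
  define X where "X = {x \<in> V (Suc t). (lab x, m) \<in> parcs G}"
  have finX: "finite X" using finite_level by (simp add: X_def)
  obtain d where d: "\<And>x. x \<in> X \<Longrightarrow> u x = (\<Sum>y\<in>Vl t m. d y * Z t x y)"
  proof (rule combination_if_annihilates[OF finX finite_Vl[of t m], of "\<lambda>y x. Z t x y" u])
    fix b assume b: "\<And>y. y \<in> Vl t m \<Longrightarrow> (\<Sum>x\<in>X. Z t x y * b x) = 0"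
    define b' where "b' x = (if x \<in> X then b x else 0)" for x
    have ext: "(\<Sum>x\<in>V (Suc t). g x * b' x) = (\<Sum>x\<in>X. g x * b x)" for g
      unfolding b'_def
      by (rule sum.mono_neutral_cong_right[OF finite_level]) (auto simp: X_def)
    obtain \<alpha> where \<alpha>: "\<And>x. x \<in> V (Suc t) \<Longrightarrow> b' x = (\<Sum>w\<in>Vl (Suc (Suc t)) m. \<alpha> w * Z (Suc t) w x)"
    proof (rule Z_rows_span[of "Suc t" m b'])
      fix s y assume "Suc t = Suc s" "y \<in> Vl s m"
      then show "(\<Sum>x\<in>V (Suc t). Z s x y * b' x) = 0" using b[of y] ext[of "\<lambda>x. Z t x y"] by simp
    qed (auto simp: b'_def X_def)
    have "(\<Sum>x\<in>X. u x * b x) = (\<Sum>x\<in>V (Suc t). u x * (\<Sum>w\<in>Vl (Suc (Suc t)) m. \<alpha> w * Z (Suc t) w x))"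
      using ext[of u] \<alpha> by simp
    also have "\<dots> = (\<Sum>w\<in>Vl (Suc (Suc t)) m. \<alpha> w * (\<Sum>x\<in>V (Suc t). Z (Suc t) w x * u x))"
      unfolding sum_distrib_left by (subst sum.swap) (simp add: mult_ac)
    also have "\<dots> = 0" using van by simp
    finally show "(\<Sum>x\<in>X. u x * b x) = 0" .
  qed blast
  show thesis
  proof (rule that[of "\<lambda>y. if y \<in> Vl t m then d y else 0"])
    fix x assume x: "x \<in> V (Suc t)"
    have "(\<Sum>y\<in>V t. Z t x y * (if y \<in> Vl t m then d y else 0)) = (\<Sum>y\<in>Vl t m. d y * Z t x y)"
      by (rule sum.mono_neutral_cong_right[OF finite_level]) auto
    also have "\<dots> = u x"
    proof (cases "x \<in> X")
      case False
      then have "Z t x y = 0" if "y \<in> Vl t m" for y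
        using x that Z_nonzero_arc[of t x y] by (auto simp: X_def)
      then show ?thesis using u[OF x] x False by (simp add: X_def)
    qed (simp add: d)
    finally show "u x = (\<Sum>y\<in>V t. Z t x y * (if y \<in> Vl t m then d y else 0))" by simp
  qed auto
qed

text \<open>The levels form a cyclic graded module, generated by \<open>V 0\<close>, over the preprojective algebra (without signs). The
  second condition allows extending \<open>S\<close> downwards, level by level, to an endomorphism of that module; as
  such an endomorphism is determined by its restriction to \<open>V 0\<close>, it is scalar.\<close>

lemma endomorphism_scalar:
  assumes "\<And>x x'. S x x' \<noteq> 0 \<Longrightarrow> x \<in> V s \<and> x' \<in> V s \<and> lab x = lab x'"
    and "\<And>r w y. s = Suc r \<Longrightarrow> w \<in> V (Suc s) \<Longrightarrow> y \<in> V r \<Longrightarrow> lab w = lab y \<Longrightarrow>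
      (\<Sum>x\<in>V s. Z s w x * (\<Sum>x'\<in>V s. S x x' * Z r x' y)) = 0"
  obtains l where "\<And>x x'. x \<in> V s \<Longrightarrow> x' \<in> V s \<Longrightarrow> S x x' = (if x = x' then l else 0)"
proof -
  have "\<exists>l. \<forall>x\<in>V s. \<forall>x'\<in>V s. S x x' = (if x = x' then l else 0)"
    using assms
  proof (induction s arbitrary: S)
    case (0 S)
    obtain v where "V 0 = {v}" by (rule level_0)
    then show ?case by auto
  next
    case (Suc s S)
    \<comment> \<open>\<open>P y d\<close> says that \<open>d\<close> can serve as column
      \<open>y\<close> of a label-preserving matrix \<open>T\<close> on level \<open>s\<close> with
      \<open>S Z_s = Z_s T\<close>.\<close>
    define P where "P y d \<longleftrightarrow> (\<forall>y'. y' \<notin> Vl s (lab y) \<longrightarrow> d y' = 0) \<and>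
      (\<forall>x\<in>V (Suc s). (\<Sum>x'\<in>V (Suc s). S x x' * Z s x' y) = (\<Sum>y'\<in>V s. Z s x y' * d y'))" for y d
    have ex: "\<exists>d. P y d" if y: "y \<in> V s" for y
    proof -
      obtain d where "\<And>y'. y' \<notin> Vl s (lab y) \<Longrightarrow> d y' = 0"
        "\<And>x. x \<in> V (Suc s) \<Longrightarrow> (\<Sum>x'\<in>V (Suc s). S x x' * Z s x' y) = (\<Sum>y'\<in>V s. Z s x y' * d y')"
      proof (rule Z_columns_span[of s "lab y" "\<lambda>x. \<Sum>x'\<in>V (Suc s). S x x' * Z s x' y"])
        fix x assume "x \<in> V (Suc s)" "(lab x, lab y) \<notin> parcs G"
        then have "S x x' * Z s x' y = 0" for x'
          using Suc.prems(1)[of x x'] Z_nonzero_arc[of s x' y] by fastforce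
        then show "(\<Sum>x'\<in>V (Suc s). S x x' * Z s x' y) = 0" by (intro sum.neutral ballI)
      next
        fix w assume "w \<in> Vl (Suc (Suc s)) (lab y)"
        then show "(\<Sum>x\<in>V (Suc s). Z (Suc s) w x * (\<Sum>x'\<in>V (Suc s). S x x' * Z s x' y)) = 0"
          using Suc.prems(2)[of s w y] y by simp
      qed auto
      then show ?thesis unfolding P_def by blast
    qed
    define D where "D y = (SOME d. P y d)" for y
    have PD: "P y (D y)" if "y \<in> V s" for y using ex that unfolding D_def by (metis someI_ex)
    have D0: "D y y' = 0" if "y \<in> V s" "y' \<notin> Vl s (lab y)" for y y'
      using PD[OF that(1)] that(2) unfolding P_def by blast
    have D: "(\<Sum>x'\<in>V (Suc s). S x x' * Z s x' y) = (\<Sum>y'\<in>V s. Z s x y' * D y y')"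
      if "y \<in> V s" "x \<in> V (Suc s)" for y x
      using PD[OF that(1)] that(2) unfolding P_def by blast
    define T where "T y' y = (if y \<in> V s then D y y' else 0)" for y' y
    have "\<exists>l. \<forall>x\<in>V s. \<forall>x'\<in>V s. T x x' = (if x = x' then l else 0)"
    proof (rule Suc.IH)
      fix x x' assume "T x x' \<noteq> 0"
      then show "x \<in> V s \<and> x' \<in> V s \<and> lab x = lab x'"
        using D0[of x' x] by (auto simp: T_def split: if_splits)
    next
      \<comment> \<open>The condition is inherited: \<open>Z_s T Z_r = S Z_s Z_r\<close>, and as
        \<open>S\<close> preserves labels, the entries between equal labels vanish by
        \<open>ZZ_zero\<close>.\<close>
      fix r w y assume s: "s = Suc r" and w: "w \<in> V (Suc s)" and y: "y \<in> V r" and l: "lab w = lab y"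
      have "(\<Sum>x\<in>V s. Z s w x * (\<Sum>x'\<in>V s. T x x' * Z r x' y)) =
        (\<Sum>x'\<in>V s. (\<Sum>x\<in>V s. Z s w x * T x x') * Z r x' y)"
        unfolding sum_distrib_left sum_distrib_right by (subst sum.swap) (simp add: mult_ac)
      also have "\<dots> = (\<Sum>x'\<in>V s. (\<Sum>v\<in>V (Suc s). S w v * Z s v x') * Z r x' y)"
        by (intro sum.cong refl) (simp add: T_def D w)
      also have "\<dots> = (\<Sum>v\<in>V (Suc s). S w v * (\<Sum>x'\<in>V s. Z s v x' * Z r x' y))"
        unfolding sum_distrib_left sum_distrib_right by (subst sum.swap) (simp add: mult_ac)
      also have "\<dots> = 0"
      proof (intro sum.neutral ballI)
        fix v assume v: "v \<in> V (Suc s)"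
        show "S w v * (\<Sum>x'\<in>V s. Z s v x' * Z r x' y) = 0"
        proof (cases "S w v = 0")
          case False
          then have "lab v = lab y" using Suc.prems(1)[of w v] l by simp
          then show ?thesis using ZZ_zero[of v r y] v s by simp
        qed simp
      qed
      finally show "(\<Sum>x\<in>V s. Z s w x * (\<Sum>x'\<in>V s. T x x' * Z r x' y)) = 0" .
    qed
    then obtain l where l: "\<And>x x'. x \<in> V s \<Longrightarrow> x' \<in> V s \<Longrightarrow> T x x' = (if x = x' then l else 0)" by blast
    have "S x x' = (if x = x' then l else 0)" if x: "x \<in> V (Suc s)" and x': "x' \<in> V (Suc s)" for x x'
    proof (cases "lab x = lab x'")
      case False
      then show ?thesis using Suc.prems(1)[of x x'] by auto
    next
      case True
      \<comment> \<open>Row \<open>x\<close> of \<open>S - l\<close>. Since \<open>T\<close> is the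
        scalar \<open>l\<close>, this row multiplied by \<open>Z_s\<close> is 0, and row
        independence for the label of \<open>x\<close> gives \<open>g = 0\<close>.\<close>
      define g where "g v = S x v - (if x = v then l else 0)" for v
      have "g x' = 0"
      proof (rule Z_rows_independent[where t = s and k = "lab x" and \<alpha> = g and w = x'])
        fix y assume y: "y \<in> V s"
        have "(\<Sum>v\<in>Vl (Suc s) (lab x). g v * Z s v y) = (\<Sum>v\<in>V (Suc s). g v * Z s v y)"
          by (rule sum.mono_neutral_left[OF finite_level]) (use Suc.prems(1)[of x] in \<open>auto simp: g_def\<close>)
        also have "\<dots> = (\<Sum>v\<in>V (Suc s). S x v * Z s v y) - (\<Sum>v\<in>V (Suc s). if x = v then l * Z s v y else 0)"
          unfolding sum_subtractf[symmetric] by (intro sum.cong) (auto simp: g_def left_diff_distrib)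
        also have "(\<Sum>v\<in>V (Suc s). S x v * Z s v y) = (\<Sum>y'\<in>V s. Z s x y' * T y' y)"
          using D[OF y x] y by (simp add: T_def)
        also have "\<dots> = (\<Sum>y'\<in>V s. if y' = y then Z s x y' * l else 0)"
          by (intro sum.cong) (auto simp: l y)
        finally show "(\<Sum>v\<in>Vl (Suc s) (lab x). g v * Z s v y) = 0"
          using finite_level x y by (simp add: mult.commute)
      qed (use True x' in simp)
      then show ?thesis by (simp add: g_def)
    qed
    then show ?case by blast
  qed
  then show thesis using that by blast
qed

lemma Z_columns_independent:
  assumes ne: "V (Suc t) \<noteq> {}"
    and c: "\<And>w. w \<in> V (Suc t) \<Longrightarrow> (\<Sum>x\<in>Vl t k. c x * Z t w x) = 0" and x0: "x0 \<in> Vl t k"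
  shows "c x0 = 0"
proof (rule ccontr)
  assume nz: "c x0 \<noteq> 0"
  \<comment> \<open>A matrix whose only nonzero column is \<open>x0\<close>, filled with
    \<open>c\<close>. The relation says \<open>Z_t S = 0\<close>, which implies the condition for
    extending \<open>S\<close> downwards.\<close>
  define S where "S x x' = (if x \<in> Vl t k \<and> x' = x0 then c x else 0)" for x x'
  have van: "(\<Sum>x\<in>V t. Z t w x * S x x') = 0" if "w \<in> V (Suc t)" for w x'
  proof -
    have "(\<Sum>x\<in>V t. Z t w x * S x x') = (\<Sum>x\<in>Vl t k. if x' = x0 then c x * Z t w x else 0)"
      by (rule sum.mono_neutral_cong_right[OF finite_level]) (auto simp: S_def)
    then show ?thesis using c[OF that] by (cases "x' = x0") auto
  qed
  obtain l where l: "\<And>x x'. x \<in> V t \<Longrightarrow> x' \<in> V t \<Longrightarrow> S x x' = (if x = x' then l else 0)"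
  proof (rule endomorphism_scalar[of S t])
    fix x x' assume "S x x' \<noteq> 0"
    then show "x \<in> V t \<and> x' \<in> V t \<and> lab x = lab x'" using x0 by (auto simp: S_def split: if_splits)
  next
    fix r w y assume "w \<in> V (Suc t)"
    have "(\<Sum>x\<in>V t. Z t w x * (\<Sum>x'\<in>V t. S x x' * Z r x' y)) =
      (\<Sum>x'\<in>V t. (\<Sum>x\<in>V t. Z t w x * S x x') * Z r x' y)"
      unfolding sum_distrib_left sum_distrib_right by (subst sum.swap) (simp add: mult_ac)
    then show "(\<Sum>x\<in>V t. Z t w x * (\<Sum>x'\<in>V t. S x x' * Z r x' y)) = 0"
      by (simp add: van[OF \<open>w \<in> V (Suc t)\<close>])
  qed auto
  have lc: "l = c x0" using l[of x0 x0] x0 by (simp add: S_def)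
  \<comment> \<open>Away from \<open>x0\<close> the diagonal of \<open>S\<close> is 0, whereas the
    scalar is \<open>c x0\<close>.\<close>
  have single: "x = x0" if "x \<in> V t" for x
  proof (rule ccontr)
    assume "x \<noteq> x0"
    then show False using l[OF that that] lc nz by (simp add: S_def)
  qed
  obtain w where w: "w \<in> V (Suc t)" using ne by blast
  have Zx0: "Z t w x0 = 0" if "w \<in> V (Suc t)" for w
  proof -
    have "V t = {x0}" using single x0 by auto
    then have "Vl t k = {x0}" using x0 by auto
    then show ?thesis using c[OF that] nz by simp
  qed
  \<comment> \<open>The rows have the single entry at \<open>x0\<close>, which the relation forces
    to be 0. So the coefficients 1 form a relation among zero rows, against row independence at the
    vertex \<open>w\<close>.\<close>
  have "(1 :: 'k) = 0"
  proof (rule Z_rows_independent[where t = t and k = "lab w" and \<alpha> = "\<lambda>_. 1" and w = w])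
    fix y assume "y \<in> V t"
    then have "y = x0" by (rule single)
    then show "(\<Sum>x\<in>Vl (Suc t) (lab w). 1 * Z t x y) = 0" using Zx0 by (intro sum.neutral) auto
  qed (use w in simp)
  then show False by simp
qed

section \<open>Sizes of the levels, label by label\<close>

lemma card_level_0: "card (Vl 0 k) = (if k = i then 1 else 0)"
proof -
  obtain v where "V 0 = {v}" "lab v = i" by (rule level_0)
  then have "Vl 0 k = (if k = i then {v} else {})" by auto
  then show ?thesis by simp
qed

lemma sum_arcs_eq:
  assumes "\<And>x. x \<in> V t \<Longrightarrow> (lab x, k) \<notin> parcs G \<Longrightarrow> f x = 0"
  shows "(\<Sum>x | x \<in> V t \<and> (lab x, k) \<in> parcs G. f x) = (\<Sum>x\<in>V t. f x)"
  by (rule sum.mono_neutral_left[OF finite_level]) (use assms in auto)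

lemma sum_arcs_Z:
  assumes "lab w = k"
  shows "(\<Sum>x | x \<in> V t \<and> (lab x, k) \<in> parcs G. Z t w x * f x) = (\<Sum>x\<in>V t. Z t w x * f x)"
  by (rule sum_arcs_eq) (metis Z_nonzero_arc arcs_sym assms mult_zero_left)

text \<open>The case without equations: in step 1 the rows labeled \<open>k\<close> form a basis of
  all functions on the neighbours of \<open>k\<close> in level 0. Hence \<open>Y\<close> is empty
  and \<open>M\<close> arbitrary.\<close>

lemma card_level_1: "card (Vl (Suc 0) k) = card {x \<in> V 0. (lab x, k) \<in> parcs G}"
proof -
  have "card (Vl (Suc 0) k) + card ({} :: 'w set) = card {x \<in> V 0. (lab x, k) \<in> parcs G}"
  proof (rule card_kernel_basis[where M = "\<lambda>_ _. 0" and g = "Z 0"])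
    fix c assume c: "\<And>x. x \<in> {x \<in> V 0. (lab x, k) \<in> parcs G} \<Longrightarrow> (\<Sum>w\<in>Vl (Suc 0) k. c w * Z 0 w x) = 0"
    have "(\<Sum>w\<in>Vl (Suc 0) k. c w * Z 0 w x) = 0" if "x \<in> V 0" for x
    proof (cases "(lab x, k) \<in> parcs G")
      case False
      then have "Z 0 w x = 0" if "lab w = k" for w using that Z_nonzero_arc[of 0 w x] arcs_sym by blast
      then show ?thesis by (intro sum.neutral) auto
    qed (use c that in auto)
    then show "\<forall>w\<in>Vl (Suc 0) k. c w = 0" using Z_rows_independent[where t = 0 and k = k and \<alpha> = c] by blast
  next
    fix b :: "'w \<Rightarrow> 'k"
    obtain \<alpha> where "\<And>x. x \<in> V 0 \<Longrightarrow>
      (if (lab x, k) \<in> parcs G then b x else 0) = (\<Sum>w\<in>Vl (Suc 0) k. \<alpha> w * Z 0 w x)"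
      by (rule Z_rows_span[of 0 k "\<lambda>x. if (lab x, k) \<in> parcs G then b x else 0"]) auto
    then show "\<exists>c. \<forall>x\<in>{x \<in> V 0. (lab x, k) \<in> parcs G}. b x = (\<Sum>w\<in>Vl (Suc 0) k. c w * Z 0 w x)"
      by (intro exI[of _ \<alpha>]) force
  qed (use finite_level finite_Vl in auto)
  then show ?thesis by simp
qed

text \<open>Rank-nullity for the label \<open>k\<close>: the unknowns are entries at the neighbours
  of \<open>k\<close> in level \<open>t + 1\<close>, the equations are the columns labeled
  \<open>k\<close> of \<open>Z t\<close>, and the rows labeled \<open>k\<close> of
  \<open>Z (Suc t)\<close> form a basis of the solutions. Nonemptiness gives independent
  equations.\<close>

lemma card_level_Suc_Suc:
  assumes "V (Suc t) \<noteq> {}"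
  shows "card (Vl (Suc (Suc t)) k) + card (Vl t k) = card {x \<in> V (Suc t). (lab x, k) \<in> parcs G}"
proof (rule card_kernel_basis[where M = "\<lambda>y x. Z t x y" and g = "Z (Suc t)"])
  let ?X = "{x \<in> V (Suc t). (lab x, k) \<in> parcs G}"
  fix c assume c: "\<And>x. x \<in> ?X \<Longrightarrow> (\<Sum>y\<in>Vl t k. c y * Z t x y) = 0"
  have "(\<Sum>y\<in>Vl t k. c y * Z t x y) = 0" if x: "x \<in> V (Suc t)" for x
  proof (cases "x \<in> ?X")
    case False
    then have "Z t x y = 0" if "lab y = k" for y using x that Z_nonzero_arc[of t x y] by blast
    then show ?thesis by (intro sum.neutral) auto
  qed (rule c)
  then show "\<forall>y\<in>Vl t k. c y = 0" using Z_columns_independent[OF assms, where k = k and c = c] by blast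
next
  let ?X = "{x \<in> V (Suc t). (lab x, k) \<in> parcs G}"
  fix c assume c: "\<And>x. x \<in> ?X \<Longrightarrow> (\<Sum>w\<in>Vl (Suc (Suc t)) k. c w * Z (Suc t) w x) = 0"
  have "(\<Sum>w\<in>Vl (Suc (Suc t)) k. c w * Z (Suc t) w x) = 0" if x: "x \<in> V (Suc t)" for x
  proof (cases "x \<in> ?X")
    case False
    then have "Z (Suc t) w x = 0" if "lab w = k" for w
      using x that Z_nonzero_arc[of "Suc t" w x] arcs_sym by blast
    then show ?thesis by (intro sum.neutral) auto
  qed (rule c)
  then show "\<forall>w\<in>Vl (Suc (Suc t)) k. c w = 0" using Z_rows_independent[where t = "Suc t" and k = k and \<alpha> = c] by blast
next
  fix w y assume w: "w \<in> Vl (Suc (Suc t)) k" and y: "y \<in> Vl t k"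
  have "(\<Sum>x | x \<in> V (Suc t) \<and> (lab x, k) \<in> parcs G. Z (Suc t) w x * Z t x y) = 0"
    using sum_arcs_Z[of w k "Suc t" "\<lambda>x. Z t x y"] ZZ_zero[of w t y] w y by simp
  then show "(\<Sum>x | x \<in> V (Suc t) \<and> (lab x, k) \<in> parcs G. Z t x y * Z (Suc t) w x) = 0"
    by (simp add: mult.commute)
next
  let ?X = "{x \<in> V (Suc t). (lab x, k) \<in> parcs G}"
  fix b assume b: "\<And>y. y \<in> Vl t k \<Longrightarrow> (\<Sum>x\<in>?X. Z t x y * b x) = 0"
  define b' where "b' x = (if (lab x, k) \<in> parcs G then b x else 0)" for x
  obtain \<alpha> where "\<And>x. x \<in> V (Suc t) \<Longrightarrow> b' x = (\<Sum>w\<in>Vl (Suc (Suc t)) k. \<alpha> w * Z (Suc t) w x)"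
  proof (rule Z_rows_span[of "Suc t" k b'])
    fix s y assume s: "Suc t = Suc s" and y: "y \<in> Vl s k"
    have "(\<Sum>x\<in>V (Suc t). Z t x y * b' x) = (\<Sum>x\<in>?X. Z t x y * b x)"
      by (rule sum.mono_neutral_cong_right[OF finite_level]) (auto simp: b'_def)
    then show "(\<Sum>x\<in>V (Suc t). Z s x y * b' x) = 0" using b[of y] s y by simp
  qed (auto simp: b'_def)
  then show "\<exists>c. \<forall>x\<in>?X. b x = (\<Sum>w\<in>Vl (Suc (Suc t)) k. c w * Z (Suc t) w x)"
    by (intro exI[of _ \<alpha>]) (force simp: b'_def)
qed (use finite_level finite_Vl in auto)

end

section \<open>Homogeneous components\<close>

lemma additive_zero:
  assumes "abelian_group M" and "abelian_group N" and "F \<in> carrier M \<rightarrow> carrier N"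
    and add: "\<And>x y. x \<in> carrier M \<Longrightarrow> y \<in> carrier M \<Longrightarrow> F (x \<oplus>\<^bsub>M\<^esub> y) = F x \<oplus>\<^bsub>N\<^esub> F y"
  shows "F \<zero>\<^bsub>M\<^esub> = \<zero>\<^bsub>N\<^esub>"
proof -
  interpret M: abelian_group M by fact
  interpret N: abelian_group N by fact
  have "F \<zero>\<^bsub>M\<^esub> \<in> carrier N" using assms(3) by auto
  moreover have "F \<zero>\<^bsub>M\<^esub> \<oplus>\<^bsub>N\<^esub> F \<zero>\<^bsub>M\<^esub> = F \<zero>\<^bsub>M\<^esub>" using add[of "\<zero>\<^bsub>M\<^esub>" "\<zero>\<^bsub>M\<^esub>"] by simp
  ultimately show ?thesis using N.add.l_cancel_one' by metis
qed

lemma additive_finsum: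
  assumes "abelian_group M" and "abelian_group N" and "F \<in> carrier M \<rightarrow> carrier N"
    and add: "\<And>x y. x \<in> carrier M \<Longrightarrow> y \<in> carrier M \<Longrightarrow> F (x \<oplus>\<^bsub>M\<^esub> y) = F x \<oplus>\<^bsub>N\<^esub> F y"
    and "f \<in> S \<rightarrow> carrier M"
  shows "F (finsum M f S) = finsum N (\<lambda>s. F (f s)) S"
proof -
  interpret M: abelian_group M by fact
  interpret N: abelian_group N by fact
  have zero: "F \<zero>\<^bsub>M\<^esub> = \<zero>\<^bsub>N\<^esub>" by (rule additive_zero[OF assms(1-4)])
  show ?thesis
    using assms(5)
  proof (induction S rule: infinite_finite_induct)
    case (infinite S)
    then show ?case by (simp add: zero M.finsum_infinite N.finsum_infinite)
  next
    case empty
    then show ?case by (simp add: zero)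
  next
    case (insert s S)
    then have "F (finsum M f (insert s S)) = F (f s) \<oplus>\<^bsub>N\<^esub> F (finsum M f S)"
      by (simp add: add M.finsum_closed)
    moreover have "(\<lambda>s. F (f s)) \<in> S \<rightarrow> carrier N" "F (f s) \<in> carrier N"
      using insert.prems assms(3) by auto
    ultimately show ?case using insert by simp
  qed
qed

definition homog :: "('m, 'x) ring_scheme \<Rightarrow> (int \<Rightarrow> 'm set) \<Rightarrow> 'm \<Rightarrow> int \<Rightarrow> 'm" where
  "homog M D x = (THE c. (\<forall>n. c n \<in> D n) \<and> finite {n. c n \<noteq> \<zero>\<^bsub>M\<^esub>} \<and>
                         x = finsum M c {n. c n \<noteq> \<zero>\<^bsub>M\<^esub>})"

locale graded_group = abelian_group M for M :: "('m, 'x) ring_scheme" (structure) +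
  fixes D :: "int \<Rightarrow> 'm set"
  assumes graded: "graded_by M D"
begin

lemma D_subgroup: "subgroup (D n) (add_monoid M)"
  using graded by (simp add: graded_by_def)

lemma D_carrier: "x \<in> D n \<Longrightarrow> x \<in> carrier M"
  using subgroup.subset[OF D_subgroup] by auto

lemma D_zero: "\<zero> \<in> D n"
  using subgroup.one_closed[OF D_subgroup] by simp

lemma D_add: "x \<in> D n \<Longrightarrow> y \<in> D n \<Longrightarrow> x \<oplus> y \<in> D n"
  using subgroup.m_closed[OF D_subgroup] by simp

lemma homog:
  assumes "x \<in> carrier M"
  shows homog_D: "homog M D x n \<in> D n" and finite_homog: "finite {n. homog M D x n \<noteq> \<zero>}"
    and homog_sum: "x = finsum M (homog M D x) {n. homog M D x n \<noteq> \<zero>}"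
proof -
  have "\<exists>!c. (\<forall>n. c n \<in> D n) \<and> finite {n. c n \<noteq> \<zero>} \<and> x = finsum M c {n. c n \<noteq> \<zero>}"
    using assms graded by (simp add: graded_by_def)
  from theI'[OF this]
  show "homog M D x n \<in> D n" "finite {n. homog M D x n \<noteq> \<zero>}"
    "x = finsum M (homog M D x) {n. homog M D x n \<noteq> \<zero>}"
    unfolding homog_def by blast+
qed

text \<open>\<open>graded_by\<close> sums over the exact support, while in applications only a
  finite set containing the support is at hand.\<close>

lemma homog_eqI:
  assumes "finite S" and "\<And>n. c n \<in> D n" and "\<And>n. n \<notin> S \<Longrightarrow> c n = \<zero>" and "x = finsum M c S"
  shows "homog M D x = c"
proof -
  have c: "c n \<in> carrier M" for n using assms(2) D_carrier by blast
  have x: "x \<in> carrier M" unfolding assms(4) using c by (intro finsum_closed) auto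
  have S: "{n. c n \<noteq> \<zero>} \<subseteq> S" using assms(3) by blast
  have "finsum M c {n. c n \<noteq> \<zero>} = finsum M c S"
    using c S assms(1) by (intro add.finprod_mono_neutral_cong_left) auto
  then have "(\<forall>n. c n \<in> D n) \<and> finite {n. c n \<noteq> \<zero>} \<and> x = finsum M c {n. c n \<noteq> \<zero>}"
    using assms(2,4) finite_subset[OF S assms(1)] by simp
  moreover have "\<exists>!c. (\<forall>n. c n \<in> D n) \<and> finite {n. c n \<noteq> \<zero>} \<and> x = finsum M c {n. c n \<noteq> \<zero>}"
    using x graded by (simp add: graded_by_def)
  ultimately show ?thesis unfolding homog_def by (intro the1_equality)
qed

lemma homog_homogeneous:
  assumes "x \<in> D n"
  shows "homog M D x m = (if m = n then x else \<zero>)"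
proof -
  have "homog M D x = (\<lambda>m. if m = n then x else \<zero>)"
  proof (rule homog_eqI[of "{n}"])
    have "finsum M (\<lambda>m. if m = n then x else \<zero>) {n} = x"
      using assms D_carrier by simp
    then show "x = finsum M (\<lambda>m. if m = n then x else \<zero>) {n}" by simp
  qed (use assms D_zero in auto)
  then show ?thesis by simp
qed

lemma homog_add:
  assumes x: "x \<in> carrier M" and y: "y \<in> carrier M"
  shows "homog M D (x \<oplus> y) n = homog M D x n \<oplus> homog M D y n"
proof -
  let ?S = "{n. homog M D x n \<noteq> \<zero>} \<union> {n. homog M D y n \<noteq> \<zero>}"
  have cx: "homog M D x n \<in> carrier M" and cy: "homog M D y n \<in> carrier M" for n
    using homog_D x y D_carrier by blast+
  have fin: "finite ?S" using finite_homog x y by blast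
  have "homog M D (x \<oplus> y) = (\<lambda>n. homog M D x n \<oplus> homog M D y n)"
  proof (rule homog_eqI[OF fin])
    have "x = finsum M (homog M D x) ?S"
      by (subst homog_sum[OF x]) (use fin cx in \<open>auto intro!: add.finprod_mono_neutral_cong_left\<close>)
    moreover have "y = finsum M (homog M D y) ?S"
      by (subst homog_sum[OF y]) (use fin cy in \<open>auto intro!: add.finprod_mono_neutral_cong_left\<close>)
    ultimately have "x \<oplus> y = finsum M (homog M D x) ?S \<oplus> finsum M (homog M D y) ?S" by simp
    also have "\<dots> = finsum M (\<lambda>n. homog M D x n \<oplus> homog M D y n) ?S"
      using cx cy by (intro finsum_addf[symmetric]) auto
    finally show "x \<oplus> y = finsum M (\<lambda>n. homog M D x n \<oplus> homog M D y n) ?S" .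
  qed (use homog_D x y D_add in auto)
  then show ?thesis by simp
qed

lemma D_finsum: "(\<And>s. s \<in> S \<Longrightarrow> f s \<in> D n) \<Longrightarrow> finsum M f S \<in> D n"
proof (induction S rule: infinite_finite_induct)
  case (insert s S)
  then have "f \<in> S \<rightarrow> carrier M" "f s \<in> carrier M" using D_carrier by blast+
  then show ?case using insert by (simp add: D_add)
qed (auto simp: D_zero finsum_infinite)

end

text \<open>Applying \<open>F\<close> to the decomposition of \<open>x\<close> gives a decomposition
  of \<open>F x\<close>, and decompositions are unique. The applications are inclusions, coordinate
  projections, right multiplication by an idempotent, and homomorphisms.\<close>

lemma homog_additive:
  assumes M: "graded_group M D" and N: "graded_group N E" and F: "F \<in> carrier M \<rightarrow> carrier N"
    and add: "\<And>x y. x \<in> carrier M \<Longrightarrow> y \<in> carrier M \<Longrightarrow> F (x \<oplus>\<^bsub>M\<^esub> y) = F x \<oplus>\<^bsub>N\<^esub> F y"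
    and deg: "\<And>n x. x \<in> D n \<Longrightarrow> F x \<in> E n" and x: "x \<in> carrier M"
  shows "homog N E (F x) n = F (homog M D x n)"
proof -
  interpret M: graded_group M D by fact
  interpret N: graded_group N E by fact
  let ?S = "{n. homog M D x n \<noteq> \<zero>\<^bsub>M\<^esub>}"
  have h: "homog M D x n \<in> carrier M" for n using M.homog_D[OF x] M.D_carrier by blast
  have "homog N E (F x) = (\<lambda>n. F (homog M D x n))"
  proof (rule N.homog_eqI[of ?S])
    have "F x = F (finsum M (homog M D x) ?S)" using M.homog_sum[OF x] by simp
    also have "\<dots> = finsum N (\<lambda>n. F (homog M D x n)) ?S"
      by (rule additive_finsum[OF M.abelian_group_axioms N.abelian_group_axioms F add]) (use h in auto)
    finally show "F x = finsum N (\<lambda>n. F (homog M D x n)) ?S" .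
  next
    fix n assume "n \<notin> ?S"
    then show "F (homog M D x n) = \<zero>\<^bsub>N\<^esub>"
      using additive_zero[OF M.abelian_group_axioms N.abelian_group_axioms F add] by simp
  qed (use deg M.homog_D[OF x] M.finite_homog[OF x] in auto)
  then show ?thesis by simp
qed

text \<open>\<open>p x n\<close> is the candidate for the component of \<open>x\<close> in degree
  \<open>n\<close>. Uniqueness becomes the statement that \<open>p\<close> recovers the terms of any
  finite homogeneous sum.\<close>

lemma graded_byI:
  assumes "abelian_group M" and sub: "\<And>n. subgroup (D n) (add_monoid M)"
    and ex: "\<And>x. x \<in> carrier M \<Longrightarrow> \<exists>S. finite S \<and> (\<forall>n. p x n \<in> D n) \<and> (\<forall>n. n \<notin> S \<longrightarrow> p x n = \<zero>\<^bsub>M\<^esub>) \<and> x = finsum M (p x) S"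
    and uniq: "\<And>c S. finite S \<Longrightarrow> (\<And>n. c n \<in> D n) \<Longrightarrow> (\<And>n. n \<notin> S \<Longrightarrow> c n = \<zero>\<^bsub>M\<^esub>) \<Longrightarrow> p (finsum M c S) = c"
  shows "graded_by M D"
  unfolding graded_by_def
proof (intro conjI ballI allI sub ex1I)
  interpret abelian_group M by fact
  fix x assume x: "x \<in> carrier M"
  obtain S where S: "finite S" "\<And>n. p x n \<in> D n" "\<And>n. n \<notin> S \<Longrightarrow> p x n = \<zero>\<^bsub>M\<^esub>" "x = finsum M (p x) S"
    using ex[OF x] by blast
  have c: "p x n \<in> carrier M" for n using S(2) subgroup.subset[OF sub] by fastforce
  have sup: "{n. p x n \<noteq> \<zero>\<^bsub>M\<^esub>} \<subseteq> S" using S(3) by blast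
  show "p x n \<in> D n" for n by (rule S(2))
  show "finite {n. p x n \<noteq> \<zero>\<^bsub>M\<^esub>}" by (rule finite_subset[OF sup S(1)])
  have "finsum M (p x) {n. p x n \<noteq> \<zero>\<^bsub>M\<^esub>} = finsum M (p x) S"
    using c S(1) sup by (intro add.finprod_mono_neutral_cong_left) auto
  then show "x = finsum M (p x) {n. p x n \<noteq> \<zero>\<^bsub>M\<^esub>}" using S(4) by simp
  fix c assume c: "(\<forall>n. c n \<in> D n) \<and> finite {n. c n \<noteq> \<zero>\<^bsub>M\<^esub>} \<and> x = finsum M c {n. c n \<noteq> \<zero>\<^bsub>M\<^esub>}"
  then have "p (finsum M c {n. c n \<noteq> \<zero>\<^bsub>M\<^esub>}) = c" by (intro uniq) simp_all
  then show "c = p x" using c by simp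
qed

text \<open>Components in the ambient group serve as components in the subgroup, because the
  subgroup is closed under taking them.\<close>

lemma graded_by_subset:
  assumes "graded_group M D" and N: "abelian_group N" and "carrier N \<subseteq> carrier M"
    and ops: "\<zero>\<^bsub>N\<^esub> = \<zero>\<^bsub>M\<^esub>" "add N = add M"
    and hom: "\<And>x n. x \<in> carrier N \<Longrightarrow> homog M D x n \<in> carrier N"
    and E: "\<And>n. E n = D n \<inter> carrier N"
  shows "graded_by N E"
proof -
  interpret M: graded_group M D by fact
  interpret N: abelian_group N by fact
  have fs: "finsum N c S = finsum M c S" if "c \<in> S \<rightarrow> carrier N" for c S
    using additive_finsum[OF N M.abelian_group_axioms, of "\<lambda>x. x" c S] assms(3) ops(2) that by auto
  show ?thesis
  proof (rule graded_byI[OF N, of _ "homog M D"])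
    fix n
    have inv: "inv\<^bsub>add_monoid N\<^esub> x = inv\<^bsub>add_monoid M\<^esub> x" if x: "x \<in> carrier N" for x
    proof -
      have "\<ominus>\<^bsub>N\<^esub> x \<in> carrier M" "\<ominus>\<^bsub>N\<^esub> x \<oplus>\<^bsub>M\<^esub> x = \<zero>\<^bsub>M\<^esub>"
        using N.a_inv_closed[OF x] N.l_neg[OF x] assms(3) ops by auto
      then show ?thesis using M.minus_equality[of "\<ominus>\<^bsub>N\<^esub> x" x] x assms(3) by (auto simp: a_inv_def)
    qed
    show "subgroup (E n) (add_monoid N)"
    proof (rule subgroup.intro)
      fix x y assume "x \<in> E n" "y \<in> E n"
      then have "x \<in> D n" "y \<in> D n" "x \<in> carrier N" "y \<in> carrier N" by (auto simp: E)
      then show "x \<otimes>\<^bsub>add_monoid N\<^esub> y \<in> E n"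
        using M.D_add[of x n y] N.a_closed[of x y] by (simp add: E ops)
    next
      fix x assume "x \<in> E n"
      then have "x \<in> D n" "x \<in> carrier N" by (auto simp: E)
      then show "inv\<^bsub>add_monoid N\<^esub> x \<in> E n"
        using subgroup.m_inv_closed[OF M.D_subgroup, of x n] N.a_inv_closed[of x, unfolded a_inv_def] inv[of x]
        by (simp add: E)
    qed (use M.D_zero N.zero_closed ops in \<open>auto simp: E\<close>)
  next
    fix x assume x: "x \<in> carrier N"
    then have xM: "x \<in> carrier M" using assms(3) by blast
    have "x = finsum N (homog M D x) {n. homog M D x n \<noteq> \<zero>\<^bsub>M\<^esub>}"
      using M.homog_sum[OF xM] hom[OF x] by (simp add: fs)
    then show "\<exists>S. finite S \<and> (\<forall>n. homog M D x n \<in> E n) \<and> (\<forall>n. n \<notin> S \<longrightarrow> homog M D x n = \<zero>\<^bsub>N\<^esub>) \<and>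
      x = finsum N (homog M D x) S"
      using M.finite_homog[OF xM] M.homog_D[OF xM] hom[OF x]
      by (intro exI[of _ "{n. homog M D x n \<noteq> \<zero>\<^bsub>M\<^esub>}"] conjI) (simp_all add: E ops)
  next
    fix c S assume "finite S" and c: "\<And>n. c n \<in> E n" and 0: "\<And>n. n \<notin> S \<Longrightarrow> c n = \<zero>\<^bsub>N\<^esub>"
    moreover have "finsum N c S = finsum M c S" using c by (intro fs) (simp add: E)
    ultimately show "homog M D (finsum N c S) = c"
      by (intro M.homog_eqI[of S]) (simp_all add: E ops)
  qed
qed

lemma graded_by_shift:
  assumes "graded_group M D"
  shows "graded_by M (\<lambda>n. D (n - t))"
proof -
  interpret M: graded_group M D by fact
  have re: "finsum M c S = finsum M (\<lambda>n. c (n + t)) ((\<lambda>n. n - t) ` S)" if "\<And>n. c n \<in> carrier M" for c S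
  proof -
    have "S = (\<lambda>n. n + t) ` ((\<lambda>n. n - t) ` S)" by (auto simp: image_image)
    then have "finsum M c S = finsum M c ((\<lambda>n. n + t) ` ((\<lambda>n. n - t) ` S))" by simp
    also have "\<dots> = finsum M (\<lambda>n. c (n + t)) ((\<lambda>n. n - t) ` S)"
      using that by (intro M.finsum_reindex) auto
    finally show ?thesis .
  qed
  show ?thesis
  proof (rule graded_byI[OF M.abelian_group_axioms M.D_subgroup, of "\<lambda>x n. homog M D x (n - t)"])
    fix x assume x: "x \<in> carrier M"
    let ?S = "{n. homog M D x n \<noteq> \<zero>\<^bsub>M\<^esub>}"
    have "finsum M (\<lambda>n. homog M D x (n - t)) ((\<lambda>n. n + t) ` ?S) = x"
      using M.homog_D[OF x] M.D_carrier M.homog_sum[OF x] by (subst re) (auto simp: image_image)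
    then show "\<exists>S. finite S \<and> (\<forall>n. homog M D x (n - t) \<in> D (n - t)) \<and>
      (\<forall>n. n \<notin> S \<longrightarrow> homog M D x (n - t) = \<zero>\<^bsub>M\<^esub>) \<and> x = finsum M (\<lambda>n. homog M D x (n - t)) S"
      using M.homog_D[OF x] M.finite_homog[OF x]
      by (intro exI[of _ "(\<lambda>n. n + t) ` ?S"]) (force intro: rev_image_eqI)
  next
    fix c S assume S: "finite S" "\<And>n. c n \<in> D (n - t)" "\<And>n. n \<notin> S \<Longrightarrow> c n = \<zero>\<^bsub>M\<^esub>"
    have "c n \<in> carrier M" for n using S(2) M.D_carrier by blast
    then have sum: "finsum M c S = finsum M (\<lambda>n. c (n + t)) ((\<lambda>n. n - t) ` S)" by (rule re)
    have "homog M D (finsum M c S) = (\<lambda>n. c (n + t))"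
    proof (rule M.homog_eqI[OF _ _ _ sum])
      show "c (n + t) \<in> D n" for n using S(2)[of "n + t"] by simp
      show "c (n + t) = \<zero>\<^bsub>M\<^esub>" if "n \<notin> (\<lambda>n. n - t) ` S" for n
        using S(3)[of "n + t"] that by force
    qed (use S(1) in simp)
    then show "(\<lambda>n. homog M D (finsum M c S) (n - t)) = c" by simp
  qed
qed

section \<open>Graded modules\<close>

lemma graded_module_group: "graded_module A M \<Longrightarrow> graded_group M (gm_comp M)"
  by (auto simp: graded_module_def graded_group_def graded_group_axioms_def left_module_def)

lemma graded_ring_group: "graded_ring A \<Longrightarrow> graded_group A (gr_comp A)"
  by (auto simp: graded_ring_def graded_group_def graded_group_axioms_def ring_def)

context left_module
begin

lemma smult_zero_left: "x \<in> carrier M \<Longrightarrow> \<zero>\<^bsub>R\<^esub> \<odot>\<^bsub>M\<^esub> x = \<zero>\<^bsub>M\<^esub>"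
  by (rule additive_zero[OF R.abelian_group_axioms M.abelian_group_axioms, of "\<lambda>a. a \<odot>\<^bsub>M\<^esub> x"])
    (auto simp: smult_closed smult_l_distr)

lemma smult_finsum:
  "a \<in> carrier R \<Longrightarrow> f \<in> S \<rightarrow> carrier M \<Longrightarrow> a \<odot>\<^bsub>M\<^esub> finsum M f S = finsum M (\<lambda>s. a \<odot>\<^bsub>M\<^esub> f s) S"
  by (rule additive_finsum[OF M.abelian_group_axioms M.abelian_group_axioms, of "\<lambda>x. a \<odot>\<^bsub>M\<^esub> x"])
    (auto simp: smult_closed smult_r_distr)

end

lemma abelian_group_cong:
  "add_monoid N = add_monoid M \<Longrightarrow> abelian_group N = abelian_group M"
  by (simp add: abelian_group_def abelian_monoid_def abelian_group_axioms_def)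

lemma finsum_gshift: "finsum (gshift t M) = finsum M"
  by (simp add: fun_eq_iff finsum_def gshift_def)

lemma carrier_gshift [simp]: "carrier (gshift t M) = carrier M"
  and add_gshift [simp]: "add (gshift t M) = add M"
  and zero_gshift [simp]: "zero (gshift t M) = zero M"
  and smult_gshift [simp]: "smult (gshift t M) = smult M"
  and gm_comp_gshift [simp]: "gm_comp (gshift t M) n = gm_comp M (n - t)"
  by (simp_all add: gshift_def)

lemma carrier_gsub [simp]: "carrier (gsub M N) = N"
  and add_gsub [simp]: "add (gsub M N) = add M"
  and zero_gsub [simp]: "zero (gsub M N) = zero M"
  and smult_gsub [simp]: "smult (gsub M N) = smult M"
  and gm_comp_gsub [simp]: "gm_comp (gsub M N) n = gm_comp M n \<inter> N"
  by (simp_all add: gsub_def)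

lemma graded_module_gshift:
  assumes "graded_module A M"
  shows "graded_module A (gshift t M)"
proof -
  have "abelian_group (gshift t M) = abelian_group M" by (intro abelian_group_cong) simp
  moreover have "graded_by (gshift t M) (gm_comp (gshift t M)) = graded_by M (\<lambda>n. gm_comp M (n - t))"
    by (simp add: graded_by_def finsum_gshift)
  moreover have "a \<odot>\<^bsub>M\<^esub> x \<in> gm_comp M (m + n - t)" if "a \<in> gr_comp A m" "x \<in> gm_comp M (n - t)" for a x m n
  proof -
    have "a \<odot>\<^bsub>M\<^esub> x \<in> gm_comp M (m + (n - t))" using assms that by (simp add: graded_module_def)
    then show ?thesis by (simp add: add_diff_eq)
  qed
  ultimately show ?thesis
    using assms graded_by_shift[OF graded_module_group[OF assms], of t]
    by (simp add: graded_module_def left_module_def left_module_axioms_def)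
qed

lemma gsub_abelian_group:
  assumes "left_module A M" and "submodule N A M"
  shows "abelian_group (gsub M N)"
proof -
  interpret left_module A M by fact
  interpret N: submodule N A M by fact
  have cl: "x \<oplus>\<^bsub>M\<^esub> y \<in> N" if "x \<in> N" "y \<in> N" for x y using N.m_closed that by simp
  have z: "\<zero>\<^bsub>M\<^esub> \<in> N" using N.one_closed by simp
  show ?thesis
  proof (rule abelian_groupI)
    fix x assume "x \<in> carrier (gsub M N)"
    then show "\<exists>y\<in>carrier (gsub M N). y \<oplus>\<^bsub>gsub M N\<^esub> x = \<zero>\<^bsub>gsub M N\<^esub>"
      using N.m_inv_closed[of x] M.add.l_inv[of x] N.subset by (intro bexI[of _ "\<ominus>\<^bsub>M\<^esub> x"]) (auto simp: a_inv_def)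
  qed (use cl z N.subset in \<open>auto simp: subset_iff intro: M.a_assoc M.a_comm\<close>)
qed

lemma gsub_left_module:
  assumes "left_module A M" and "submodule N A M"
  shows "left_module A (gsub M N)"
proof -
  interpret left_module A M by fact
  interpret N: submodule N A M by fact
  interpret G: abelian_group "gsub M N" by (rule gsub_abelian_group[OF assms])
  show ?thesis
    by unfold_locales
      (use N.subset in \<open>auto simp: subset_iff smult_l_distr smult_r_distr smult_assoc smult_one\<close>)
qed

lemma graded_submoduleI:
  assumes M: "graded_module A M" and N: "submodule N A M"
    and hom: "\<And>x n. x \<in> N \<Longrightarrow> homog M (gm_comp M) x n \<in> N"
  shows "graded_submodule A M N"
proof -
  have lm: "left_module A M" and "graded_ring A" using M by (auto simp: graded_module_def)
  interpret left_module A M by (rule lm)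
  interpret N: submodule N A M by fact
  have "graded_by (gsub M N) (gm_comp (gsub M N))"
    by (rule graded_by_subset[OF graded_module_group[OF M] gsub_abelian_group[OF lm N]])
      (use N.subset hom in auto)
  moreover have "a \<in> carrier A" if "a \<in> gr_comp A n" for a n
    using graded_group.D_carrier[OF graded_ring_group[OF \<open>graded_ring A\<close>] that] .
  ultimately show ?thesis
    using N M gsub_left_module[OF lm N]
    by (auto simp: graded_submodule_def graded_module_def)
qed

text \<open>A homogeneous summand of \<open>M\<close> without elements in the degree \<open>t\<close> of the generators vanishes,
  since then the complement contains all generators.\<close>

lemma summand_eq_zero:
  assumes M: "graded_module A M" and gen: "generated_in_degree A t M"
    and comp: "complementary A M N N'" and deg: "N \<inter> gm_comp M t = {\<zero>\<^bsub>M\<^esub>}"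
  shows "N = {\<zero>\<^bsub>M\<^esub>}"
proof -
  have lm: "left_module A M" using M by (auto simp: graded_module_def)
  have N: "submodule N A M" "graded_module A (gsub M N)" and N': "submodule N' A M" "graded_module A (gsub M N')"
    using comp by (auto simp: complementary_def graded_submodule_def)
  have int: "N \<inter> N' = {\<zero>\<^bsub>M\<^esub>}" and sum: "N <+>\<^bsub>M\<^esub> N' = carrier M"
    using comp by (auto simp: complementary_def)
  interpret left_module A M by (rule lm)
  interpret M: graded_group M "gm_comp M" by (rule graded_module_group[OF M])
  interpret N: submodule N A M by (rule N)
  interpret N': submodule N' A M by (rule N')
  interpret GN: graded_group "gsub M N" "gm_comp (gsub M N)" by (rule graded_module_group[OF N(2)])
  interpret GN': graded_group "gsub M N'" "gm_comp (gsub M N')" by (rule graded_module_group[OF N'(2)])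
  \<comment> \<open>The grading of \<open>N\<close> is induced from \<open>M\<close>, so components
    taken in \<open>N\<close> and in \<open>M\<close> agree; hence \<open>N\<close> contains the
    components of its elements.\<close>
  have hN: "homog M (gm_comp M) x t \<in> N" if "x \<in> N" for x
  proof -
    have "homog M (gm_comp M) x t = homog (gsub M N) (gm_comp (gsub M N)) x t"
      by (rule homog_additive[OF GN.graded_group_axioms M.graded_group_axioms, of "\<lambda>x. x"])
        (use that N.subset in auto)
    then show ?thesis using GN.homog_D[of x t] that by simp
  qed
  have hN': "homog M (gm_comp M) x t \<in> N'" if "x \<in> N'" for x
  proof -
    have "homog M (gm_comp M) x t = homog (gsub M N') (gm_comp (gsub M N')) x t"
      by (rule homog_additive[OF GN'.graded_group_axioms M.graded_group_axioms, of "\<lambda>x. x"])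
        (use that N'.subset in auto)
    then show ?thesis using GN'.homog_D[of x t] that by simp
  qed
  have "gm_comp M t \<subseteq> N'"
  proof
    fix x assume x: "x \<in> gm_comp M t"
    then have "x \<in> N <+>\<^bsub>M\<^esub> N'" using sum M.D_carrier by blast
    then obtain y y' where y: "y \<in> N" "y' \<in> N'" "x = y \<oplus>\<^bsub>M\<^esub> y'" by (auto simp: set_add_def')
    have yc: "y \<in> carrier M" "y' \<in> carrier M" using y N.subset N'.subset by auto
    \<comment> \<open>A generator is its own component of degree \<open>t\<close>. Its part in
      \<open>N\<close> may thus be replaced by a component lying in
      \<open>N \<inter> gm_comp M t\<close>, which is 0.\<close>
    have "x = homog M (gm_comp M) (y \<oplus>\<^bsub>M\<^esub> y') t" using M.homog_homogeneous[OF x] y by simp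
    also have "\<dots> = homog M (gm_comp M) y t \<oplus>\<^bsub>M\<^esub> homog M (gm_comp M) y' t"
      by (rule M.homog_add) (use yc in auto)
    also have "homog M (gm_comp M) y t = \<zero>\<^bsub>M\<^esub>"
      using hN[OF y(1)] M.homog_D[OF yc(1), of t] deg by blast
    finally show "x \<in> N'" using hN'[OF y(2)] N'.subset by auto
  qed
  then have "N' = carrier M" using gen N' by (auto simp: generated_in_degree_def)
  then show ?thesis using int N.subset by auto
qed

section \<open>Direct sums of modules generated by idempotents\<close>

text \<open>The left ideal generated by \<open>c\<close>. The modules \<open>proj_module\<close> are
  of this form; the abstract version keeps the module theory free of paths.\<close>

definition cyclic_module :: "'a gring \<Rightarrow> 'a \<Rightarrow> ('a, 'a) gmodule" where
  "cyclic_module A c =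
    \<lparr>carrier = {a \<otimes>\<^bsub>A\<^esub> c | a. a \<in> carrier A}, mult = undefined, one = undefined, zero = zero A, add = add A,
     smult = mult A, gm_comp = (\<lambda>n. gr_comp A n \<inter> {a \<otimes>\<^bsub>A\<^esub> c | a. a \<in> carrier A})\<rparr>"

locale idempotent_sum =
  fixes A :: "'a gring" (structure) and V :: "'i set" and e :: "'i \<Rightarrow> 'a"
  assumes graded_ring: "graded_ring A" and finite_V: "finite V"
    and e_degree: "\<And>v. v \<in> V \<Longrightarrow> e v \<in> gr_comp A 0"
    and e_idem: "\<And>v. v \<in> V \<Longrightarrow> e v \<otimes> e v = e v"
begin

sublocale A: ring A
  using graded_ring by (simp add: graded_ring_def)

sublocale GA: graded_group A "gr_comp A"
  by (rule graded_ring_group[OF graded_ring])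

definition M :: "('a, 'i \<Rightarrow> 'a) gmodule" where
  "M = gdirect_sum V (\<lambda>v. cyclic_module A (e v))"

lemma gr_mult: "a \<in> gr_comp A m \<Longrightarrow> b \<in> gr_comp A n \<Longrightarrow> a \<otimes> b \<in> gr_comp A (m + n)"
  using graded_ring by (simp add: graded_ring_def)

lemma gr_carrier: "a \<in> gr_comp A m \<Longrightarrow> a \<in> carrier A"
  by (rule GA.D_carrier)

lemma e_carrier: "v \<in> V \<Longrightarrow> e v \<in> carrier A"
  using e_degree gr_carrier by blast

text \<open>For an idempotent, membership in the left ideal is an equation and can be checked
  without exhibiting a preimage.\<close>

lemma cyclic_carrier:
  assumes "v \<in> V"
  shows "a \<in> carrier (cyclic_module A (e v)) \<longleftrightarrow> a \<in> carrier A \<and> a \<otimes> e v = a"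
proof
  assume "a \<in> carrier (cyclic_module A (e v))"
  then obtain b where b: "b \<in> carrier A" "a = b \<otimes> e v" by (auto simp: cyclic_module_def)
  then show "a \<in> carrier A \<and> a \<otimes> e v = a"
    using e_carrier[OF assms] e_idem[OF assms] by (simp add: A.m_assoc)
next
  assume "a \<in> carrier A \<and> a \<otimes> e v = a"
  then show "a \<in> carrier (cyclic_module A (e v))" by (auto simp: cyclic_module_def) metis
qed

lemma M_carrier:
  "x \<in> carrier M \<longleftrightarrow> x \<in> extensional V \<and> (\<forall>v\<in>V. x v \<in> carrier A \<and> x v \<otimes> e v = x v)"
  using finite_V by (auto simp: M_def gdirect_sum_def cyclic_carrier PiE_def Pi_def)

lemma M_add: "x \<oplus>\<^bsub>M\<^esub> y = (\<lambda>v\<in>V. x v \<oplus> y v)"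
  and M_zero: "\<zero>\<^bsub>M\<^esub> = (\<lambda>v\<in>V. \<zero>)"
  and M_smult: "a \<odot>\<^bsub>M\<^esub> x = (\<lambda>v\<in>V. a \<otimes> x v)"
  by (simp_all add: M_def gdirect_sum_def cyclic_module_def)

lemma M_comp: "x \<in> gm_comp M n \<longleftrightarrow> x \<in> carrier M \<and> (\<forall>v\<in>V. x v \<in> gr_comp A n)"
proof -
  have "gm_comp (cyclic_module A (e v)) n = gr_comp A n \<inter> carrier (cyclic_module A (e v))" for v
    by (simp add: cyclic_module_def)
  then show ?thesis
    by (auto simp: M_def gdirect_sum_def Let_def PiE_def Pi_def)
qed

lemma M_eqI: "x \<in> carrier M \<Longrightarrow> y \<in> carrier M \<Longrightarrow> (\<And>v. v \<in> V \<Longrightarrow> x v = y v) \<Longrightarrow> x = y"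
  by (rule extensionalityI[of _ V]) (auto simp: M_carrier)

lemma M_mem: "x \<in> carrier M \<Longrightarrow> v \<in> V \<Longrightarrow> x v \<in> carrier A"
  by (simp add: M_carrier)

lemma M_idem: "x \<in> carrier M \<Longrightarrow> v \<in> V \<Longrightarrow> x v \<otimes> e v = x v"
  by (simp add: M_carrier)

lemma M_abelian_group: "abelian_group M"
proof (rule abelian_groupI)
  fix x assume x: "x \<in> carrier M"
  have "(\<lambda>v\<in>V. \<ominus> x v) \<oplus>\<^bsub>M\<^esub> x = \<zero>\<^bsub>M\<^esub>"
    using x by (auto simp: M_add M_zero M_carrier A.l_neg fun_eq_iff restrict_def)
  moreover have "(\<lambda>v\<in>V. \<ominus> x v) \<in> carrier M"
    using x e_carrier by (auto simp: M_carrier A.l_minus)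
  ultimately show "\<exists>y\<in>carrier M. y \<oplus>\<^bsub>M\<^esub> x = \<zero>\<^bsub>M\<^esub>" by blast
next
  fix x y assume xy: "x \<in> carrier M" "y \<in> carrier M"
  then show "x \<oplus>\<^bsub>M\<^esub> y \<in> carrier M"
    using e_carrier by (auto simp: M_carrier M_add A.l_distr)
  show "x \<oplus>\<^bsub>M\<^esub> y = y \<oplus>\<^bsub>M\<^esub> x"
    using xy by (auto simp: M_add fun_eq_iff restrict_def M_carrier intro: A.a_comm)
  fix z assume "z \<in> carrier M"
  then show "x \<oplus>\<^bsub>M\<^esub> y \<oplus>\<^bsub>M\<^esub> z = x \<oplus>\<^bsub>M\<^esub> (y \<oplus>\<^bsub>M\<^esub> z)"
    using xy by (auto simp: M_add fun_eq_iff restrict_def M_carrier intro: A.a_assoc)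
next
  fix x assume x: "x \<in> carrier M"
  then have "x v = undefined" if "v \<notin> V" for v using that by (auto simp: M_carrier extensional_def)
  then show "\<zero>\<^bsub>M\<^esub> \<oplus>\<^bsub>M\<^esub> x = x"
    using x by (auto simp: M_add M_zero M_carrier fun_eq_iff restrict_def)
qed (use e_carrier in \<open>auto simp: M_zero M_carrier\<close>)

sublocale M: abelian_group M
  by (rule M_abelian_group)

lemma M_left_module: "left_module A M"
proof (unfold_locales)
  fix a x assume "a \<in> carrier A" "x \<in> carrier M"
  then show "a \<odot>\<^bsub>M\<^esub> x \<in> carrier M"
    using e_carrier by (auto simp: M_carrier M_smult A.m_assoc)
next
  fix x assume x: "x \<in> carrier M"
  then have "x v = undefined" if "v \<notin> V" for v using that by (auto simp: M_carrier extensional_def)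
  then show "\<one> \<odot>\<^bsub>M\<^esub> x = x"
    using x by (auto simp: M_smult M_carrier fun_eq_iff restrict_def)
qed (auto simp: M_smult M_add M_carrier fun_eq_iff restrict_def A.l_distr A.r_distr A.m_assoc)

sublocale M: left_module A M
  by (rule M_left_module)

lemma M_finsum:
  assumes "f \<in> S \<rightarrow> carrier M" and "v \<in> V"
  shows "finsum M f S v = finsum A (\<lambda>s. f s v) S"
  by (rule additive_finsum[OF M_abelian_group A.abelian_group_axioms, of "\<lambda>x. x v"])
    (use assms in \<open>auto simp: M_mem M_add\<close>)

lemma homog_mult_e:
  assumes "a \<in> carrier A" and "v \<in> V"
  shows "homog A (gr_comp A) (a \<otimes> e v) n = homog A (gr_comp A) a n \<otimes> e v"
  by (rule homog_additive[OF GA.graded_group_axioms GA.graded_group_axioms, of "\<lambda>a. a \<otimes> e v"])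
    (use assms e_carrier gr_mult[OF _ e_degree] in \<open>auto simp: A.l_distr\<close>)

lemma M_graded_by: "graded_by M (gm_comp M)"
proof (rule graded_byI[OF M_abelian_group, of _ "\<lambda>x n. \<lambda>v\<in>V. homog A (gr_comp A) (x v) n"])
  fix n
  show "subgroup (gm_comp M n) (add_monoid M)"
  proof (rule subgroup.intro)
    fix x assume x: "x \<in> gm_comp M n"
    then have xc: "x \<in> carrier M" by (simp add: M_comp)
    have "\<ominus>\<^bsub>M\<^esub> x = (\<lambda>v\<in>V. \<ominus> x v)"
    proof (rule M.minus_equality[OF _ xc])
      show "(\<lambda>v\<in>V. \<ominus> x v) \<oplus>\<^bsub>M\<^esub> x = \<zero>\<^bsub>M\<^esub>"
        using xc by (auto simp: M_add M_zero M_carrier A.l_neg fun_eq_iff restrict_def)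
      show "(\<lambda>v\<in>V. \<ominus> x v) \<in> carrier M"
        using xc e_carrier by (auto simp: M_carrier A.l_minus)
    qed
    moreover have "\<ominus> x v \<in> gr_comp A n" if "v \<in> V" for v
      using subgroup.m_inv_closed[OF GA.D_subgroup, of "x v" n] x that by (simp add: M_comp a_inv_def)
    ultimately show "inv\<^bsub>add_monoid M\<^esub> x \<in> gm_comp M n"
      using M.a_inv_closed[OF xc] by (simp add: M_comp a_inv_def)
  next
    fix x y assume "x \<in> gm_comp M n" "y \<in> gm_comp M n"
    then have "x \<in> carrier M" "y \<in> carrier M" "\<forall>v\<in>V. x v \<oplus> y v \<in> gr_comp A n"
      using GA.D_add by (auto simp: M_comp)
    then show "x \<otimes>\<^bsub>add_monoid M\<^esub> y \<in> gm_comp M n"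
      using M.a_closed[of x y] by (simp add: M_comp) (simp add: M_add)
  next
    show "gm_comp M n \<subseteq> carrier (add_monoid M)" by (auto simp: M_comp)
    show "\<one>\<^bsub>add_monoid M\<^esub> \<in> gm_comp M n"
      using M.zero_closed by (simp add: M_comp) (simp add: M_zero GA.D_zero)
  qed
next
  fix x assume x: "x \<in> carrier M"
  let ?p = "\<lambda>n. \<lambda>v\<in>V. homog A (gr_comp A) (x v) n"
  \<comment> \<open>One finite set of degrees that serves all coordinates at once.\<close>
  define S where "S = (\<Union>v\<in>V. {n. homog A (gr_comp A) (x v) n \<noteq> \<zero>})"
  have S: "finite S" unfolding S_def using finite_V GA.finite_homog M_mem[OF x] by blast
  have pc: "?p n \<in> carrier M" for n
    using gr_carrier[OF GA.homog_D[OF M_mem[OF x]]] homog_mult_e[OF M_mem[OF x], symmetric] M_idem[OF x]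
    by (simp add: M_carrier)
  have p: "?p n \<in> gm_comp M n" for n
    using pc GA.homog_D M_mem[OF x] by (auto simp: M_comp)
  have z: "?p n = \<zero>\<^bsub>M\<^esub>" if "n \<notin> S" for n
    using that by (auto simp: M_zero S_def fun_eq_iff restrict_def)
  have "x = finsum M ?p S"
  proof (rule M_eqI[OF x])
    show "finsum M ?p S \<in> carrier M" using pc by (intro M.finsum_closed) auto
    fix v assume v: "v \<in> V"
    have "x v = finsum A (homog A (gr_comp A) (x v)) {n. homog A (gr_comp A) (x v) n \<noteq> \<zero>}"
      by (rule GA.homog_sum[OF M_mem[OF x v]])
    also have "\<dots> = finsum A (\<lambda>n. ?p n v) S"
      using v S GA.homog_D[OF M_mem[OF x v]] gr_carrier
      by (intro A.add.finprod_mono_neutral_cong_left) (auto simp: S_def)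
    also have "\<dots> = finsum M ?p S v" using pc v by (subst M_finsum) auto
    finally show "x v = finsum M ?p S v" .
  qed
  then show "\<exists>S. finite S \<and> (\<forall>n. ?p n \<in> gm_comp M n) \<and> (\<forall>n. n \<notin> S \<longrightarrow> ?p n = \<zero>\<^bsub>M\<^esub>) \<and> x = finsum M ?p S"
    using S p z by blast
next
  fix c S assume S: "finite S" and c: "\<And>n. c n \<in> gm_comp M n" and z: "\<And>n. n \<notin> S \<Longrightarrow> c n = \<zero>\<^bsub>M\<^esub>"
  have cc: "c n \<in> carrier M" for n using c by (simp add: M_comp)
  have h: "homog A (gr_comp A) (finsum M c S v) = (\<lambda>n. c n v)" if v: "v \<in> V" for v
  proof (rule GA.homog_eqI[OF S])
    show "c n v \<in> gr_comp A n" for n using c v by (simp add: M_comp)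
    show "c n v = \<zero>" if "n \<notin> S" for n using z[OF that] v by (simp add: M_zero)
    show "finsum M c S v = finsum A (\<lambda>n. c n v) S" using cc v by (intro M_finsum) auto
  qed
  show "(\<lambda>n. \<lambda>v\<in>V. homog A (gr_comp A) (finsum M c S v) n) = c"
  proof
    fix n
    show "(\<lambda>v\<in>V. homog A (gr_comp A) (finsum M c S v) n) = c n"
      by (rule extensionalityI[of _ V]) (use cc[of n] in \<open>auto simp: h M_carrier\<close>)
  qed
qed

lemma M_graded: "graded_module A M"
proof -
  have "a \<odot>\<^bsub>M\<^esub> x \<in> gm_comp M (m + n)" if "a \<in> gr_comp A m" "x \<in> gm_comp M n" for a x m n
  proof -
    have "a \<odot>\<^bsub>M\<^esub> x \<in> carrier M" using that gr_carrier by (auto simp: M_comp intro: M.smult_closed)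
    then show ?thesis using that gr_mult by (auto simp: M_comp M_smult)
  qed
  then show ?thesis using graded_ring M_left_module M_graded_by by (simp add: graded_module_def)
qed

sublocale GM: graded_group M "gm_comp M"
  by (rule graded_module_group[OF M_graded])

lemma M_homog: "x \<in> carrier M \<Longrightarrow> v \<in> V \<Longrightarrow> homog M (gm_comp M) x n v = homog A (gr_comp A) (x v) n"
  by (rule homog_additive[OF GM.graded_group_axioms GA.graded_group_axioms, of "\<lambda>x. x v", symmetric])
    (auto simp: M_mem M_add M_comp)

section \<open>Generators and the lifting property\<close>

definition gen :: "'i \<Rightarrow> 'i \<Rightarrow> 'a" where
  "gen v = (\<lambda>w\<in>V. if w = v then e v else \<zero>)"

lemma gen_comp: "v \<in> V \<Longrightarrow> gen v \<in> gm_comp M 0"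
  using e_degree e_idem e_carrier GA.D_zero by (auto simp: M_comp M_carrier gen_def)

lemma gen_carrier: "v \<in> V \<Longrightarrow> gen v \<in> carrier M"
  using gen_comp by (simp add: M_comp)

lemma e_gen: "v \<in> V \<Longrightarrow> e v \<odot>\<^bsub>M\<^esub> gen v = gen v"
  using e_idem e_carrier by (auto simp: M_smult gen_def fun_eq_iff restrict_def)

text \<open>The coordinates double as coefficients, because
  \<open>x v \<otimes> e v = x v\<close>.\<close>

lemma gen_expansion:
  assumes x: "x \<in> carrier M"
  shows "x = finsum M (\<lambda>v. x v \<odot>\<^bsub>M\<^esub> gen v) V"
proof (rule M_eqI[OF x])
  have cl: "(\<lambda>v. x v \<odot>\<^bsub>M\<^esub> gen v) \<in> V \<rightarrow> carrier M" using x gen_carrier M_mem by (auto intro: M.smult_closed)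
  then show "finsum M (\<lambda>v. x v \<odot>\<^bsub>M\<^esub> gen v) V \<in> carrier M" by (rule M.finsum_closed)
  fix w assume w: "w \<in> V"
  have "finsum M (\<lambda>v. x v \<odot>\<^bsub>M\<^esub> gen v) V w = finsum A (\<lambda>v. if w = v then x v else \<zero>) V"
    unfolding M_finsum[OF cl w]
    by (rule A.finsum_cong') (use w x M_mem M_idem in \<open>auto simp: M_smult gen_def\<close>)
  also have "\<dots> = x w"
    using A.finsum_singleton[OF w finite_V, of x] M_mem[OF x] by auto
  finally show "x w = finsum M (\<lambda>v. x v \<odot>\<^bsub>M\<^esub> gen v) V w" by simp
qed

lemma M_generated: "generated_in_degree A t (gshift t M)"
  unfolding generated_in_degree_def
proof (intro allI impI, elim conjE)
  fix N assume N: "submodule N A (gshift t M)" and gens: "gm_comp (gshift t M) t \<subseteq> N"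
  interpret N: submodule N A "gshift t M" by fact
  have sub: "N \<subseteq> carrier M" using N.subset by simp
  have add: "x \<oplus>\<^bsub>M\<^esub> y \<in> N" if "x \<in> N" "y \<in> N" for x y using N.m_closed that by simp
  have zero: "\<zero>\<^bsub>M\<^esub> \<in> N" using N.one_closed by simp
  have sm: "a \<odot>\<^bsub>M\<^esub> x \<in> N" if "a \<in> carrier A" "x \<in> N" for a x using N.smult_closed that by simp
  have sums: "finsum M f S \<in> N" if "finite S" "f ` S \<subseteq> N" for f and S :: "'i set"
    using that
  proof (induction S rule: finite_induct)
    case (insert s S)
    then have "f \<in> S \<rightarrow> carrier M" "f s \<in> carrier M" using sub by auto
    then show ?case using insert add by simp
  qed (simp add: zero)
  have expand: "finsum M (\<lambda>v. x v \<odot>\<^bsub>M\<^esub> gen v) V \<in> N" if "x \<in> carrier M" for x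
  proof -
    have "x v \<odot>\<^bsub>M\<^esub> gen v \<in> N" if "v \<in> V" for v
      using gens gen_comp[OF that] M_mem[OF \<open>x \<in> carrier M\<close> that] by (intro sm) auto
    then show ?thesis by (intro sums finite_V) auto
  qed
  have "x \<in> N" if "x \<in> carrier M" for x
    using expand[OF that] gen_expansion[OF that] by simp
  then show "N = carrier (gshift t M)" using sub by auto
qed

text \<open>The images of the generators are lifted along \<open>g\<close>, and each lift is
  replaced by its component of degree \<open>t\<close>; this keeps its image and makes the lifted
  map homogeneous of degree 0.\<close>

lemma M_projective: "graded_projective TYPE('m) TYPE('n) A (gshift t M)"
  unfolding graded_projective_def
proof (intro conjI allI impI graded_module_gshift M_graded, elim conjE)
  fix X :: "('a, 'm) gmodule" and Y :: "('a, 'n) gmodule" and g f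
  assume X: "graded_module A X" and Y: "graded_module A Y" and g: "g \<in> graded_hom A X Y"
    and surj: "g ` carrier X = carrier Y" and f: "f \<in> graded_hom A (gshift t M) Y"
  have lX: "left_module A X" and lY: "left_module A Y" using X Y by (auto simp: graded_module_def)
  interpret X: left_module A X by (rule lX)
  interpret Y: left_module A Y by (rule lY)
  interpret GX: graded_group X "gm_comp X" by (rule graded_module_group[OF X])
  interpret GY: graded_group Y "gm_comp Y" by (rule graded_module_group[OF Y])
  have gc: "g \<in> carrier X \<rightarrow> carrier Y" and gadd: "\<And>x y. x \<in> carrier X \<Longrightarrow> y \<in> carrier X \<Longrightarrow> g (x \<oplus>\<^bsub>X\<^esub> y) = g x \<oplus>\<^bsub>Y\<^esub> g y"
    and gsm: "\<And>a x. a \<in> carrier A \<Longrightarrow> x \<in> carrier X \<Longrightarrow> g (a \<odot>\<^bsub>X\<^esub> x) = a \<odot>\<^bsub>Y\<^esub> g x"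
    and gdeg: "\<And>n x. x \<in> gm_comp X n \<Longrightarrow> g x \<in> gm_comp Y n"
    using g by (simp_all add: graded_hom_def image_subset_iff)
  have fc: "f \<in> carrier M \<rightarrow> carrier Y" and fadd: "\<And>x y. x \<in> carrier M \<Longrightarrow> y \<in> carrier M \<Longrightarrow> f (x \<oplus>\<^bsub>M\<^esub> y) = f x \<oplus>\<^bsub>Y\<^esub> f y"
    and fsm: "\<And>a x. a \<in> carrier A \<Longrightarrow> x \<in> carrier M \<Longrightarrow> f (a \<odot>\<^bsub>M\<^esub> x) = a \<odot>\<^bsub>Y\<^esub> f x"
    and fdeg: "\<And>n x. x \<in> gm_comp M (n - t) \<Longrightarrow> f x \<in> gm_comp Y n"
    using f by (simp_all add: graded_hom_def image_subset_iff)
  have XD: "a \<odot>\<^bsub>X\<^esub> x \<in> gm_comp X (m + n)" if "a \<in> gr_comp A m" "x \<in> gm_comp X n" for a x m n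
    using X that by (simp add: graded_module_def)
  have "\<exists>m. m \<in> gm_comp X t \<and> g m = f (gen v)" if v: "v \<in> V" for v
  proof -
    have fg: "f (gen v) \<in> gm_comp Y t" using fdeg[of "gen v" t] gen_comp[OF v] by simp
    then obtain m where m: "m \<in> carrier X" "g m = f (gen v)" using surj GY.D_carrier by (metis imageE)
    define m' where "m' = homog X (gm_comp X) m t"
    have m': "m' \<in> gm_comp X t" unfolding m'_def by (rule GX.homog_D[OF m(1)])
    have "g m' = homog Y (gm_comp Y) (g m) t"
      unfolding m'_def by (rule homog_additive[OF GX.graded_group_axioms GY.graded_group_axioms gc gadd gdeg m(1), symmetric])
    also have "\<dots> = f (gen v)" unfolding m(2) using GY.homog_homogeneous[OF fg] by simp
    finally show ?thesis using m' by blast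
  qed
  then obtain m where m: "\<And>v. v \<in> V \<Longrightarrow> m v \<in> gm_comp X t" "\<And>v. v \<in> V \<Longrightarrow> g (m v) = f (gen v)" by metis
  have mc: "m v \<in> carrier X" if "v \<in> V" for v using m(1)[OF that] by (rule GX.D_carrier)
  \<comment> \<open>The coefficients are the coordinates of \<open>x\<close>, which depend linearly
    on \<open>x\<close>, so every choice of \<open>m v\<close> in degree \<open>t\<close> gives a
    homomorphism.\<close>
  define h where "h x = finsum X (\<lambda>v. x v \<odot>\<^bsub>X\<^esub> m v) V" for x
  have cl: "(\<lambda>v. x v \<odot>\<^bsub>X\<^esub> m v) \<in> V \<rightarrow> carrier X" if "x \<in> carrier M" for x
    using that mc M_mem by (auto intro: X.smult_closed)
  show "\<exists>h\<in>graded_hom A (gshift t M) X. \<forall>x\<in>carrier (gshift t M). g (h x) = f x"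
  proof (intro bexI ballI)
    fix x assume "x \<in> carrier (gshift t M)"
    then have x: "x \<in> carrier M" by simp
    have "g (h x) = finsum Y (\<lambda>v. g (x v \<odot>\<^bsub>X\<^esub> m v)) V"
      unfolding h_def by (rule additive_finsum[OF X.M.abelian_group_axioms Y.M.abelian_group_axioms gc gadd cl[OF x]])
    also have "\<dots> = finsum Y (\<lambda>v. f (x v \<odot>\<^bsub>M\<^esub> gen v)) V"
      using M_mem[OF x] mc m(2) gen_carrier funcset_mem[OF fc gen_carrier]
      by (intro Y.M.finsum_cong') (auto simp: gsm fsm intro!: Y.smult_closed)
    also have "\<dots> = f (finsum M (\<lambda>v. x v \<odot>\<^bsub>M\<^esub> gen v) V)"
    proof (rule additive_finsum[OF M_abelian_group Y.M.abelian_group_axioms fc, symmetric])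
      show "(\<lambda>v. x v \<odot>\<^bsub>M\<^esub> gen v) \<in> V \<rightarrow> carrier M"
        using M_mem[OF x] gen_carrier by (auto intro: M.smult_closed)
    qed (rule fadd)
    also have "\<dots> = f x" using gen_expansion[OF x] by simp
    finally show "g (h x) = f x" .
  next
    have "h \<in> carrier M \<rightarrow> carrier X" using cl by (auto simp: h_def intro!: X.M.finsum_closed)
    moreover have "h (x \<oplus>\<^bsub>M\<^esub> y) = h x \<oplus>\<^bsub>X\<^esub> h y" if x: "x \<in> carrier M" and y: "y \<in> carrier M" for x y
    proof -
      have "h (x \<oplus>\<^bsub>M\<^esub> y) = finsum X (\<lambda>v. (x v \<odot>\<^bsub>X\<^esub> m v) \<oplus>\<^bsub>X\<^esub> (y v \<odot>\<^bsub>X\<^esub> m v)) V"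
        unfolding h_def using cl[OF x] cl[OF y] M_mem[OF x] M_mem[OF y] mc
        by (intro X.M.finsum_cong') (auto simp: M_add X.smult_l_distr Pi_def)
      then show ?thesis unfolding h_def using X.M.finsum_addf[OF cl[OF x] cl[OF y]] by simp
    qed
    moreover have "h (a \<odot>\<^bsub>M\<^esub> x) = a \<odot>\<^bsub>X\<^esub> h x" if a: "a \<in> carrier A" and x: "x \<in> carrier M" for a x
    proof -
      have "h (a \<odot>\<^bsub>M\<^esub> x) = finsum X (\<lambda>v. a \<odot>\<^bsub>X\<^esub> (x v \<odot>\<^bsub>X\<^esub> m v)) V"
        unfolding h_def using cl[OF x] M_mem[OF x] mc a
        by (intro X.M.finsum_cong') (auto simp: M_smult X.smult_assoc Pi_def intro!: X.smult_closed)
      then show ?thesis unfolding h_def using X.smult_finsum[OF a cl[OF x]] by simp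
    qed
    moreover have "h x \<in> gm_comp X n" if x: "x \<in> gm_comp M (n - t)" for x n
      unfolding h_def
    proof (rule GX.D_finsum)
      fix v assume v: "v \<in> V"
      have "x v \<odot>\<^bsub>X\<^esub> m v \<in> gm_comp X (n - t + t)" using x v m(1) by (intro XD) (auto simp: M_comp)
      then show "x v \<odot>\<^bsub>X\<^esub> m v \<in> gm_comp X n" by simp
    qed
    ultimately show "h \<in> graded_hom A (gshift t M) X" by (auto simp: graded_hom_def)
  qed
qed

lemma gshift_0: "gshift 0 X = X"
  by (simp add: gshift_def)

text \<open>Otherwise the summand would avoid the degree of the generators and vanish by
  \<open>summand_eq_zero\<close>. For minimality it therefore suffices to look at the differential
  in that degree.\<close>

lemma indecomposable_summand_degree_0:
  assumes "indecomposable_summand A M N"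
  obtains x where "x \<in> N" and "x \<in> gm_comp M 0" and "x \<noteq> \<zero>\<^bsub>M\<^esub>"
proof -
  obtain N' where N': "complementary A M N N'" and ind: "indecomposable A (gsub M N)"
    using assms by (auto simp: indecomposable_summand_def)
  have "N \<noteq> {\<zero>\<^bsub>M\<^esub>}" using ind by (simp add: indecomposable_def)
  moreover have "generated_in_degree A 0 M" using M_generated[of 0] by (simp add: gshift_0)
  ultimately have ne: "N \<inter> gm_comp M 0 \<noteq> {\<zero>\<^bsub>M\<^esub>}" using summand_eq_zero[OF M_graded _ N'] by blast
  have "submodule N A M" using N' by (simp add: complementary_def graded_submodule_def)
  then interpret N: submodule N A M .
  have "\<zero>\<^bsub>M\<^esub> \<in> N \<inter> gm_comp M 0" using N.one_closed GM.D_zero by simp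
  then show thesis using ne that by blast
qed

section \<open>Coordinate summands and multiplicities\<close>

definition summand :: "'i \<Rightarrow> ('i \<Rightarrow> 'a) set" where
  "summand v = {x \<in> carrier M. \<forall>w\<in>V. w \<noteq> v \<longrightarrow> x w = \<zero>}"

lemma summandI: "x \<in> carrier M \<Longrightarrow> (\<And>w. w \<in> V \<Longrightarrow> w \<noteq> v \<Longrightarrow> x w = \<zero>) \<Longrightarrow> x \<in> summand v"
  by (simp add: summand_def)

lemma summand_carrier: "x \<in> summand v \<Longrightarrow> x \<in> carrier M"
  by (simp add: summand_def)

lemma gen_summand: "v \<in> V \<Longrightarrow> gen v \<in> summand v"
  using gen_carrier by (simp add: summand_def) (simp add: gen_def)

lemma summand_expansion:
  assumes x: "x \<in> summand v" and v: "v \<in> V"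
  shows "x = x v \<odot>\<^bsub>M\<^esub> gen v"
proof (rule M_eqI[OF summand_carrier[OF x]])
  have c: "x v \<in> carrier A" using M_mem[OF summand_carrier[OF x] v] .
  then show "x v \<odot>\<^bsub>M\<^esub> gen v \<in> carrier M" using gen_carrier[OF v] by (rule M.smult_closed)
  show "x w = (x v \<odot>\<^bsub>M\<^esub> gen v) w" if "w \<in> V" for w
    using x that v c M_idem[OF summand_carrier[OF x] v] by (auto simp: summand_def M_smult gen_def)
qed

lemma summand_submodule: "v \<in> V \<Longrightarrow> submodule (summand v) A M"
proof (intro submodule.intro subgroup.intro submodule_axioms.intro)
  fix x y assume xy: "x \<in> summand v" "y \<in> summand v"
  then have "x \<oplus>\<^bsub>M\<^esub> y \<in> carrier M" using summand_carrier by auto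
  then show "x \<otimes>\<^bsub>add_monoid M\<^esub> y \<in> summand v"
    using xy by (simp add: summand_def) (simp add: M_add)
next
  fix x assume x: "x \<in> summand v"
  then have xc: "x \<in> carrier M" by (rule summand_carrier)
  have "(\<ominus>\<^bsub>M\<^esub> x) w = \<zero>" if "w \<in> V" "w \<noteq> v" for w
  proof -
    have c: "(\<ominus>\<^bsub>M\<^esub> x) w \<in> carrier A" using M_mem[OF M.a_inv_closed[OF xc] that(1)] .
    have "(\<ominus>\<^bsub>M\<^esub> x \<oplus>\<^bsub>M\<^esub> x) w = \<zero>" using M.l_neg[OF xc] that(1) by (simp add: M_zero)
    then show ?thesis using x that c by (simp add: M_add summand_def)
  qed
  then show "inv\<^bsub>add_monoid M\<^esub> x \<in> summand v"
    using M.a_inv_closed[OF xc] by (simp add: summand_def a_inv_def)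
next
  fix a x assume "a \<in> carrier A" and x: "x \<in> summand v"
  then have "a \<odot>\<^bsub>M\<^esub> x \<in> carrier M" using summand_carrier by (auto intro: M.smult_closed)
  then show "a \<odot>\<^bsub>M\<^esub> x \<in> summand v"
    using x \<open>a \<in> carrier A\<close> by (simp add: summand_def) (simp add: M_smult)
next
  show "\<one>\<^bsub>add_monoid M\<^esub> \<in> summand v" using M.zero_closed by (simp add: summand_def) (simp add: M_zero)
qed (auto simp: summand_def)

lemma summand_graded_submodule:
  assumes v: "v \<in> V"
  shows "graded_submodule A M (summand v)"
proof (rule graded_submoduleI[OF M_graded summand_submodule[OF v]])
  fix x n assume x: "x \<in> summand v"
  have xc: "x \<in> carrier M" using x by (rule summand_carrier)
  have "homog A (gr_comp A) \<zero> n = \<zero>" using GA.homog_homogeneous[OF GA.D_zero] by simp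
  then show "homog M (gm_comp M) x n \<in> summand v"
    using x GM.D_carrier[OF GM.homog_D[OF xc]] by (intro summandI) (simp_all add: M_homog[OF xc] summand_def)
qed

lemma summand_generated:
  assumes v: "v \<in> V"
  shows "generated_in_degree A 0 (gsub M (summand v))"
  unfolding generated_in_degree_def
proof (intro allI impI, elim conjE)
  fix N assume "submodule N A (gsub M (summand v))" and gens: "gm_comp (gsub M (summand v)) 0 \<subseteq> N"
  then interpret N: submodule N A "gsub M (summand v)" by simp
  have "gen v \<in> N" using gens gen_comp[OF v] gen_summand[OF v] by auto
  then have "x v \<odot>\<^bsub>M\<^esub> gen v \<in> N" if "x \<in> summand v" for x
    using N.smult_closed[of "x v" "gen v"] M_mem[OF summand_carrier[OF that] v] by simp
  then show "N = carrier (gsub M (summand v))"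
    using N.subset summand_expansion[OF _ v] by auto
qed

end

text \<open>\<open>e_local\<close> says that every nonzero element of degree 0 generates the left
  ideal of \<open>e v\<close>. For the zigzag algebra it holds since that degree is the line through
  \<open>e v\<close>.\<close>

locale local_idempotent_sum = idempotent_sum +
  assumes e_nonzero: "\<And>v. v \<in> V \<Longrightarrow> e v \<noteq> \<zero>"
    and e_local: "\<And>v a. v \<in> V \<Longrightarrow> a \<in> gr_comp A 0 \<Longrightarrow> a \<otimes> e v = a \<Longrightarrow> a \<noteq> \<zero> \<Longrightarrow> \<exists>b\<in>carrier A. b \<otimes> a = e v"
begin

lemma gen_nonzero: "v \<in> V \<Longrightarrow> gen v \<noteq> \<zero>\<^bsub>M\<^esub>"
  using e_nonzero[of v] by (auto simp: gen_def M_zero fun_eq_iff restrict_def)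

text \<open>If \<open>X\<close> has no nonzero element of degree 0, it vanishes by
  \<open>summand_eq_zero\<close>. Otherwise \<open>e_local\<close> turns such an element into the
  generator, so \<open>X\<close> is everything and contains its complement.\<close>

lemma summand_indecomposable:
  assumes v: "v \<in> V"
  shows "indecomposable A (gsub M (summand v))"
  unfolding indecomposable_def
proof (intro conjI allI impI)
  show "carrier (gsub M (summand v)) \<noteq> {\<zero>\<^bsub>gsub M (summand v)\<^esub>}"
    using gen_summand[OF v] gen_nonzero[OF v] by auto
  fix X X' assume comp: "complementary A (gsub M (summand v)) X X'"
  have gr: "graded_module A (gsub M (summand v))"
    using summand_graded_submodule[OF v] by (simp add: graded_submodule_def)
  have subX: "submodule X A (gsub M (summand v))" and subX': "submodule X' A (gsub M (summand v))"
    and int: "X \<inter> X' = {\<zero>\<^bsub>M\<^esub>}"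
    using comp by (auto simp: complementary_def graded_submodule_def)
  interpret X: submodule X A "gsub M (summand v)" by (rule subX)
  interpret X': submodule X' A "gsub M (summand v)" by (rule subX')
  show "X = {\<zero>\<^bsub>gsub M (summand v)\<^esub>} \<or> X' = {\<zero>\<^bsub>gsub M (summand v)\<^esub>}"
  proof (cases "X \<inter> gm_comp (gsub M (summand v)) 0 = {\<zero>\<^bsub>gsub M (summand v)\<^esub>}")
    case True
    then show ?thesis using summand_eq_zero[OF gr summand_generated[OF v] comp] by blast
  next
    case False
    have "\<zero>\<^bsub>M\<^esub> \<in> X" using X.one_closed by simp
    then have "\<zero>\<^bsub>M\<^esub> \<in> X \<inter> gm_comp (gsub M (summand v)) 0" using X.subset GM.D_zero by auto
    then obtain x where x: "x \<in> X" "x \<in> gm_comp M 0" "x \<in> summand v" "x \<noteq> \<zero>\<^bsub>M\<^esub>"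
      using False by auto
    have exp: "x = x v \<odot>\<^bsub>M\<^esub> gen v" by (rule summand_expansion[OF x(3) v])
    have "x v \<noteq> \<zero>" using exp x(4) M.smult_zero_left[OF gen_carrier[OF v]] by auto
    then obtain b where b: "b \<in> carrier A" "b \<otimes> x v = e v"
      using e_local[OF v, of "x v"] x(2) v by (auto simp: M_comp M_idem)
    have "b \<odot>\<^bsub>M\<^esub> x = gen v"
    proof (rule M_eqI)
      show "b \<odot>\<^bsub>M\<^esub> x \<in> carrier M" using b(1) summand_carrier[OF x(3)] by (rule M.smult_closed)
      show "(b \<odot>\<^bsub>M\<^esub> x) w = gen v w" if "w \<in> V" for w
        using that b x(3) by (auto simp: M_smult gen_def summand_def)
    qed (rule gen_carrier[OF v])
    then have "gen v \<in> X" using X.smult_closed[OF b(1) x(1)] by simp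
    then have "y v \<odot>\<^bsub>M\<^esub> gen v \<in> X" if "y \<in> summand v" for y
      using X.smult_closed[of "y v" "gen v"] M_mem[OF summand_carrier[OF that] v] by simp
    then have "summand v \<subseteq> X" using summand_expansion[OF _ v] by auto
    then have "X' \<subseteq> X" using X'.subset by auto
    then show ?thesis using int X'.one_closed by auto
  qed
qed

lemma summand_iso:
  assumes v: "v \<in> V"
  shows "graded_iso A (gsub M (summand v)) (cyclic_module A (e v))"
  unfolding graded_iso_def
proof (rule bexI[where x = "\<lambda>x. x v"])
  show "bij_betw (\<lambda>x. x v) (carrier (gsub M (summand v))) (carrier (cyclic_module A (e v)))"
  proof (rule bij_betw_imageI)
    show "inj_on (\<lambda>x. x v) (carrier (gsub M (summand v)))"
      using summand_expansion[OF _ v] by (intro inj_onI) (metis carrier_gsub)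
    have "a \<in> (\<lambda>x. x v) ` summand v" if "a \<in> carrier A" "a \<otimes> e v = a" for a
    proof (rule image_eqI[where x = "a \<odot>\<^bsub>M\<^esub> gen v"])
      show "a = (a \<odot>\<^bsub>M\<^esub> gen v) v" using that v by (simp add: M_smult gen_def)
      show "a \<odot>\<^bsub>M\<^esub> gen v \<in> summand v"
        using submodule.smult_closed[OF summand_submodule[OF v] that(1) gen_summand[OF v]] .
    qed
    then show "(\<lambda>x. x v) ` carrier (gsub M (summand v)) = carrier (cyclic_module A (e v))"
      using v M_mem M_idem summand_carrier by (auto simp: cyclic_carrier)
  qed
  have comp: "gm_comp (cyclic_module A (e v)) n = gr_comp A n \<inter> carrier (cyclic_module A (e v))" for n
    by (simp add: cyclic_module_def)
  show "(\<lambda>x. x v) \<in> graded_hom A (gsub M (summand v)) (cyclic_module A (e v))"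
    unfolding graded_hom_def comp
    using v M_mem M_idem summand_carrier
    by (auto simp: cyclic_carrier M_add M_smult M_comp) (simp_all add: cyclic_module_def)
qed

text \<open>The generator is fixed by \<open>e v\<close>, but its image has degree 0 in the other
  module and is killed by \<open>e v\<close>. An isomorphism would thus send the generator to
  0.\<close>

lemma summand_not_iso:
  assumes v: "v \<in> V" and f: "f \<in> carrier A" "f \<otimes> f = f"
    and van: "\<And>a. a \<in> gr_comp A 0 \<Longrightarrow> a \<otimes> f = a \<Longrightarrow> e v \<otimes> a = \<zero>"
  shows "\<not> graded_iso A (gsub M (summand v)) (cyclic_module A f)"
proof
  assume "graded_iso A (gsub M (summand v)) (cyclic_module A f)"
  then obtain h where h: "h \<in> graded_hom A (gsub M (summand v)) (cyclic_module A f)"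
    and inj: "inj_on h (summand v)"
    by (auto simp: graded_iso_def bij_betw_def)
  have deg: "h (gen v) \<in> gm_comp (cyclic_module A f) 0"
    using h gen_comp[OF v] gen_summand[OF v] by (fastforce simp: graded_hom_def)
  then obtain a where a: "a \<in> carrier A" "h (gen v) = a \<otimes> f" "h (gen v) \<in> gr_comp A 0"
    by (auto simp: cyclic_module_def)
  then have "e v \<otimes> h (gen v) = \<zero>" using f by (intro van) (auto simp: A.m_assoc)
  moreover have sm: "h (c \<odot>\<^bsub>M\<^esub> gen v) = c \<otimes> h (gen v)" if "c \<in> carrier A" for c
    using h gen_summand[OF v] that by (auto simp: graded_hom_def cyclic_module_def)
  ultimately have "h (gen v) = \<zero>" using sm[OF e_carrier[OF v]] e_gen[OF v] by simp
  moreover have "h \<zero>\<^bsub>M\<^esub> = \<zero> \<otimes> h (gen v)"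
    using sm[OF A.zero_closed] M.smult_zero_left[OF gen_carrier[OF v]] by simp
  ultimately have "h (gen v) = h \<zero>\<^bsub>M\<^esub>" by simp
  moreover have "\<zero>\<^bsub>M\<^esub> \<in> summand v"
    using subgroup.one_closed[OF submodule.axioms(1)[OF summand_submodule[OF v]]] by simp
  ultimately show False using inj gen_summand[OF v] gen_nonzero[OF v] by (auto dest: inj_onD)
qed

lemma summand_inj: "inj_on summand V"
proof (rule inj_onI, rule ccontr)
  fix v w assume vw: "v \<in> V" "w \<in> V" "summand v = summand w" "v \<noteq> w"
  then have "gen v \<in> summand w" using gen_summand by blast
  then show False using vw e_nonzero by (auto simp: summand_def gen_def)
qed

definition part :: "'b \<Rightarrow> ('b \<Rightarrow> 'a) \<Rightarrow> 'b \<Rightarrow> 'a" where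
  "part v x = (\<lambda>w\<in>V. if w = v then x w else \<zero>)"

lemma part_summand: "x \<in> carrier M \<Longrightarrow> part v x \<in> summand v"
  using e_carrier by (auto simp: summand_def part_def M_carrier)

lemma finsum_summand:
  assumes c: "\<And>v. v \<in> V \<Longrightarrow> c v \<in> summand v" and w: "w \<in> V"
  shows "finsum M c V w = c w w"
proof -
  have cw: "c v w \<in> carrier A" if "v \<in> V" for v using M_mem[OF summand_carrier[OF c[OF that]] w] .
  have "finsum M c V w = finsum A (\<lambda>v. c v w) V"
    using c summand_carrier w by (intro M_finsum) auto
  also have "\<dots> = finsum A (\<lambda>v. if w = v then c v w else \<zero>) V"
    using c w cw by (intro A.finsum_cong') (auto simp: summand_def)
  also have "\<dots> = c w w"
    using A.finsum_singleton[OF w finite_V, of "\<lambda>v. c v w"] cw by auto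
  finally show ?thesis .
qed

text \<open>Different vertices have different summands, so counting submodules counts vertices. A
  summand is isomorphic to the module of \<open>f\<close> if \<open>e v = f\<close>, and
  \<open>van\<close> excludes an isomorphism otherwise.\<close>

lemma has_multiplicity_card:
  assumes f: "f \<in> carrier A" "f \<otimes> f = f"
    and van: "\<And>v a. v \<in> V \<Longrightarrow> e v \<noteq> f \<Longrightarrow> a \<in> gr_comp A 0 \<Longrightarrow> a \<otimes> f = a \<Longrightarrow> e v \<otimes> a = \<zero>"
  shows "has_multiplicity A (cyclic_module A f) M (card {v \<in> V. e v = f})"
  unfolding has_multiplicity_def
proof (intro exI[of _ "summand ` V"] conjI ballI)
  show "finite (summand ` V)" using finite_V by simp
  show "graded_submodule A M N" "indecomposable A (gsub M N)" if "N \<in> summand ` V" for N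
    using that summand_graded_submodule summand_indecomposable by auto
  have iso: "graded_iso A (gsub M (summand v)) (cyclic_module A f) \<longleftrightarrow> e v = f" if v: "v \<in> V" for v
  proof (cases "e v = f")
    case True
    then show ?thesis using summand_iso[OF v] by simp
  next
    case False
    then show ?thesis using summand_not_iso[OF v f van[OF v False]] by simp
  qed
  have "{N \<in> summand ` V. graded_iso A (gsub M N) (cyclic_module A f)} = summand ` {v \<in> V. e v = f}"
    using iso by auto
  then show "card {N \<in> summand ` V. graded_iso A (gsub M N) (cyclic_module A f)} = card {v \<in> V. e v = f}"
    using card_image[OF inj_on_subset[OF summand_inj, of "{v \<in> V. e v = f}"]] by simp
next
  fix x assume x: "x \<in> carrier M"
  \<comment> \<open>The decomposition is indexed by submodules instead of vertices; the inverse of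
    \<open>summand\<close> recovers the vertex.\<close>
  define c where "c = (\<lambda>N\<in>summand ` V. part (the_inv_into V summand N) x)"
  have cv: "c (summand v) = part v x" if "v \<in> V" for v
    using that by (simp add: c_def the_inv_into_f_f[OF summand_inj])
  have re: "finsum M d (summand ` V) = finsum M (\<lambda>v. d (summand v)) V"
    if "d \<in> (\<Pi>\<^sub>E N\<in>summand ` V. N)" for d
    using that summand_carrier by (intro M.finsum_reindex[OF _ summand_inj]) (fastforce simp: PiE_def Pi_def)
  have cm: "c \<in> (\<Pi>\<^sub>E N\<in>summand ` V. N)"
    using cv part_summand[OF x] by (auto simp: PiE_def Pi_def) (simp add: c_def)
  have "x = finsum M c (summand ` V)"
    unfolding re[OF cm]
  proof (rule M_eqI[OF x])
    show "finsum M (\<lambda>v. c (summand v)) V \<in> carrier M"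
      using cv summand_carrier[OF part_summand[OF x]] by (intro M.finsum_closed) auto
    show "x w = finsum M (\<lambda>v. c (summand v)) V w" if w: "w \<in> V" for w
      using cv part_summand[OF x] w by (subst finsum_summand) (auto simp: part_def)
  qed
  then show "\<exists>!c. c \<in> (\<Pi>\<^sub>E N\<in>summand ` V. N) \<and> x = finsum M c (summand ` V)"
  proof (intro ex1I[of _ c] conjI cm)
    fix d assume "d \<in> (\<Pi>\<^sub>E N\<in>summand ` V. N) \<and> x = finsum M d (summand ` V)"
    then have d: "d \<in> (\<Pi>\<^sub>E N\<in>summand ` V. N)" and xd: "x = finsum M (\<lambda>v. d (summand v)) V"
      using re by auto
    have dv: "d (summand v) \<in> summand v" if "v \<in> V" for v using d that by (auto simp: PiE_def Pi_def)
    have "d (summand v) = c (summand v)" if v: "v \<in> V" for v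
      unfolding cv[OF v]
    proof (rule M_eqI)
      show "d (summand v) \<in> carrier M" using dv[OF v] by (rule summand_carrier)
      show "part v x \<in> carrier M" using part_summand[OF x] by (rule summand_carrier)
      show "d (summand v) w = part v x w" if w: "w \<in> V" for w
        using dv[OF v] w finsum_summand[of "\<lambda>v. d (summand v)" w] dv xd
        by (auto simp: part_def summand_def)
    qed
    then show "d = c"
      using d cm by (intro PiE_ext[of d _ "\<lambda>N. N"]) auto
  qed
qed

end

section \<open>The path algebra\<close>

lemma set_vwalk_arcs: "set (vwalk_arcs p) = {(p ! n, p ! Suc n) | n. Suc n < length p}"
proof (induction p rule: vwalk_arcs.induct)
  case (3 x y xs)
  have "{((x # y # xs) ! n, (x # y # xs) ! Suc n) | n. Suc n < length (x # y # xs)} =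
    insert (x, y) {((y # xs) ! n, (y # xs) ! Suc n) | n. Suc n < length (y # xs)}" (is "?L = ?R")
  proof (intro equalityI subsetI)
    fix a assume "a \<in> ?L"
    then obtain n where "a = ((x # y # xs) ! n, (x # y # xs) ! Suc n)" "Suc n < length (x # y # xs)" by blast
    then show "a \<in> ?R" by (cases n) auto
  next
    fix a assume "a \<in> ?R"
    then consider "a = (x, y)" | n where "a = ((y # xs) ! n, (y # xs) ! Suc n)" "Suc n < length (y # xs)" by blast
    then show "a \<in> ?L"
    proof cases
      case 1
      then show ?thesis by (intro CollectI exI[of _ 0]) simp
    next
      case (2 n)
      then show ?thesis by (intro CollectI exI[of _ "Suc n"]) simp
    qed
  qed
  then show ?case using 3 by simp
qed auto

text \<open>The form by positions suits the product, which cuts a path at a position.\<close>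

lemma vwalk_nth:
  "vwalk p (with_proj Q) \<longleftrightarrow> p \<noteq> [] \<and> (\<forall>n<length p. p ! n \<in> pverts Q) \<and>
    (\<forall>n. Suc n < length p \<longrightarrow> (p ! n, p ! Suc n) \<in> parcs Q)"
  by (auto simp: vwalk_def set_vwalk_arcs in_set_conv_nth subset_iff)

context
  fixes Q :: "'v pair_pre_digraph"
begin

abbreviation (input) KQ :: "('v list \<Rightarrow> 'k::field) ring" where "KQ \<equiv> path_algebra Q"

lemma path_carrier: "f \<in> carrier KQ \<longleftrightarrow> finite {p. f p \<noteq> 0} \<and> (\<forall>p. f p \<noteq> 0 \<longrightarrow> vwalk p (with_proj Q))"
  and path_mult: "f \<otimes>\<^bsub>KQ\<^esub> g = (\<lambda>p. \<Sum>k<length p. f (take (Suc k) p) * g (drop k p))"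
  and path_one: "\<one>\<^bsub>KQ\<^esub> = (\<lambda>p. if \<exists>v\<in>pverts Q. p = [v] then 1 else 0)"
  and path_zero: "\<zero>\<^bsub>KQ\<^esub> = (\<lambda>p. 0)"
  and path_add: "f \<oplus>\<^bsub>KQ\<^esub> g = (\<lambda>p. f p + g p)"
  by (simp_all add: path_algebra_def)

lemma path_carrier_walk: "f \<in> carrier KQ \<Longrightarrow> f p \<noteq> 0 \<Longrightarrow> vwalk p (with_proj Q)"
  by (simp add: path_carrier)

lemma path_carrier_Nil: "f \<in> carrier KQ \<Longrightarrow> f [] = 0"
  using path_carrier_walk[of f "[]"] by (auto simp: vwalk_def)

lemma path_mult_closed:
  fixes f g :: "'v list \<Rightarrow> 'k::field"
  assumes f: "f \<in> carrier KQ" and g: "g \<in> carrier KQ"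
  shows "f \<otimes>\<^bsub>KQ\<^esub> g \<in> carrier KQ"
proof -
  have cut: "\<exists>k<length p. f (take (Suc k) p) \<noteq> 0 \<and> g (drop k p) \<noteq> 0" if "(f \<otimes>\<^bsub>KQ\<^esub> g) p \<noteq> 0" for p
  proof (rule ccontr)
    assume "\<not> ?thesis"
    then have "(f \<otimes>\<^bsub>KQ\<^esub> g) p = 0" unfolding path_mult by (intro sum.neutral) auto
    then show False using that by simp
  qed
  \<comment> \<open>A path is recovered from its two pieces as \<open>q @ tl r\<close>, since they
    share the vertex at the cut; there are finitely many pairs of pieces.\<close>
  have "{p. (f \<otimes>\<^bsub>KQ\<^esub> g) p \<noteq> 0} \<subseteq> (\<lambda>(q, r). q @ tl r) ` ({p. f p \<noteq> 0} \<times> {p. g p \<noteq> 0})"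
  proof
    fix p assume "p \<in> {p. (f \<otimes>\<^bsub>KQ\<^esub> g) p \<noteq> 0}"
    then obtain k where k: "f (take (Suc k) p) \<noteq> 0" "g (drop k p) \<noteq> 0" using cut[of p] by blast
    have "p = take (Suc k) p @ tl (drop k p)" by (simp add: tl_drop flip: drop_Suc)
    then show "p \<in> (\<lambda>(q, r). q @ tl r) ` ({p. f p \<noteq> 0} \<times> {p. g p \<noteq> 0})"
      using k by (intro image_eqI[of _ _ "(take (Suc k) p, drop k p)"]) simp_all
  qed
  then have fin: "finite {p. (f \<otimes>\<^bsub>KQ\<^esub> g) p \<noteq> 0}"
    by (rule finite_subset) (use f g in \<open>simp add: path_carrier\<close>)
  have "vwalk p (with_proj Q)" if nz: "(f \<otimes>\<^bsub>KQ\<^esub> g) p \<noteq> 0" for p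
  proof -
    obtain k where k: "k < length p" "f (take (Suc k) p) \<noteq> 0" "g (drop k p) \<noteq> 0" using cut[OF nz] by blast
    have w1: "vwalk (take (Suc k) p) (with_proj Q)" and w2: "vwalk (drop k p) (with_proj Q)"
      using path_carrier_walk f g k by blast+
    have v2: "drop k p ! m \<in> pverts Q" if "m < length p - k" for m
      using w2 that unfolding vwalk_nth length_drop by blast
    have a2: "(drop k p ! m, drop k p ! Suc m) \<in> parcs Q" if "Suc m < length p - k" for m
      using w2 that unfolding vwalk_nth length_drop by blast
    have "p ! n \<in> pverts Q" if "n < length p" for n
    proof (cases "n \<le> k")
      case True
      then have "take (Suc k) p ! n \<in> pverts Q" using w1 that unfolding vwalk_nth by simp
      then show ?thesis using True by simp
    next
      case False
      then have "drop k p ! (n - k) \<in> pverts Q" using that by (intro v2) simp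
      then show ?thesis using False k(1) by simp
    qed
    moreover have "(p ! n, p ! Suc n) \<in> parcs Q" if "Suc n < length p" for n
    proof (cases "Suc n \<le> k")
      case True
      then have "(take (Suc k) p ! n, take (Suc k) p ! Suc n) \<in> parcs Q" using w1 that unfolding vwalk_nth by simp
      then show ?thesis using True by simp
    next
      case False
      then have "(drop k p ! (n - k), drop k p ! Suc (n - k)) \<in> parcs Q"
        using that by (intro a2) simp
      then show ?thesis using False k(1) by simp
    qed
    ultimately show ?thesis using k(1) by (auto simp: vwalk_nth)
  qed
  then show ?thesis using fin by (simp add: path_carrier)
qed

text \<open>Both sides sum over two cuts \<open>j \<le> k\<close>. They differ in whether the second
  cut is counted from the start of the path or from the first cut, hence the shift by
  \<open>j\<close> in the reindexing.\<close>

lemma path_mult_assoc: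
  fixes f g h :: "'v list \<Rightarrow> 'k::field"
  shows "f \<otimes>\<^bsub>KQ\<^esub> g \<otimes>\<^bsub>KQ\<^esub> h = f \<otimes>\<^bsub>KQ\<^esub> (g \<otimes>\<^bsub>KQ\<^esub> h)"
proof
  fix p :: "'v list"
  let ?t = "\<lambda>j k. f (take (Suc j) p) * g (take (Suc (k - j)) (drop j p)) * h (drop k p)"
  have "(f \<otimes>\<^bsub>KQ\<^esub> g \<otimes>\<^bsub>KQ\<^esub> h) p = (\<Sum>k<length p. \<Sum>j<Suc k. ?t j k)"
    unfolding path_mult sum_distrib_right
    by (intro sum.cong refl) (auto simp: min_def take_drop Suc_diff_le intro!: sum.cong)
  also have "\<dots> = (\<Sum>(k, j)\<in>(SIGMA k:{..<length p}. {..<Suc k}). ?t j k)"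
    by (subst sum.Sigma) auto
  also have "\<dots> = (\<Sum>(j, i)\<in>(SIGMA j:{..<length p}. {..<length p - j}). ?t j (i + j))"
    by (rule sum.reindex_bij_witness[of _ "\<lambda>(j, i). (i + j, j)" "\<lambda>(k, j). (j, k - j)"]) auto
  also have "\<dots> = (\<Sum>j<length p. \<Sum>i<length p - j. ?t j (i + j))"
    by (subst sum.Sigma) auto
  also have "\<dots> = (f \<otimes>\<^bsub>KQ\<^esub> (g \<otimes>\<^bsub>KQ\<^esub> h)) p"
    unfolding path_mult sum_distrib_left
    by (intro sum.cong refl) (auto simp: mult.assoc Suc_diff_le intro!: sum.cong)
  finally show "(f \<otimes>\<^bsub>KQ\<^esub> g \<otimes>\<^bsub>KQ\<^esub> h) p = (f \<otimes>\<^bsub>KQ\<^esub> (g \<otimes>\<^bsub>KQ\<^esub> h)) p" .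
qed

text \<open>With \<open>c = 1\<close> this is the unit law; for general \<open>c\<close> it shows
  that ideals are closed under scalars.\<close>

lemma path_scalar_left:
  fixes f :: "'v list \<Rightarrow> 'k::field"
  assumes f: "f \<in> carrier KQ"
  shows "(\<lambda>p. if \<exists>v\<in>pverts Q. p = [v] then c else 0) \<otimes>\<^bsub>KQ\<^esub> f = (\<lambda>p. c * f p)"
proof
  fix p :: "'v list"
  let ?o = "\<lambda>p. if \<exists>v\<in>pverts Q. p = [v] then c else 0"
  show "(?o \<otimes>\<^bsub>KQ\<^esub> f) p = c * f p"
  proof (cases p)
    case Nil
    then show ?thesis by (simp add: path_mult path_carrier_Nil[OF f])
  next
    case (Cons v q)
    have "(?o \<otimes>\<^bsub>KQ\<^esub> f) p = (\<Sum>k<length p. if k = 0 then ?o [v] * f p else 0)"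
      unfolding path_mult
    proof (intro sum.cong refl)
      fix k assume k: "k \<in> {..<length p}"
      have "length (take (Suc k) p) = Suc k" using k by simp
      then have "k = 0" if "take (Suc k) p = [w]" for w using that by simp
      then show "?o (take (Suc k) p) * f (drop k p) = (if k = 0 then ?o [v] * f p else 0)"
        using Cons by auto
    qed
    also have "\<dots> = ?o [v] * f p" using Cons by (simp add: sum.delta')
    also have "\<dots> = c * f p"
    proof (cases "f p = 0")
      case False
      then have "v \<in> pverts Q" using path_carrier_walk[OF f, of p] Cons by (auto simp: vwalk_def)
      then show ?thesis by simp
    qed simp
    finally show ?thesis .
  qed
qed

lemma path_one_right:
  fixes f :: "'v list \<Rightarrow> 'k::field"
  assumes f: "f \<in> carrier KQ"
  shows "f \<otimes>\<^bsub>KQ\<^esub> \<one>\<^bsub>KQ\<^esub> = f"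
proof
  fix p :: "'v list"
  let ?o = "\<one>\<^bsub>KQ\<^esub> :: 'v list \<Rightarrow> 'k"
  show "(f \<otimes>\<^bsub>KQ\<^esub> ?o) p = f p"
  proof (cases p rule: rev_cases)
    case Nil
    then show ?thesis by (simp add: path_mult path_carrier_Nil[OF f])
  next
    case (snoc q v)
    have "(f \<otimes>\<^bsub>KQ\<^esub> ?o) p = (\<Sum>k<length p. if k = length q then f p * ?o [v] else 0)"
      unfolding path_mult
    proof (intro sum.cong refl)
      fix k assume k: "k \<in> {..<length p}"
      have len: "length (drop k p) = Suc (length q) - k" using snoc by simp
      have "k = length q" if "drop k p = [w]" for w
      proof -
        have "Suc (length q) - k = 1" using len that by simp
        then show ?thesis by simp
      qed
      then show "f (take (Suc k) p) * ?o (drop k p) = (if k = length q then f p * ?o [v] else 0)"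
        using snoc by (auto simp: path_one)
    qed
    also have "\<dots> = f p * ?o [v]" using snoc by (simp add: sum.delta')
    also have "\<dots> = f p"
    proof (cases "f p = 0")
      case False
      then have "v \<in> pverts Q" using path_carrier_walk[OF f, of p] snoc by (auto simp: vwalk_def)
      then show ?thesis by (simp add: path_one)
    qed simp
    finally show ?thesis .
  qed
qed

lemma path_scale_closed: "f \<in> carrier KQ \<Longrightarrow> (\<lambda>p. c * f p :: 'k::field) \<in> carrier KQ"
  by (auto simp: path_carrier elim!: rev_finite_subset)

lemma path_add_closed:
  "f \<in> carrier KQ \<Longrightarrow> g \<in> carrier KQ \<Longrightarrow> (\<lambda>p. f p + g p :: 'k::field) \<in> carrier KQ"
proof -
  assume f: "f \<in> carrier KQ" and g: "g \<in> carrier KQ"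
  have "{p. f p + g p \<noteq> 0} \<subseteq> {p. f p \<noteq> 0} \<union> {p. g p \<noteq> 0}" by auto
  then have "finite {p. f p + g p \<noteq> 0}" by (rule finite_subset) (use f g in \<open>simp add: path_carrier\<close>)
  moreover have "vwalk p (with_proj Q)" if "f p + g p \<noteq> 0" for p
    using that path_carrier_walk[OF f, of p] path_carrier_walk[OF g, of p] by (cases "f p = 0") auto
  ultimately show ?thesis by (simp add: path_carrier)
qed

lemma path_algebra_ring:
  assumes "finite (pverts Q)"
  shows "ring (path_algebra Q :: ('v list \<Rightarrow> 'k::field) ring)"
proof (rule ringI)
  show "abelian_group (path_algebra Q :: ('v list \<Rightarrow> 'k) ring)"
  proof (rule abelian_groupI)
    fix f :: "'v list \<Rightarrow> 'k" assume f: "f \<in> carrier KQ"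
    have "(\<lambda>p. - 1 * f p) \<oplus>\<^bsub>KQ\<^esub> f = \<zero>\<^bsub>KQ\<^esub>" by (simp add: path_add path_zero)
    then show "\<exists>g\<in>carrier KQ. g \<oplus>\<^bsub>KQ\<^esub> f = \<zero>\<^bsub>KQ\<^esub>" using path_scale_closed[OF f] by blast
  next
    show "\<zero>\<^bsub>KQ\<^esub> \<in> carrier (path_algebra Q :: ('v list \<Rightarrow> 'k) ring)" by (simp add: path_carrier path_zero)
  qed (auto simp: path_add path_zero path_add_closed add_ac)
  have one: "\<one>\<^bsub>KQ\<^esub> \<in> carrier (path_algebra Q :: ('v list \<Rightarrow> 'k) ring)"
  proof -
    have "{p. \<exists>v\<in>pverts Q. p = [v]} = (\<lambda>v. [v]) ` pverts Q" by auto
    then show ?thesis using assms by (auto simp: path_carrier path_one vwalk_def)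
  qed
  show "Group.monoid (path_algebra Q :: ('v list \<Rightarrow> 'k) ring)"
  proof (rule monoidI)
    fix f :: "'v list \<Rightarrow> 'k" assume f: "f \<in> carrier KQ"
    show "\<one>\<^bsub>KQ\<^esub> \<otimes>\<^bsub>KQ\<^esub> f = f" using path_scalar_left[OF f, of 1] by (simp add: path_one)
    show "f \<otimes>\<^bsub>KQ\<^esub> \<one>\<^bsub>KQ\<^esub> = f" by (rule path_one_right[OF f])
  qed (auto simp: path_mult_closed path_mult_assoc one)
qed (auto simp: path_mult path_add algebra_simps sum.distrib)

text \<open>The two paths share a vertex, hence \<open>tl q\<close>. The joined path has exactly one
  cut into \<open>p\<close> and \<open>q\<close>, at position \<open>length p - 1\<close>.\<close>

lemma scaled_path_mult:
  fixes a b :: "'k::field"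
  assumes "p \<noteq> []" and "q \<noteq> []" and "last p = hd q"
  shows "scaled_path a p \<otimes>\<^bsub>KQ\<^esub> scaled_path b q = scaled_path (a * b) (p @ tl q)"
proof
  fix r :: "'v list"
  have iff: "take (Suc k) r = p \<and> drop k r = q \<longleftrightarrow> r = p @ tl q \<and> k = length p - 1" if k: "k < length r" for k
  proof
    assume *: "take (Suc k) r = p \<and> drop k r = q"
    have "r = take (Suc k) r @ tl (drop k r)" by (simp add: tl_drop flip: drop_Suc)
    then have "r = p @ tl q" using * by simp
    moreover have "length p = Suc k" using * k by (metis Suc_leI length_take min_absorb2)
    ultimately show "r = p @ tl q \<and> k = length p - 1" by simp
  next
    assume *: "r = p @ tl q \<and> k = length p - 1"
    have "p = butlast p @ [hd q]" using assms by (metis append_butlast_last_id)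
    then have r: "r = butlast p @ q" using * assms(2) by (metis append.assoc append_Cons append_Nil list.collapse)
    have "drop k r = q" unfolding r using * by simp
    moreover have "take (Suc k) r = p" using * assms(1) by simp
    ultimately show "take (Suc k) r = p \<and> drop k r = q" by blast
  qed
  have "(scaled_path a p \<otimes>\<^bsub>KQ\<^esub> scaled_path b q) r =
    (\<Sum>k<length r. if k = length p - 1 then (if r = p @ tl q then a * b else 0) else 0)"
    unfolding path_mult
  proof (intro sum.cong refl)
    fix k assume "k \<in> {..<length r}"
    then have k: "k < length r" by simp
    have "scaled_path a p (take (Suc k) r) * scaled_path b q (drop k r) =
      (if take (Suc k) r = p \<and> drop k r = q then a * b else 0)"
      by (simp add: scaled_path_def)
    then show "scaled_path a p (take (Suc k) r) * scaled_path b q (drop k r) =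
      (if k = length p - 1 then (if r = p @ tl q then a * b else 0) else 0)"
      unfolding iff[OF k] by simp
  qed
  also have "\<dots> = scaled_path (a * b) (p @ tl q) r"
    using assms(1) by (cases p) (auto simp: scaled_path_def)
  finally show "(scaled_path a p \<otimes>\<^bsub>KQ\<^esub> scaled_path b q) r = scaled_path (a * b) (p @ tl q) r" .
qed

lemma scaled_path_carrier: "vwalk p (with_proj Q) \<Longrightarrow> scaled_path (c :: 'k::field) p \<in> carrier KQ"
  by (auto simp: path_carrier scaled_path_def split: if_splits)

end

text \<open>Connectedness is defined through the symmetric closure, which adds no arcs to a
  symmetric graph.\<close>

lemma connected_closed_UNIV:
  assumes "pair_graph G" and "pverts G = UNIV" and "Digraph_Component.connected (with_proj G)"
    and closed: "\<And>u v. u \<in> S \<Longrightarrow> (u, v) \<in> parcs G \<Longrightarrow> v \<in> S" and "u \<in> S"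
  shows "S = UNIV"
proof -
  interpret pair_graph G by fact
  have arcs: "parcs (mk_symmetric (with_proj G)) \<subseteq> parcs G"
    using arcs_symmetric by (auto simp: mk_symmetric_def)
  have "w \<in> S" for w
  proof -
    have "u \<rightarrow>\<^sup>*\<^bsub>with_proj (mk_symmetric (with_proj G))\<^esub> w"
      using assms(2,3) by (auto simp: connected_def strongly_connected_def mk_symmetric_def)
    then have "(u, w) \<in> (arcs_ends (with_proj (mk_symmetric (with_proj G))))\<^sup>*"
      unfolding reachable_def by (rule subsetD[OF rtrancl_on_sub_rtrancl])
    then have "(u, w) \<in> (parcs (mk_symmetric (with_proj G)))\<^sup>*" by simp
    then show ?thesis
      by (induction rule: rtrancl_induct) (use assms(5) closed arcs in auto)
  qed
  then show ?thesis by blast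
qed

section \<open>The zigzag algebra in coordinates\<close>

text \<open>The ground field occurs only in types, hence the parameter \<open>K\<close>. Three
  vertices select the quadratic presentation; \<open>terminates_if_small\<close> disposes of smaller
  graphs.\<close>

locale zigzag =
  fixes G :: "'v::finite pair_pre_digraph" and K :: "'k::field itself"
  assumes pair_graph: "pair_graph G" and pverts_UNIV: "pverts G = UNIV"
    and connected: "Digraph_Component.connected (with_proj G)"
    and three_vertices: "card (UNIV :: 'v set) \<ge> 3"
begin

abbreviation PA :: "('v list \<Rightarrow> 'k) ring" where "PA \<equiv> path_algebra G"
abbreviation A :: "('v list \<Rightarrow> 'k) set gring" where "A \<equiv> zigzag_algebra G"
abbreviation I :: "('v list \<Rightarrow> 'k) set" where "I \<equiv> zigzag_ideal G"
abbreviation cl :: "('v list \<Rightarrow> 'k) \<Rightarrow> ('v list \<Rightarrow> 'k) set" where "cl \<equiv> zigzag_class G"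

lemma quiver: "zigzag_quiver G = G"
  and degree: "arrow_degree G = 1"
  using three_vertices by (simp_all add: zigzag_quiver_def arrow_degree_def pverts_UNIV)

sublocale PA: ring PA
  by (rule path_algebra_ring) (simp add: pverts_UNIV)

lemma arcs_sym: "(u, v) \<in> parcs G \<longleftrightarrow> (v, u) \<in> parcs G"
proof -
  interpret pair_graph G by (rule pair_graph)
  show ?thesis using arcs_symmetric by blast
qed

definition nb :: "'v \<Rightarrow> 'v" where
  "nb v = (SOME u. (v, u) \<in> parcs G)"

lemma arc_nb: "(v, nb v) \<in> parcs G"
proof -
  have "\<exists>u. (v, u) \<in> parcs G"
  proof (rule ccontr)
    assume no: "\<not> ?thesis"
    have "{v} = UNIV"
      by (rule connected_closed_UNIV[OF pair_graph pverts_UNIV connected, of _ v]) (use no in auto)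
    then have "card (UNIV :: 'v set) = card {v}" by simp
    then show False using three_vertices by simp
  qed
  then show ?thesis unfolding nb_def by (rule someI_ex)
qed

text \<open>Otherwise \<open>{u, v}\<close> would be closed under adjacency and hence contain all
  vertices. This is what makes the path \<open>u, v, u, v\<close> vanish in the algebra.\<close>

lemma another_neighbour:
  assumes "(u, v) \<in> parcs G"
  shows "(\<exists>w. w \<noteq> v \<and> (u, w) \<in> parcs G) \<or> (\<exists>w. w \<noteq> u \<and> (v, w) \<in> parcs G)"
proof (rule ccontr)
  assume no: "\<not> ?thesis"
  have "{u, v} = UNIV"
    by (rule connected_closed_UNIV[OF pair_graph pverts_UNIV connected, of _ u]) (use no in auto)
  then have "card (UNIV :: 'v set) = card {u, v}" by simp
  also have "\<dots> \<le> 2" by (simp add: card_insert_if)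
  finally show False using three_vertices by simp
qed

lemma walk_simps:
  "vwalk [u] (with_proj G)"
  "vwalk [u, v] (with_proj G) \<longleftrightarrow> (u, v) \<in> parcs G"
  "vwalk (u # v # p) (with_proj G) \<longleftrightarrow> (u, v) \<in> parcs G \<and> vwalk (v # p) (with_proj G)"
  "u \<in> pverts G"
  by (auto simp: vwalk_def pverts_UNIV)

lemma mult_1: "(f \<otimes>\<^bsub>PA\<^esub> g) [v] = f [v] * g [v]"
  and mult_2: "(f \<otimes>\<^bsub>PA\<^esub> g) [u, v] = f [u] * g [u, v] + f [u, v] * g [v]"
  and mult_3: "(f \<otimes>\<^bsub>PA\<^esub> g) [u, v, w] = f [u] * g [u, v, w] + f [u, v] * g [v, w] + f [u, v, w] * g [w]"
  by (simp_all add: path_mult lessThan_Suc add_ac)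

lemma nonarc_zero: "f \<in> carrier PA \<Longrightarrow> (u, v) \<notin> parcs G \<Longrightarrow> f [u, v] = 0"
  using path_carrier_walk[of f G "[u, v]"] by (auto simp: walk_simps)

subsection \<open>The ideal of relations\<close>

text \<open>Closed form of the relation ideal (see \<open>I_eq_J\<close>), from which the
  coordinates of a class can be read off.\<close>

definition J :: "('v list \<Rightarrow> 'k) set" where
  "J = {f \<in> carrier PA. (\<forall>v. f [v] = 0) \<and> (\<forall>u v. f [u, v] = 0) \<and> (\<forall>v. (\<Sum>u\<in>UNIV. f [v, u, v]) = 0)}"

lemma PA_minus: "f \<in> carrier PA \<Longrightarrow> \<ominus>\<^bsub>PA\<^esub> f = (\<lambda>p. - f p)"
  using path_scale_closed[of f G "- 1"] by (intro PA.minus_equality) (simp_all add: path_add path_zero)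

text \<open>As the entries of \<open>f\<close> in lengths 0 and 1 vanish, multiplication on either
  side scales all loops at \<open>v\<close> by the same number, the entry of the other factor at
  \<open>[v]\<close>; so the loop sums stay 0.\<close>

lemma J_ideal: "ideal J PA"
proof (rule idealI[OF PA.ring_axioms])
  show "subgroup J (add_monoid PA)"
  proof (rule subgroup.intro)
    fix f g assume "f \<in> J" "g \<in> J"
    then show "f \<otimes>\<^bsub>add_monoid PA\<^esub> g \<in> J"
      by (simp add: J_def path_add path_add_closed sum.distrib)
  next
    fix f assume f: "f \<in> J"
    then have "\<ominus>\<^bsub>PA\<^esub> f \<in> J"
      using PA.a_inv_closed[of f] by (simp add: J_def PA_minus sum_negf)
    then show "inv\<^bsub>add_monoid PA\<^esub> f \<in> J" by (simp add: a_inv_def)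
  qed (auto simp: J_def path_zero path_carrier)
next
  fix f x assume "f \<in> J" "x \<in> carrier PA"
  then show "x \<otimes>\<^bsub>PA\<^esub> f \<in> J" "f \<otimes>\<^bsub>PA\<^esub> x \<in> J"
    by (simp_all add: J_def path_mult_closed mult_1 mult_2 mult_3 sum.distrib
        sum_distrib_left[symmetric] sum_distrib_right[symmetric])
qed

abbreviation rels :: "('v list \<Rightarrow> 'k) set" where "rels \<equiv> zigzag_relations G"

lemma rels_cases:
  "rels = {scaled_path 1 [i, j, k] | i j k. (i, j) \<in> parcs G \<and> (j, k) \<in> parcs G \<and> i \<noteq> k} \<union>
    {(\<lambda>p. scaled_path 1 [i, j, i] p - scaled_path 1 [i, k, i] p) | i j k. (i, j) \<in> parcs G \<and> (i, k) \<in> parcs G}"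
  using three_vertices by (simp add: zigzag_relations_def pverts_UNIV)

lemma rel_difference_carrier:
  assumes "(i, j) \<in> parcs G" and "(i, k) \<in> parcs G"
  shows "(\<lambda>p. scaled_path 1 [i, j, i] p - scaled_path 1 [i, k, i] p) \<in> carrier PA"
proof -
  have "scaled_path (1 :: 'k) [i, j, i] \<in> carrier PA" "scaled_path (- 1 :: 'k) [i, k, i] \<in> carrier PA"
    using assms arcs_sym by (auto intro!: scaled_path_carrier simp: walk_simps)
  then have "(\<lambda>p. scaled_path 1 [i, j, i] p + scaled_path (- 1 :: 'k) [i, k, i] p) \<in> carrier PA"
    by (rule path_add_closed)
  moreover have "scaled_path (- 1 :: 'k) [i, k, i] p = - scaled_path 1 [i, k, i] p" for p
    by (simp add: scaled_path_def)
  ultimately show ?thesis by simp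
qed

lemma rels_J: "rels \<subseteq> J"
proof
  fix f assume "f \<in> rels"
  then consider i j k where "f = scaled_path 1 [i, j, k]" "(i, j) \<in> parcs G" "(j, k) \<in> parcs G" "i \<noteq> k"
    | i j k where "f = (\<lambda>p. scaled_path 1 [i, j, i] p - scaled_path 1 [i, k, i] p)" "(i, j) \<in> parcs G" "(i, k) \<in> parcs G"
    unfolding rels_cases by blast
  then show "f \<in> J"
  proof cases
    case 1
    then have "f \<in> carrier PA" by (auto intro!: scaled_path_carrier simp: walk_simps)
    then show ?thesis using 1 by (auto simp: J_def scaled_path_def intro!: sum.neutral)
  next
    case 2
    have "(\<Sum>u\<in>UNIV. f [v, u, v]) = 0" for v
    proof (cases "v = i")
      case True
      then show ?thesis by (simp add: 2 scaled_path_def sum_subtractf)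
    next
      case False
      then show ?thesis by (simp add: 2 scaled_path_def)
    qed
    then show ?thesis using rel_difference_carrier[OF 2(2,3)] by (simp add: J_def 2) (simp add: scaled_path_def)
  qed
qed

lemma rels_carrier: "rels \<subseteq> carrier PA"
  using rels_J by (auto simp: J_def)

lemma I_def: "I = Idl\<^bsub>PA\<^esub> rels"
  by (simp add: zigzag_ideal_def quiver)

sublocale I: ideal I PA
  unfolding I_def by (rule PA.genideal_ideal[OF rels_carrier])

lemma rels_I: "f \<in> rels \<Longrightarrow> f \<in> I"
  unfolding I_def using PA.genideal_self[OF rels_carrier] by blast

lemma I_carrier: "f \<in> I \<Longrightarrow> f \<in> carrier PA"
  by (rule I.a_Hcarr)

lemma I_scale: "f \<in> I \<Longrightarrow> (\<lambda>p. c * f p) \<in> I"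
proof -
  assume f: "f \<in> I"
  have "(\<lambda>p. c * (\<one>\<^bsub>PA\<^esub> p)) \<in> carrier PA" by (intro path_scale_closed PA.one_closed)
  moreover have "(\<lambda>p. c * (\<one>\<^bsub>PA\<^esub> p)) = (\<lambda>p. if \<exists>v\<in>pverts G. p = [v] then c else 0)"
    by (auto simp: path_one)
  ultimately have "(\<lambda>p. if \<exists>v\<in>pverts G. p = [v] then c else 0) \<otimes>\<^bsub>PA\<^esub> f \<in> I"
    by (intro I.I_l_closed[OF f]) simp
  then show ?thesis unfolding path_scalar_left[OF I_carrier[OF f]] .
qed

lemma I_add: "f \<in> I \<Longrightarrow> g \<in> I \<Longrightarrow> (\<lambda>p. f p + g p) \<in> I"
  using I.a_closed[of f g] by (simp add: path_add)

lemma I_sum: "finite S \<Longrightarrow> (\<And>s. s \<in> S \<Longrightarrow> f s \<in> I) \<Longrightarrow> (\<lambda>p. \<Sum>s\<in>S. f s p) \<in> I"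
proof (induction S rule: finite_induct)
  case empty
  then show ?case using I.zero_closed by (simp add: path_zero)
next
  case (insert s S)
  then have "(\<lambda>p. f s p + (\<Sum>s\<in>S. f s p)) \<in> I" by (intro I_add) auto
  then show ?case using insert by simp
qed

lemma bent_path_I: "(a, b) \<in> parcs G \<Longrightarrow> (b, c) \<in> parcs G \<Longrightarrow> a \<noteq> c \<Longrightarrow> scaled_path 1 [a, b, c] \<in> I"
  by (rule rels_I) (auto simp: rels_cases)

lemma loop_difference_I:
  "(a, b) \<in> parcs G \<Longrightarrow> (a, c) \<in> parcs G \<Longrightarrow> (\<lambda>p. scaled_path 1 [a, b, a] p - scaled_path 1 [a, c, a] p) \<in> I"
  by (rule rels_I) (auto simp: rels_cases)

lemma path_mult_diff_left: "(\<lambda>p. f p - g p) \<otimes>\<^bsub>PA\<^esub> h = (\<lambda>p. (f \<otimes>\<^bsub>PA\<^esub> h) p - (g \<otimes>\<^bsub>PA\<^esub> h) p)"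
  and path_mult_diff_right: "h \<otimes>\<^bsub>PA\<^esub> (\<lambda>p. f p - g p) = (\<lambda>p. (h \<otimes>\<^bsub>PA\<^esub> f) p - (h \<otimes>\<^bsub>PA\<^esub> g) p)"
  by (simp_all add: path_mult algebra_simps sum_subtractf)

text \<open>If \<open>a \<noteq> c\<close> or \<open>b \<noteq> d\<close>, the path contains a bent
  piece. The path \<open>a, b, a, b\<close> is rerouted: replacing the loop at \<open>a\<close> by
  one through another neighbour \<open>w\<close> produces the bent piece \<open>w, a, b\<close>;
  replacing the loop at \<open>b\<close> produces \<open>a, b, w\<close>.\<close>

lemma path_4_I:
  assumes ab: "(a, b) \<in> parcs G" and bc: "(b, c) \<in> parcs G" and cd: "(c, d) \<in> parcs G"
  shows "scaled_path 1 [a, b, c, d] \<in> I"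
proof -
  have arrow: "scaled_path (1 :: 'k) [x, y] \<in> carrier PA" if "(x, y) \<in> parcs G" for x y
    using that by (intro scaled_path_carrier) (simp add: walk_simps)
  have left: "scaled_path 1 [x, y, z, w] \<in> I"
    if "(x, y) \<in> parcs G" "(y, z) \<in> parcs G" "(z, w) \<in> parcs G" "x \<noteq> z" for x y z w
    using I.I_r_closed[OF bent_path_I[OF that(1,2,4)] arrow[OF that(3)]]
    by (simp add: scaled_path_mult)
  have right: "scaled_path 1 [x, y, z, w] \<in> I"
    if "(x, y) \<in> parcs G" "(y, z) \<in> parcs G" "(z, w) \<in> parcs G" "y \<noteq> w" for x y z w
    using I.I_l_closed[OF bent_path_I[OF that(2,3,4)] arrow[OF that(1)]]
    by (simp add: scaled_path_mult)
  show ?thesis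
  proof (cases "a = c \<and> b = d")
    case False
    then show ?thesis using left right ab bc cd by blast
  next
    case True
    have ba: "(b, a) \<in> parcs G" using ab arcs_sym by blast
    from another_neighbour[OF ab] have "scaled_path 1 [a, b, a, b] \<in> I"
    proof (elim disjE exE conjE)
      fix w assume w: "w \<noteq> b" "(a, w) \<in> parcs G"
      have "(\<lambda>p. scaled_path 1 [a, b, a] p - scaled_path 1 [a, w, a] p) \<otimes>\<^bsub>PA\<^esub> scaled_path 1 [a, b] \<in> I"
        by (rule I.I_r_closed[OF loop_difference_I[OF ab w(2)] arrow[OF ab]])
      then have 1: "(\<lambda>p. scaled_path 1 [a, b, a, b] p - scaled_path 1 [a, w, a, b] p) \<in> I"
        by (simp add: path_mult_diff_left scaled_path_mult)
      have 2: "scaled_path 1 [a, w, a, b] \<in> I" using right w ab arcs_sym by blast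
      show ?thesis using I_add[OF 1 2] by simp
    next
      fix w assume w: "w \<noteq> a" "(b, w) \<in> parcs G"
      have "scaled_path 1 [a, b] \<otimes>\<^bsub>PA\<^esub> (\<lambda>p. scaled_path 1 [b, a, b] p - scaled_path 1 [b, w, b] p) \<in> I"
        by (rule I.I_l_closed[OF loop_difference_I[OF ba w(2)] arrow[OF ab]])
      then have 1: "(\<lambda>p. scaled_path 1 [a, b, a, b] p - scaled_path 1 [a, b, w, b] p) \<in> I"
        by (simp add: path_mult_diff_right scaled_path_mult)
      have 2: "scaled_path 1 [a, b, w, b] \<in> I" using left w ab arcs_sym by blast
      show ?thesis using I_add[OF 1 2] by simp
    qed
    then show ?thesis using True by simp
  qed
qed

lemma long_path_I:
  assumes "vwalk p (with_proj G)" and "length p \<ge> 4"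
  shows "scaled_path 1 p \<in> I"
proof -
  obtain a b c d q where p: "p = a # b # c # d # q"
  proof -
    obtain a p1 where 1: "p = a # p1" using assms(2) by (cases p) auto
    then obtain b p2 where 2: "p1 = b # p2" using assms(2) by (cases p1) auto
    then obtain c p3 where 3: "p2 = c # p3" using assms(2) 1 by (cases p2) auto
    then obtain d q where "p3 = d # q" using assms(2) 1 2 by (cases p3) auto
    then show thesis using that 1 2 3 by blast
  qed
  have arcs: "(a, b) \<in> parcs G" "(b, c) \<in> parcs G" "(c, d) \<in> parcs G" and w: "vwalk (d # q) (with_proj G)"
    using assms(1) by (simp_all add: p walk_simps)
  have "scaled_path 1 [a, b, c, d] \<otimes>\<^bsub>PA\<^esub> scaled_path 1 (d # q) \<in> I"
    by (rule I.I_r_closed[OF path_4_I[OF arcs] scaled_path_carrier[OF w]])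
  then show ?thesis by (simp add: scaled_path_mult p)
qed

text \<open>Modulo the ideal every path of length at least 2 equals its normal form
  \<open>c p\<close>: a loop at \<open>v\<close> becomes the loop through \<open>nb v\<close>, any
  other path becomes 0. The normal forms of the terms of \<open>f\<close> add up to its loop sums,
  which are 0.\<close>

lemma J_subset_I: "J \<subseteq> I"
proof
  fix f assume f: "f \<in> J"
  then have fc: "f \<in> carrier PA" and f1: "\<And>v. f [v] = 0" and f2: "\<And>u v. f [u, v] = 0"
    and f3: "\<And>v. (\<Sum>u\<in>UNIV. f [v, u, v]) = 0" by (simp_all add: J_def)
  define S where "S = {p. f p \<noteq> 0}"
  have fin: "finite S" using fc by (simp add: S_def path_carrier)
  define loop where "loop p \<longleftrightarrow> (\<exists>v u. p = [v, u, v])" for p :: "'v list"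
  define c where "c p q = (if loop p then scaled_path (1 :: 'k) [hd p, nb (hd p), hd p] q else 0)" for p q
  have "(\<lambda>q. scaled_path 1 p q - c p q) \<in> I" if p: "p \<in> S" for p
  proof -
    have w: "vwalk p (with_proj G)" using path_carrier_walk[OF fc] p by (simp add: S_def)
    have "length p \<noteq> 0" using w by (auto simp: vwalk_def)
    moreover have "length p \<noteq> 1" using p f1 by (auto simp: S_def length_Suc_conv)
    moreover have "length p \<noteq> 2" using p f2 by (auto simp: S_def length_Suc_conv numeral_2_eq_2)
    ultimately consider "length p = 3" | "length p \<ge> 4" by linarith
    then show ?thesis
    proof cases
      case 1
      then obtain x y z where xyz: "p = [x, y, z]" by (auto simp: length_Suc_conv numeral_3_eq_3)
      then have arcs: "(x, y) \<in> parcs G" "(y, z) \<in> parcs G" using w by (simp_all add: walk_simps)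
      show ?thesis
      proof (cases "x = z")
        case True
        then have "c p = scaled_path 1 [x, nb x, x]" by (auto simp: c_def loop_def xyz)
        then show ?thesis using loop_difference_I[OF arcs(1) arc_nb] xyz True by simp
      next
        case False
        then have "c p q = 0" for q by (auto simp: c_def loop_def xyz)
        then show ?thesis using bent_path_I[OF arcs False] xyz by simp
      qed
    next
      case 2
      then have "c p q = 0" for q by (auto simp: c_def loop_def)
      then show ?thesis using long_path_I[OF w 2] by simp
    qed
  qed
  then have "(\<lambda>q. \<Sum>p\<in>S. f p * (scaled_path 1 p q - c p q)) \<in> I"
    by (intro I_sum I_scale fin)
  moreover have "(\<Sum>p\<in>S. f p * (scaled_path 1 p q - c p q)) = f q" for q
  proof -
    have "(\<Sum>p\<in>S. f p * c p q) = 0"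
    proof (cases "\<exists>v. q = [v, nb v, v]")
      case False
      then have "c p q = 0" for p by (auto simp: c_def scaled_path_def)
      then show ?thesis by simp
    next
      case True
      then obtain v where q: "q = [v, nb v, v]" by blast
      \<comment> \<open>Exactly the loops at \<open>v\<close> have \<open>q\<close> as normal form;
        the sum then extends from the support of \<open>f\<close> to all of them.\<close>
      have "(\<Sum>p\<in>S. f p * c p q) = (\<Sum>p\<in>S \<inter> range (\<lambda>u. [v, u, v]). f p)"
        by (rule sum.mono_neutral_cong_right[OF fin]) (auto simp: c_def loop_def q scaled_path_def)
      also have "\<dots> = (\<Sum>p\<in>range (\<lambda>u. [v, u, v]). f p)"
        by (rule sum.mono_neutral_left) (auto simp: S_def)
      also have "\<dots> = (\<Sum>u\<in>UNIV. f [v, u, v])"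
        by (subst sum.reindex) (auto intro: inj_onI)
      finally show ?thesis using f3 by simp
    qed
    moreover have "(\<Sum>p\<in>S. f p * scaled_path 1 p q) = (\<Sum>p\<in>S. if q = p then f p else 0)"
      by (intro sum.cong) (auto simp: scaled_path_def)
    moreover have "\<dots> = f q" using fin by (auto simp: S_def)
    ultimately show ?thesis by (simp add: right_diff_distrib sum_subtractf)
  qed
  ultimately show "f \<in> I" by simp
qed

lemma I_eq_J: "I = J"
  unfolding I_def using PA.genideal_minimal[OF J_ideal rels_J] J_subset_I I_def by blast

subsection \<open>Coordinates\<close>

text \<open>The coordinates of a class at the idempotents \<open>e\<^sub>v\<close>, the arrows \<open>u \<rightarrow> v\<close>, and the loops
  \<open>v \<rightarrow> u \<rightarrow> v\<close>, all of which are equal in the quotient.\<close>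

definition cE :: "('v list \<Rightarrow> 'k) set \<Rightarrow> 'v \<Rightarrow> 'k" where
  "cE a v = the_elem ((\<lambda>f. f [v]) ` a)"

definition cB :: "('v list \<Rightarrow> 'k) set \<Rightarrow> 'v \<Rightarrow> 'v \<Rightarrow> 'k" where
  "cB a u v = the_elem ((\<lambda>f. f [u, v]) ` a)"

definition cX :: "('v list \<Rightarrow> 'k) set \<Rightarrow> 'v \<Rightarrow> 'k" where
  "cX a v = the_elem ((\<lambda>f. \<Sum>u\<in>UNIV. f [v, u, v]) ` a)"

lemma cl_coset: "cl f = I +>\<^bsub>PA\<^esub> f"
  by (simp add: zigzag_class_def quiver)

lemma cl_iff: "g \<in> cl f \<longleftrightarrow> (\<exists>h\<in>I. g = (\<lambda>p. h p + f p))"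
  by (auto simp: cl_coset a_r_coset_def' path_add)

lemma cl_self: "f \<in> carrier PA \<Longrightarrow> f \<in> cl f"
  using I.zero_closed by (auto simp: cl_iff path_zero intro!: bexI[of _ "\<lambda>p. 0"])

text \<open>The three functionals vanish on \<open>J\<close>, which is the ideal, so they are
  constant on each coset and \<open>the_elem\<close> returns the common value.\<close>

lemma coords_cl:
  assumes f: "f \<in> carrier PA"
  shows cE_cl: "cE (cl f) v = f [v]" and "cB (cl f) u v = f [u, v]"
    and "cX (cl f) v = (\<Sum>u\<in>UNIV. f [v, u, v])"
proof -
  have eq: "g [v] = f [v]" "g [u, v] = f [u, v]" "(\<Sum>u\<in>UNIV. g [v, u, v]) = (\<Sum>u\<in>UNIV. f [v, u, v])"
    if g: "g \<in> cl f" for g u v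
  proof -
    obtain h where h: "h \<in> J" and gh: "g = (\<lambda>p. h p + f p)" using g unfolding cl_iff I_eq_J by blast
    show "g [v] = f [v]" "g [u, v] = f [u, v]" "(\<Sum>u\<in>UNIV. g [v, u, v]) = (\<Sum>u\<in>UNIV. f [v, u, v])"
      using h unfolding gh J_def by (simp_all add: sum.distrib)
  qed
  have ne: "cl f \<noteq> {}" using cl_self[OF f] by blast
  show "cE (cl f) v = f [v]" unfolding cE_def
    by (rule the_elem_image_unique[OF ne]) (rule eq(1))
  show "cB (cl f) u v = f [u, v]" unfolding cB_def
    by (rule the_elem_image_unique[OF ne]) (rule eq(2))
  show "cX (cl f) v = (\<Sum>u\<in>UNIV. f [v, u, v])" unfolding cX_def
    by (rule the_elem_image_unique[OF ne]) (rule eq(3))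
qed

lemma A_carrier: "carrier A = cl ` carrier PA"
proof -
  have "cl = (\<lambda>f. I +>\<^bsub>PA\<^esub> f)" by (rule ext) (rule cl_coset)
  then show ?thesis by (auto simp: zigzag_algebra_def quiver Let_def FactRing_def A_RCOSETS_def')
qed

lemma A_carrierE:
  assumes "a \<in> carrier A"
  obtains f where "f \<in> carrier PA" and "a = cl f"
  using assms by (auto simp: A_carrier)

lemma cl_carrier: "f \<in> carrier PA \<Longrightarrow> cl f \<in> carrier A"
  by (simp add: A_carrier)

lemma A_add: "f \<in> carrier PA \<Longrightarrow> g \<in> carrier PA \<Longrightarrow> cl f \<oplus>\<^bsub>A\<^esub> cl g = cl (\<lambda>p. f p + g p)"
  using I.a_rcos_sum[of f g] by (simp add: zigzag_algebra_def quiver Let_def FactRing_def cl_coset path_add)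

lemma A_mult: "f \<in> carrier PA \<Longrightarrow> g \<in> carrier PA \<Longrightarrow> cl f \<otimes>\<^bsub>A\<^esub> cl g = cl (f \<otimes>\<^bsub>PA\<^esub> g)"
  using I.rcoset_mult_add[of f g] by (simp add: zigzag_algebra_def quiver Let_def FactRing_def cl_coset)

lemma A_zero: "\<zero>\<^bsub>A\<^esub> = cl (\<lambda>p. 0)"
proof -
  have "I +>\<^bsub>PA\<^esub> \<zero>\<^bsub>PA\<^esub> = I" by (rule PA.a_coset_join2[OF PA.zero_closed I.a_subgroup I.zero_closed])
  then show ?thesis by (simp add: zigzag_algebra_def quiver Let_def FactRing_def cl_coset path_zero)
qed

lemma A_one: "\<one>\<^bsub>A\<^esub> = cl \<one>\<^bsub>PA\<^esub>"
  by (simp add: zigzag_algebra_def quiver Let_def FactRing_def cl_coset)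

lemma A_ring: "ring A"
proof -
  interpret Q: ring "PA Quot I" by (rule I.quotient_is_ring)
  have ops: "carrier A = carrier (PA Quot I)" "add A = add (PA Quot I)" "zero A = zero (PA Quot I)"
    "mult A = mult (PA Quot I)" "one A = one (PA Quot I)"
    by (simp_all add: zigzag_algebra_def quiver Let_def)
  show ?thesis
  proof (rule ringI)
    show "abelian_group A"
    proof (rule abelian_groupI)
      fix a assume "a \<in> carrier A"
      then show "\<exists>b\<in>carrier A. b \<oplus>\<^bsub>A\<^esub> a = \<zero>\<^bsub>A\<^esub>"
        unfolding ops using Q.a_inv_closed Q.l_neg by blast
    qed (unfold ops, (rule Q.a_closed Q.zero_closed Q.a_assoc Q.a_comm Q.l_zero; assumption)+)
    show "Group.monoid A"
      by (rule monoidI, unfold ops) (rule Q.m_closed Q.one_closed Q.m_assoc Q.l_one Q.r_one; assumption)+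
  qed (unfold ops, (rule Q.l_distr Q.r_distr; assumption)+)
qed

sublocale A: ring A
  by (rule A_ring)

lemma coords_add:
  assumes "a \<in> carrier A" and "b \<in> carrier A"
  shows "cE (a \<oplus>\<^bsub>A\<^esub> b) v = cE a v + cE b v" and "cB (a \<oplus>\<^bsub>A\<^esub> b) u v = cB a u v + cB b u v"
    and "cX (a \<oplus>\<^bsub>A\<^esub> b) v = cX a v + cX b v"
  using assms by (auto elim!: A_carrierE simp: A_add coords_cl path_add_closed sum.distrib)

text \<open>The loop coordinate collects every arrow out of \<open>v\<close> followed by the arrow
  back, because all loops at \<open>v\<close> are identified.\<close>

lemma coords_mult:
  assumes "a \<in> carrier A" and "b \<in> carrier A"
  shows "cE (a \<otimes>\<^bsub>A\<^esub> b) v = cE a v * cE b v"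
    and "cB (a \<otimes>\<^bsub>A\<^esub> b) u v = cE a u * cB b u v + cB a u v * cE b v"
    and "cX (a \<otimes>\<^bsub>A\<^esub> b) v = cE a v * cX b v + (\<Sum>u\<in>UNIV. cB a v u * cB b u v) + cX a v * cE b v"
  using assms
  by (auto elim!: A_carrierE simp: A_mult coords_cl path_mult_closed mult_1 mult_2 mult_3 sum.distrib
      sum_distrib_left sum_distrib_right)

lemma coords_zero: "cE \<zero>\<^bsub>A\<^esub> v = 0" "cB \<zero>\<^bsub>A\<^esub> u v = 0" "cX \<zero>\<^bsub>A\<^esub> v = 0"
  using coords_cl[of "\<lambda>p. 0"] by (simp_all add: A_zero path_carrier)

lemma cB_nonarc: "a \<in> carrier A \<Longrightarrow> (u, v) \<notin> parcs G \<Longrightarrow> cB a u v = 0"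
  by (auto elim!: A_carrierE simp: coords_cl nonarc_zero)

text \<open>Equal coordinates put the difference of two representatives into \<open>J\<close>, hence
  into the ideal.\<close>

lemma coords_eqI:
  assumes "a \<in> carrier A" and "b \<in> carrier A" and "\<And>v. cE a v = cE b v" and "\<And>u v. cB a u v = cB b u v"
    and "\<And>v. cX a v = cX b v"
  shows "a = b"
proof -
  obtain f g where f: "f \<in> carrier PA" "a = cl f" and g: "g \<in> carrier PA" "b = cl g"
    using assms(1,2) by (auto elim!: A_carrierE)
  have "f \<ominus>\<^bsub>PA\<^esub> g = (\<lambda>p. f p - g p)"
    using g by (simp add: a_minus_def PA_minus path_add)
  moreover have "f [v] = g [v]" "f [u, v] = g [u, v]" "(\<Sum>u\<in>UNIV. f [v, u, v]) = (\<Sum>u\<in>UNIV. g [v, u, v])" for u v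
    using assms(3)[of v] assms(4)[of u v] assms(5)[of v]
    unfolding f(2) g(2) coords_cl[OF f(1)] coords_cl[OF g(1)] by blast+
  moreover have "f \<ominus>\<^bsub>PA\<^esub> g \<in> carrier PA" using f(1) g(1) by (rule PA.minus_closed)
  ultimately have "f \<ominus>\<^bsub>PA\<^esub> g \<in> I"
    unfolding I_eq_J J_def mem_Collect_eq by (simp add: sum_subtractf)
  then show ?thesis
    unfolding f(2) g(2) cl_coset PA.quotient_eq_iff_same_a_r_cos[OF I.is_ideal f(1) g(1)] .
qed

text \<open>A normal form with prescribed coordinates. The loop coefficient at \<open>u\<close> sits
  on the single path through \<open>nb u\<close>, so that the loop sum is
  \<open>\<xi> u\<close>.\<close>

definition rep :: "('v \<Rightarrow> 'k) \<Rightarrow> ('v \<Rightarrow> 'v \<Rightarrow> 'k) \<Rightarrow> ('v \<Rightarrow> 'k) \<Rightarrow> 'v list \<Rightarrow> 'k" where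
  "rep \<epsilon> \<beta> \<xi> p =
    (case p of [v] \<Rightarrow> \<epsilon> v | [u, v] \<Rightarrow> if (u, v) \<in> parcs G then \<beta> u v else 0
     | [u, v, w] \<Rightarrow> if v = nb u \<and> w = u then \<xi> u else 0 | _ \<Rightarrow> 0)"

definition mk :: "('v \<Rightarrow> 'k) \<Rightarrow> ('v \<Rightarrow> 'v \<Rightarrow> 'k) \<Rightarrow> ('v \<Rightarrow> 'k) \<Rightarrow> ('v list \<Rightarrow> 'k) set" where
  "mk \<epsilon> \<beta> \<xi> = cl (rep \<epsilon> \<beta> \<xi>)"

lemma rep_nonzero:
  assumes "rep \<epsilon> \<beta> \<xi> p \<noteq> 0"
  obtains v where "p = [v]" and "\<epsilon> v \<noteq> 0"
  | u v where "p = [u, v]" and "(u, v) \<in> parcs G" and "\<beta> u v \<noteq> 0"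
  | v where "p = [v, nb v, v]" and "\<xi> v \<noteq> 0"
  using assms by (auto simp: rep_def split: list.splits if_splits)

lemma rep_carrier: "rep \<epsilon> \<beta> \<xi> \<in> carrier PA"
proof -
  have "{p. rep \<epsilon> \<beta> \<xi> p \<noteq> 0} \<subseteq> {p. set p \<subseteq> UNIV \<and> length p \<le> 3}"
    by (auto elim!: rep_nonzero)
  then have "finite {p. rep \<epsilon> \<beta> \<xi> p \<noteq> 0}"
    by (rule finite_subset) (rule finite_lists_length_le[OF finite])
  moreover have "vwalk p (with_proj G)" if "rep \<epsilon> \<beta> \<xi> p \<noteq> 0" for p
    using that arc_nb arcs_sym by (cases rule: rep_nonzero) (auto simp: walk_simps)
  ultimately show ?thesis by (simp add: path_carrier)
qed

lemma mk_carrier: "mk \<epsilon> \<beta> \<xi> \<in> carrier A"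
  unfolding mk_def by (rule cl_carrier[OF rep_carrier])

lemma coords_mk: "cE (mk \<epsilon> \<beta> \<xi>) v = \<epsilon> v"
  "cB (mk \<epsilon> \<beta> \<xi>) u v = (if (u, v) \<in> parcs G then \<beta> u v else 0)"
  "cX (mk \<epsilon> \<beta> \<xi>) v = \<xi> v"
  by (simp_all add: mk_def coords_cl[OF rep_carrier] rep_def)

lemma coords_path_1: "cE (cl (scaled_path c [w])) v = (if v = w then c else 0)"
  "cB (cl (scaled_path c [w])) u v = 0" "cX (cl (scaled_path c [w])) v = 0"
  and path_1_carrier: "cl (scaled_path c [w]) \<in> carrier A"
  using scaled_path_carrier[of "[w]" G c] by (simp_all add: coords_cl walk_simps cl_carrier scaled_path_def)

lemma coords_path_2:
  assumes "(s, t) \<in> parcs G"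
  shows "cE (cl (scaled_path c [s, t])) v = 0"
    "cB (cl (scaled_path c [s, t])) u v = (if u = s \<and> v = t then c else 0)"
    "cX (cl (scaled_path c [s, t])) v = 0"
    and path_2_carrier: "cl (scaled_path c [s, t]) \<in> carrier A"
  using scaled_path_carrier[of "[s, t]" G c] assms
  by (simp_all add: coords_cl walk_simps cl_carrier scaled_path_def)

lemma coords_finsum:
  assumes "\<And>s. s \<in> S \<Longrightarrow> f s \<in> carrier A" and "finite S"
  shows "cE (finsum A f S) v = (\<Sum>s\<in>S. cE (f s) v)"
    and "cB (finsum A f S) u v = (\<Sum>s\<in>S. cB (f s) u v)"
    and "cX (finsum A f S) v = (\<Sum>s\<in>S. cX (f s) v)"
proof -
  have "finsum A f S \<in> carrier A \<and> cE (finsum A f S) v = (\<Sum>s\<in>S. cE (f s) v) \<and>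
    cB (finsum A f S) u v = (\<Sum>s\<in>S. cB (f s) u v) \<and> cX (finsum A f S) v = (\<Sum>s\<in>S. cX (f s) v)"
    using assms(2,1)
  proof (induction S rule: finite_induct)
    case (insert s S)
    then have "f \<in> S \<rightarrow> carrier A" "f s \<in> carrier A" by auto
    then show ?case using insert by (simp add: coords_add)
  qed (simp add: coords_zero)
  then show "cE (finsum A f S) v = (\<Sum>s\<in>S. cE (f s) v)" "cB (finsum A f S) u v = (\<Sum>s\<in>S. cB (f s) u v)"
    "cX (finsum A f S) v = (\<Sum>s\<in>S. cX (f s) v)" by blast+
qed

subsection \<open>The grading\<close>

text \<open>Degrees 0, 1 and 2 carry one kind of coordinate each. In the converse direction the
  normal form is a homogeneous representative.\<close>

lemma A_comp:
  "a \<in> gr_comp A n \<longleftrightarrow> a \<in> carrier A \<and> (n \<noteq> 0 \<longrightarrow> (\<forall>v. cE a v = 0)) \<and>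
    (n \<noteq> 1 \<longrightarrow> (\<forall>u v. cB a u v = 0)) \<and> (n \<noteq> 2 \<longrightarrow> (\<forall>v. cX a v = 0))"
proof -
  have gr: "gr_comp A n = cl ` {f \<in> carrier PA. \<forall>p. f p \<noteq> 0 \<longrightarrow> int (length p - 1) = n}"
    by (simp add: zigzag_algebra_def quiver degree Let_def)
  show ?thesis
  proof
    assume "a \<in> gr_comp A n"
    then obtain f where f: "f \<in> carrier PA" "a = cl f" and d: "\<And>p. int (length p - 1) \<noteq> n \<Longrightarrow> f p = 0"
      unfolding gr by blast
    show "a \<in> carrier A \<and> (n \<noteq> 0 \<longrightarrow> (\<forall>v. cE a v = 0)) \<and>
      (n \<noteq> 1 \<longrightarrow> (\<forall>u v. cB a u v = 0)) \<and> (n \<noteq> 2 \<longrightarrow> (\<forall>v. cX a v = 0))"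
      using f d by (auto simp: coords_cl cl_carrier)
  next
    assume a: "a \<in> carrier A \<and> (n \<noteq> 0 \<longrightarrow> (\<forall>v. cE a v = 0)) \<and>
      (n \<noteq> 1 \<longrightarrow> (\<forall>u v. cB a u v = 0)) \<and> (n \<noteq> 2 \<longrightarrow> (\<forall>v. cX a v = 0))"
    have "a = cl (rep (cE a) (cB a) (cX a))"
      using a mk_carrier by (intro coords_eqI) (auto simp: coords_mk cB_nonarc mk_def[symmetric])
    moreover have "int (length p - 1) = n" if "rep (cE a) (cB a) (cX a) p \<noteq> 0" for p
      using that a by (cases rule: rep_nonzero) auto
    ultimately show "a \<in> gr_comp A n" unfolding gr using rep_carrier by blast
  qed
qed

lemma coords_minus:
  assumes "a \<in> carrier A"
  shows "cE (\<ominus>\<^bsub>A\<^esub> a) v = - cE a v" "cB (\<ominus>\<^bsub>A\<^esub> a) u v = - cB a u v" "cX (\<ominus>\<^bsub>A\<^esub> a) v = - cX a v"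
proof -
  have "\<ominus>\<^bsub>A\<^esub> a \<oplus>\<^bsub>A\<^esub> a = \<zero>\<^bsub>A\<^esub>" "\<ominus>\<^bsub>A\<^esub> a \<in> carrier A" using assms A.l_neg by auto
  then show "cE (\<ominus>\<^bsub>A\<^esub> a) v = - cE a v" "cB (\<ominus>\<^bsub>A\<^esub> a) u v = - cB a u v" "cX (\<ominus>\<^bsub>A\<^esub> a) v = - cX a v"
    using coords_add[of "\<ominus>\<^bsub>A\<^esub> a" a, symmetric] assms by (simp_all add: coords_zero eq_neg_iff_add_eq_0)
qed

lemma A_graded: "graded_ring A"
  unfolding graded_ring_def
proof (intro conjI allI ballI A_ring)
  show "graded_by A (gr_comp A)"
  proof (rule graded_byI[OF A.abelian_group_axioms, of _ "\<lambda>a n. mk (\<lambda>v. if n = 0 then cE a v else 0)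
      (\<lambda>u v. if n = 1 then cB a u v else 0) (\<lambda>v. if n = 2 then cX a v else 0)"])
    fix n
    show "subgroup (gr_comp A n) (add_monoid A)"
    proof (rule subgroup.intro)
      fix a assume a: "a \<in> gr_comp A n"
      then have "\<ominus>\<^bsub>A\<^esub> a \<in> gr_comp A n" by (simp add: A_comp coords_minus)
      then show "inv\<^bsub>add_monoid A\<^esub> a \<in> gr_comp A n" by (simp add: a_inv_def)
    qed (auto simp: A_comp coords_add coords_zero)
  next
    fix a assume a: "a \<in> carrier A"
    let ?p = "\<lambda>n :: int. mk (\<lambda>v. if n = 0 then cE a v else 0)
      (\<lambda>u v. if n = 1 then cB a u v else 0) (\<lambda>v. if n = 2 then cX a v else 0)"
    have "a = finsum A ?p {0, 1, 2}"
    proof (rule coords_eqI[OF a])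
      show "finsum A ?p {0, 1, 2} \<in> carrier A" using mk_carrier by (intro A.finsum_closed) auto
    qed (simp_all add: coords_add mk_carrier coords_mk cB_nonarc[OF a])
    moreover have "?p n \<in> gr_comp A n" for n by (simp add: A_comp mk_carrier coords_mk)
    moreover have "?p n = \<zero>\<^bsub>A\<^esub>" if "n \<notin> {0, 1, 2}" for n
      using that by (intro coords_eqI) (simp_all add: mk_carrier coords_mk coords_zero)
    ultimately show "\<exists>S. finite S \<and> (\<forall>n. ?p n \<in> gr_comp A n) \<and> (\<forall>n. n \<notin> S \<longrightarrow> ?p n = \<zero>\<^bsub>A\<^esub>) \<and> a = finsum A ?p S"
      by (intro exI[of _ "{0, 1, 2}"]) blast
  next
    fix c and S :: "int set"
    assume S: "finite S" and c: "\<And>n. c n \<in> gr_comp A n" and z: "\<And>n. n \<notin> S \<Longrightarrow> c n = \<zero>\<^bsub>A\<^esub>"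
    have cc: "c n \<in> carrier A" for n using c[of n] by (simp add: A_comp)
    \<comment> \<open>A coordinate living in degree \<open>m\<close> sees one term of a homogeneous
      sum; if \<open>m\<close> is outside \<open>S\<close>, that term is 0 and the equation still
      holds.\<close>
    have pick: "(\<Sum>n\<in>S. f (c n)) = f (c m)"
      if "\<And>n. n \<noteq> m \<Longrightarrow> f (c n) = 0" and "f \<zero>\<^bsub>A\<^esub> = 0" for f :: "_ \<Rightarrow> 'k" and m
    proof (cases "m \<in> S")
      case True
      have "(\<Sum>n\<in>S. f (c n)) = (\<Sum>n\<in>{m}. f (c n))"
        by (rule sum.mono_neutral_right[OF S]) (use True that(1) in auto)
      then show ?thesis by simp
    next
      case False
      have "\<forall>n\<in>S. f (c n) = 0"
      proof
        fix n assume "n \<in> S"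
        then have "n \<noteq> m" using False by blast
        then show "f (c n) = 0" by (rule that(1))
      qed
      then show ?thesis using that(2) z[OF False] by simp
    qed
    have E: "cE (finsum A c S) v = cE (c 0) v" and B: "cB (finsum A c S) u v = cB (c 1) u v"
      and X: "cX (finsum A c S) v = cX (c 2) v" for u v
      using pick[of 0 "\<lambda>a. cE a v"] pick[of 1 "\<lambda>a. cB a u v"] pick[of 2 "\<lambda>a. cX a v"] c
      by (auto simp: coords_finsum S cc coords_zero A_comp)
    show "(\<lambda>n. mk (\<lambda>v. if n = 0 then cE (finsum A c S) v else 0)
      (\<lambda>u v. if n = 1 then cB (finsum A c S) u v else 0) (\<lambda>v. if n = 2 then cX (finsum A c S) v else 0)) = c"
      unfolding E B X
    proof
      fix n
      show "mk (\<lambda>v. if n = 0 then cE (c 0) v else 0) (\<lambda>u v. if n = 1 then cB (c 1) u v else 0)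
        (\<lambda>v. if n = 2 then cX (c 2) v else 0) = c n"
        using c[of n] by (intro coords_eqI) (auto simp: mk_carrier coords_mk A_comp cB_nonarc)
    qed
  qed
next
  fix m n a b assume a: "a \<in> gr_comp A m" and b: "b \<in> gr_comp A n"
  have ab: "a \<in> carrier A" "b \<in> carrier A" using a b by (simp_all add: A_comp)
  have a0: "m \<noteq> 0 \<Longrightarrow> cE a v = 0" "m \<noteq> 1 \<Longrightarrow> cB a u v = 0" "m \<noteq> 2 \<Longrightarrow> cX a v = 0"
    and b0: "n \<noteq> 0 \<Longrightarrow> cE b v = 0" "n \<noteq> 1 \<Longrightarrow> cB b u v = 0" "n \<noteq> 2 \<Longrightarrow> cX b v = 0" for u v
    using a b by (simp_all add: A_comp)
  have "cE (a \<otimes>\<^bsub>A\<^esub> b) v = 0" if "m + n \<noteq> 0" for v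
    using that a0(1) b0(1) by (cases "m = 0") (auto simp: coords_mult[OF ab])
  moreover have "cB (a \<otimes>\<^bsub>A\<^esub> b) u v = 0" if "m + n \<noteq> 1" for u v
  proof -
    have "cE a u * cB b u v = 0" using that a0(1) b0(2) by (cases "m = 0") auto
    moreover have "cB a u v * cE b v = 0" using that a0(2) b0(1) by (cases "n = 0") auto
    ultimately show ?thesis by (simp only: coords_mult[OF ab] add_0_right sum.neutral_const)
  qed
  moreover have "cX (a \<otimes>\<^bsub>A\<^esub> b) v = 0" if "m + n \<noteq> 2" for v
  proof -
    have "cE a v * cX b v = 0" using that a0(1) b0(3) by (cases "m = 0") auto
    moreover have "cX a v * cE b v = 0" using that a0(3) b0(1) by (cases "n = 0") auto
    moreover have "cB a v u * cB b u v = 0" for u using that a0(2) b0(2) by (cases "m = 1") auto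
    ultimately show ?thesis by (simp only: coords_mult[OF ab] add_0_right sum.neutral_const)
  qed
  ultimately show "a \<otimes>\<^bsub>A\<^esub> b \<in> gr_comp A (m + n)"
    using ab by (simp add: A_comp)
qed

end

section \<open>Multiplicities and Chebyshev polynomials\<close>

context chebyshev
begin

text \<open>The right-hand side is an entry of the adjacency matrix times the vector of label
  counts.\<close>

lemma card_arcs_level:
  "card {x \<in> V t. (lab x, k) \<in> parcs G} = (\<Sum>j\<in>UNIV. if (k, j) \<in> parcs G then card (Vl t j) else 0)"
proof -
  have "{x \<in> V t. (lab x, k) \<in> parcs G} = (\<Union>j\<in>{j. (k, j) \<in> parcs G}. Vl t j)"
    using arcs_sym by auto
  then have "card {x \<in> V t. (lab x, k) \<in> parcs G} = (\<Sum>j\<in>{j. (k, j) \<in> parcs G}. card (Vl t j))"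
    using finite_Vl by (simp only:) (intro card_UN_disjoint, auto)
  also have "\<dots> = (\<Sum>j\<in>UNIV. if (k, j) \<in> parcs G then card (Vl t j) else 0)"
    by (simp add: sum.If_cases)
  finally show ?thesis .
qed

text \<open>With at most two vertices, level 1 has at most one vertex, labeled \<open>j\<close>. The
  recursion then empties level 2: label \<open>i\<close> has at most one neighbour in level 1 but
  already one vertex in level 0, and label \<open>j\<close> has no neighbour there. So the
  exceptional presentations of the algebra never meet a nonterminating run.\<close>

lemma terminates_if_small:
  assumes "card (UNIV :: 'v set) \<le> 2"
  shows "\<exists>s\<ge>1. V s = {}"
proof -
  \<comment> \<open>For a graph with one vertex, \<open>j = i\<close>.\<close>
  obtain j where univ: "UNIV = {i, j}"
  proof (cases "UNIV = {i}")
    case True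
    then show thesis using that[of i] by simp
  next
    case False
    then obtain j where j: "j \<noteq> i" by blast
    then have "card {i, j} = 2" by simp
    then have "card {i, j} = card (UNIV :: 'v set)"
      using assms card_mono[of UNIV "{i, j}"] by simp
    then show thesis using card_subset_eq[of UNIV "{i, j}"] that[of j] by simp
  qed
  have cases: "k = i \<or> k = j" for k using univ by blast
  obtain v where v: "V 0 = {v}" "lab v = i" by (rule level_0)
  have i1: "Vl (Suc 0) i = {}"
  proof -
    have none: "{x \<in> V 0. (lab x, i) \<in> parcs G} = {}" using v arcs_irrefl by auto
    have "card (Vl (Suc 0) i) = 0" unfolding card_level_1 none by simp
    then show ?thesis using finite_Vl[of "Suc 0" i] card_0_eq by blast
  qed
  have le1: "card (Vl (Suc 0) k) \<le> 1" for k
  proof -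
    have "{x \<in> V 0. (lab x, k) \<in> parcs G} \<subseteq> {v}" using v by auto
    then have "card {x \<in> V 0. (lab x, k) \<in> parcs G} \<le> 1" using card_mono[of "{v}" "{x \<in> V 0. (lab x, k) \<in> parcs G}"] by simp
    then show ?thesis using card_level_1[of k] by simp
  qed
  show ?thesis
  proof (cases "V (Suc 0) = {}")
    case True
    then show ?thesis by auto
  next
    case False
    have "Vl (Suc (Suc 0)) k = {}" for k
    proof -
      have sub: "{x \<in> V (Suc 0). (lab x, k) \<in> parcs G} \<subseteq> (if k = i then Vl (Suc 0) j else {})"
      proof
        fix x assume x: "x \<in> {x \<in> V (Suc 0). (lab x, k) \<in> parcs G}"
        then have "lab x \<noteq> i" using i1 by auto
        then have "lab x = j" using cases by blast
        moreover have "k = i" using x \<open>lab x = j\<close> cases[of k] arcs_irrefl by auto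
        ultimately show "x \<in> (if k = i then Vl (Suc 0) j else {})" using x by simp
      qed
      have "card {x \<in> V (Suc 0). (lab x, k) \<in> parcs G} \<le> card (if k = i then Vl (Suc 0) j else {})"
        using sub finite_Vl by (intro card_mono) auto
      also have "\<dots> \<le> card (Vl 0 k)" using le1[of j] by (simp add: card_level_0)
      finally have "card (Vl (Suc (Suc 0)) k) = 0" using card_level_Suc_Suc[OF False, of k] by simp
      then show ?thesis using finite_Vl[of "Suc (Suc 0)" k] card_0_eq by blast
    qed
    then have "V (Suc (Suc 0)) = {}" by blast
    then show ?thesis by (intro exI[of _ "Suc (Suc 0)"]) simp
  qed
qed

end

section \<open>Polynomials evaluated at a matrix\<close>

abbreviation matrix_power :: "int ^ 'v ^ 'v \<Rightarrow> nat \<Rightarrow> int ^ 'v::finite ^ 'v" where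
  "matrix_power A n \<equiv> ((**) A ^^ n) (mat 1)"

text \<open>Replacing the degree by any upper bound gives polynomials of different degrees a common
  range of summation.\<close>

lemma poly_matrix_nth:
  assumes "degree p \<le> N"
  shows "poly_matrix p A $ j $ k = (\<Sum>n\<le>N. coeff p n * matrix_power A n $ j $ k)"
proof -
  have "poly_matrix p A $ j $ k = (\<Sum>n\<le>degree p. coeff p n * matrix_power A n $ j $ k)"
    by (simp add: poly_matrix_def)
  also have "\<dots> = (\<Sum>n\<le>N. coeff p n * matrix_power A n $ j $ k)"
    using assms by (intro sum.mono_neutral_left) (auto simp: coeff_eq_0)
  finally show ?thesis .
qed

lemma poly_matrix_diff: "poly_matrix (p - q) A = poly_matrix p A - poly_matrix q A"
proof -
  define N where "N = max (degree p) (degree q)"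
  have "degree p \<le> N" "degree q \<le> N" "degree (p - q) \<le> N"
    by (auto simp: N_def degree_diff_le)
  then show ?thesis
    by (simp add: vec_eq_iff poly_matrix_nth[where N = N] left_diff_distrib sum_subtractf)
qed

text \<open>\<open>pCons 0\<close> is multiplication by the variable. It becomes multiplication by
  \<open>A\<close> on the left, the side on which \<open>matrix_power\<close> is built.\<close>

lemma poly_matrix_pCons_0: "poly_matrix (pCons 0 p) A = A ** poly_matrix p A"
proof -
  have "poly_matrix (pCons 0 p) A $ j $ k = (A ** poly_matrix p A) $ j $ k" for j k
  proof -
    have "poly_matrix (pCons 0 p) A $ j $ k =
      (\<Sum>n\<le>Suc (degree p). coeff (pCons 0 p) n * matrix_power A n $ j $ k)"
      by (rule poly_matrix_nth) (rule degree_pCons_le)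
    also have "\<dots> = (\<Sum>n\<le>degree p. coeff p n * (A ** matrix_power A n) $ j $ k)"
      by (subst sum.atMost_Suc_shift) simp
    also have "\<dots> = (\<Sum>n\<le>degree p. \<Sum>l\<in>UNIV. A $ j $ l * (coeff p n * matrix_power A n $ l $ k))"
      by (simp add: matrix_matrix_mult_def sum_distrib_left mult_ac)
    also have "\<dots> = (\<Sum>l\<in>UNIV. A $ j $ l * (\<Sum>n\<le>degree p. coeff p n * matrix_power A n $ l $ k))"
      by (subst sum.swap) (simp add: sum_distrib_left)
    also have "\<dots> = (A ** poly_matrix p A) $ j $ k"
      by (simp add: matrix_matrix_mult_def poly_matrix_nth[OF order_refl])
    finally show ?thesis .
  qed
  then show ?thesis by (simp add: vec_eq_iff)
qed

lemma poly_matrix_1: "poly_matrix 1 A = mat 1"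
  by (simp add: poly_matrix_def vec_eq_iff)

lemma poly_matrix_0: "poly_matrix 0 A = 0"
  by (simp add: poly_matrix_def vec_eq_iff)

lemma poly_matrix_cheb_U_Suc:
  "poly_matrix (cheb_U (int (Suc t))) A = A ** poly_matrix (cheb_U (int t)) A - poly_matrix (cheb_U (int t - 1)) A"
proof -
  have "cheb_U (int (Suc t)) = pCons 0 (cheb_U (int t)) - cheb_U (int t - 1)"
    by (subst cheb_U.simps) simp
  then show ?thesis by (simp add: poly_matrix_diff poly_matrix_pCons_0)
qed

text \<open>Both sides obey the same recursion of order two, so the induction carries two
  consecutive values. In the base case the polynomial 0 at index -1 matches the absence of equations
  in step 1.\<close>

lemma (in chebyshev) column_cheb_U:
  assumes ne: "\<And>s. V s \<noteq> {}"
  shows "poly_matrix (cheb_U (int t)) (adjacency_matrix G) $ k $ i = int (card (Vl t k))"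
proof -
  let ?A = "adjacency_matrix G"
  have mult: "(?A ** M) $ k $ i = (\<Sum>j\<in>UNIV. if (k, j) \<in> parcs G then M $ j $ i else 0)" for M k
    by (simp add: matrix_matrix_mult_def adjacency_matrix_def if_distrib[of "\<lambda>a. a * _"] cong: if_cong)
  have "(\<forall>k. poly_matrix (cheb_U (int t)) ?A $ k $ i = int (card (Vl t k))) \<and>
    (\<forall>k. poly_matrix (cheb_U (int (Suc t))) ?A $ k $ i = int (card (Vl (Suc t) k)))"
  proof (induction t)
    case 0
    have U0: "cheb_U 0 = 1" "cheb_U (- 1) = 0" by (simp_all add: cheb_U.simps)
    have base: "poly_matrix (cheb_U (int 0)) ?A $ k $ i = int (card (Vl 0 k))" for k
      by (simp add: U0 poly_matrix_1 mat_def card_level_0)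
    have "poly_matrix (cheb_U (int (Suc 0))) ?A $ k $ i = int (card (Vl (Suc 0) k))" for k
      unfolding poly_matrix_cheb_U_Suc vector_minus_component mult base card_level_1 card_arcs_level
      by (simp add: U0 poly_matrix_0 if_distrib cong: if_cong)
    then show ?case using base by blast
  next
    case (Suc t)
    have "poly_matrix (cheb_U (int (Suc (Suc t)))) ?A $ k $ i = int (card (Vl (Suc (Suc t)) k))" for k
    proof -
      have "poly_matrix (cheb_U (int (Suc (Suc t)))) ?A $ k $ i =
        (\<Sum>j\<in>UNIV. if (k, j) \<in> parcs G then int (card (Vl (Suc t) j)) else 0) - int (card (Vl t k))"
        unfolding poly_matrix_cheb_U_Suc[of "Suc t"] vector_minus_component mult using Suc.IH
        by (simp cong: if_cong)
      also have "(\<Sum>j\<in>UNIV. if (k, j) \<in> parcs G then int (card (Vl (Suc t) j)) else 0) =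
        int (card {x \<in> V (Suc t). (lab x, k) \<in> parcs G})"
        unfolding card_arcs_level by (simp add: if_distrib cong: if_cong)
      finally show ?thesis using card_level_Suc_Suc[OF ne, of t k] by simp
    qed
    then show ?case using Suc.IH by blast
  qed
  then show ?thesis by blast
qed

section \<open>The resolution\<close>

locale chebyshev_resolution = chebyshev G i R + ZA: zigzag G "TYPE('k)"
  for G :: "'v::finite pair_pre_digraph" and i :: 'v and R :: "('w, 'v, 'k::field) resolution_graph" +
  assumes level_nonempty: "V s \<noteq> {}"
begin

abbreviation A :: "('v list \<Rightarrow> 'k) set gring" where "A \<equiv> ZA.A"

section \<open>Vertex idempotents and the modules of the complex in coordinates\<close>

definition eP :: "'v \<Rightarrow> ('v list \<Rightarrow> 'k) set" where
  "eP k = zigzag_class G (scaled_path 1 [k])"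

lemma eP_carrier: "eP k \<in> carrier A"
  unfolding eP_def by (rule ZA.path_1_carrier)

lemma coords_eP: "ZA.cE (eP k) v = (if v = k then 1 else 0)" "ZA.cB (eP k) u v = 0" "ZA.cX (eP k) v = 0"
  by (simp_all add: eP_def ZA.coords_path_1)

lemma coords_mult_eP:
  assumes "a \<in> carrier A"
  shows "ZA.cE (a \<otimes>\<^bsub>A\<^esub> eP k) v = (if v = k then ZA.cE a v else 0)"
    "ZA.cB (a \<otimes>\<^bsub>A\<^esub> eP k) u v = (if v = k then ZA.cB a u v else 0)"
    "ZA.cX (a \<otimes>\<^bsub>A\<^esub> eP k) v = (if v = k then ZA.cX a v else 0)"
  by (simp_all add: ZA.coords_mult assms eP_carrier coords_eP)

lemma mult_eP_iff:
  assumes a: "a \<in> carrier A"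
  shows "a \<otimes>\<^bsub>A\<^esub> eP k = a \<longleftrightarrow> (\<forall>v. v \<noteq> k \<longrightarrow> ZA.cE a v = 0 \<and> (\<forall>u. ZA.cB a u v = 0) \<and> ZA.cX a v = 0)"
proof
  assume eq: "a \<otimes>\<^bsub>A\<^esub> eP k = a"
  show "\<forall>v. v \<noteq> k \<longrightarrow> ZA.cE a v = 0 \<and> (\<forall>u. ZA.cB a u v = 0) \<and> ZA.cX a v = 0"
    using coords_mult_eP[OF a, of k] unfolding eq by (metis (full_types))
next
  assume "\<forall>v. v \<noteq> k \<longrightarrow> ZA.cE a v = 0 \<and> (\<forall>u. ZA.cB a u v = 0) \<and> ZA.cX a v = 0"
  then show "a \<otimes>\<^bsub>A\<^esub> eP k = a"
    by (intro ZA.coords_eqI) (simp_all add: a eP_carrier coords_mult_eP)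
qed

lemma eP_comp: "eP k \<in> gr_comp A 0"
  by (simp add: ZA.A_comp eP_carrier coords_eP)

lemma eP_idem: "eP k \<otimes>\<^bsub>A\<^esub> eP k = eP k"
  by (simp add: mult_eP_iff eP_carrier coords_eP)

lemma eP_eq_iff: "eP k = eP l \<longleftrightarrow> k = l"
proof
  assume "eP k = eP l"
  then have "ZA.cE (eP k) k = ZA.cE (eP l) k" by simp
  then show "k = l" by (simp add: coords_eP split: if_splits)
qed simp

text \<open>In degree 0 only the idempotent coordinate at \<open>k\<close> survives, so
  \<open>a\<close> is a nonzero multiple of the idempotent and the inverse scalar works.\<close>

lemma eP_local:
  assumes a: "a \<in> gr_comp A 0" and ak: "a \<otimes>\<^bsub>A\<^esub> eP k = a" and nz: "a \<noteq> \<zero>\<^bsub>A\<^esub>"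
  shows "\<exists>b\<in>carrier A. b \<otimes>\<^bsub>A\<^esub> a = eP k"
proof -
  have ac: "a \<in> carrier A" and a0: "ZA.cB a u v = 0" "ZA.cX a v = 0" for u v
    using a by (simp_all add: ZA.A_comp)
  have other: "ZA.cE a v = 0" if "v \<noteq> k" for v using ak that mult_eP_iff[OF ac] by blast
  have "ZA.cE a k \<noteq> 0"
  proof
    assume "ZA.cE a k = 0"
    then have "ZA.cE a v = 0" for v using other by (cases "v = k") auto
    then have "a = \<zero>\<^bsub>A\<^esub>" using a0 ac by (intro ZA.coords_eqI) (simp_all add: ZA.coords_zero)
    then show False using nz by simp
  qed
  then have "zigzag_class G (scaled_path (inverse (ZA.cE a k)) [k]) \<otimes>\<^bsub>A\<^esub> a = eP k"
    using a0 other ac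
    by (intro ZA.coords_eqI) (simp_all add: ZA.coords_mult ZA.path_1_carrier ZA.coords_path_1 coords_eP eP_carrier)
  then show ?thesis using ZA.path_1_carrier by blast
qed

sublocale Q: local_idempotent_sum A "V t" "\<lambda>v. eP (lab v)" for t
proof
  show "graded_ring A" by (rule ZA.A_graded)
  show "finite (V t)" by (rule finite_level)
  fix v
  show "eP (lab v) \<in> gr_comp A 0" by (rule eP_comp)
  show "eP (lab v) \<otimes>\<^bsub>A\<^esub> eP (lab v) = eP (lab v)" by (rule eP_idem)
  show "eP (lab v) \<noteq> \<zero>\<^bsub>A\<^esub>" using coords_eP(1)[of "lab v" "lab v"] ZA.coords_zero(1) by auto
  fix a assume "a \<in> gr_comp A 0" "a \<otimes>\<^bsub>A\<^esub> eP (lab v) = a" "a \<noteq> \<zero>\<^bsub>A\<^esub>"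
  then show "\<exists>b\<in>carrier A. b \<otimes>\<^bsub>A\<^esub> a = eP (lab v)" by (rule eP_local)
qed

lemma proj_module_cyclic: "proj_module G k = cyclic_module A (eP k)"
  by (simp add: proj_module_def cyclic_module_def eP_def Let_def)

abbreviation Qm :: "nat \<Rightarrow> (('v list \<Rightarrow> 'k) set, 'w \<Rightarrow> ('v list \<Rightarrow> 'k) set) gmodule" where
  "Qm t \<equiv> Q.M t"

lemma complex_module_eq: "complex_module G R = Qm"
  by (simp add: fun_eq_iff complex_module_def Q.M_def proj_module_cyclic)

lemma multiplicity: "has_multiplicity A (proj_module G k) (Qm t) (card (Vl t k))"
proof -
  have "has_multiplicity A (cyclic_module A (eP k)) (Qm t) (card {v \<in> V t. eP (lab v) = eP k})"
  proof (rule Q.has_multiplicity_card[OF eP_carrier eP_idem])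
    fix v a assume "eP (lab v) \<noteq> eP k" and a: "a \<in> gr_comp A 0" and ak: "a \<otimes>\<^bsub>A\<^esub> eP k = a"
    then have ne: "lab v \<noteq> k" by blast
    have ac: "a \<in> carrier A" and a0: "ZA.cB a u v = 0" "ZA.cX a v = 0" for u v
      using a by (simp_all add: ZA.A_comp)
    have "ZA.cE a w = 0" if "w \<noteq> k" for w using ak that mult_eP_iff[OF ac] by blast
    then show "eP (lab v) \<otimes>\<^bsub>A\<^esub> a = \<zero>\<^bsub>A\<^esub>"
      using ne a0 ac
      by (intro ZA.coords_eqI) (auto simp: ZA.coords_mult eP_carrier coords_eP ZA.coords_zero)
  qed
  then show ?thesis by (simp add: proj_module_cyclic eP_eq_iff)
qed

lemma Q_coords:
  assumes "q \<in> carrier (Qm t)" and "x \<in> V t" and "v \<noteq> lab x"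
  shows "ZA.cE (q x) v = 0" and "ZA.cB (q x) u v = 0" and "ZA.cX (q x) v = 0"
  using mult_eP_iff[OF Q.M_mem[OF assms(1,2)], of "lab x"] Q.M_idem[OF assms(1,2)] assms(3) by blast+

lemma Q_eqI:
  assumes p: "p \<in> carrier (Qm t)" and q: "q \<in> carrier (Qm t)"
    and "\<And>x. x \<in> V t \<Longrightarrow> ZA.cE (p x) (lab x) = ZA.cE (q x) (lab x)"
    and "\<And>x u. x \<in> V t \<Longrightarrow> ZA.cB (p x) u (lab x) = ZA.cB (q x) u (lab x)"
    and "\<And>x. x \<in> V t \<Longrightarrow> ZA.cX (p x) (lab x) = ZA.cX (q x) (lab x)"
  shows "p = q"
proof (rule Q.M_eqI[OF p q])
  fix x assume x: "x \<in> V t"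
  show "p x = q x"
  proof (rule ZA.coords_eqI[OF Q.M_mem[OF p x] Q.M_mem[OF q x]])
    show "ZA.cE (p x) v = ZA.cE (q x) v" for v
      using Q_coords(1)[OF p x, of v] Q_coords(1)[OF q x, of v] assms(3)[OF x] by (cases "v = lab x") auto
    show "ZA.cB (p x) u v = ZA.cB (q x) u v" for u v
      using Q_coords(2)[OF p x, of v u] Q_coords(2)[OF q x, of v u] assms(4)[OF x] by (cases "v = lab x") auto
    show "ZA.cX (p x) v = ZA.cX (q x) v" for v
      using Q_coords(3)[OF p x, of v] Q_coords(3)[OF q x, of v] assms(5)[OF x] by (cases "v = lab x") auto
  qed
qed

text \<open>Used for preimages under the differential, which kills loops; hence the loop coordinates
  are set to 0.\<close>

definition mkQ :: "nat \<Rightarrow> ('w \<Rightarrow> 'k) \<Rightarrow> ('w \<Rightarrow> 'v \<Rightarrow> 'k) \<Rightarrow> 'w \<Rightarrow> ('v list \<Rightarrow> 'k) set" where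
  "mkQ t \<alpha> \<beta> = (\<lambda>x\<in>V t. ZA.mk (\<lambda>v. if v = lab x then \<alpha> x else 0) (\<lambda>u v. if v = lab x then \<beta> x u else 0) (\<lambda>v. 0))"

lemma mkQ_carrier: "mkQ t \<alpha> \<beta> \<in> carrier (Qm t)"
  by (auto simp: Q.M_carrier mkQ_def ZA.mk_carrier mult_eP_iff ZA.coords_mk)

lemma coords_mkQ:
  assumes "x \<in> V t"
  shows "ZA.cE (mkQ t \<alpha> \<beta> x) (lab x) = \<alpha> x"
    and "ZA.cB (mkQ t \<alpha> \<beta> x) u (lab x) = (if (u, lab x) \<in> parcs G then \<beta> x u else 0)"
  using assms by (simp_all add: mkQ_def ZA.coords_mk)

subsection \<open>The differential in coordinates\<close>

abbreviation d :: "nat \<Rightarrow> ('w \<Rightarrow> ('v list \<Rightarrow> 'k) set) \<Rightarrow> 'w \<Rightarrow> ('v list \<Rightarrow> 'k) set" where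
  "d \<equiv> complex_map G R"

definition step_arrow :: "'w \<Rightarrow> 'w \<Rightarrow> ('v list \<Rightarrow> 'k) set" where
  "step_arrow x y = zigzag_class G (scaled_path (elabel R x y) [lab x, lab y])"

definition preds :: "nat \<Rightarrow> 'w \<Rightarrow> 'w set" where
  "preds t y = {x \<in> V (Suc t). (x, y) \<in> edges R (Suc t)}"

lemma finite_preds: "finite (preds t y)"
  using finite_level by (simp add: preds_def)

lemma d_eq: "y \<in> V t \<Longrightarrow> d t q y = finsum A (\<lambda>x. q x \<otimes>\<^bsub>A\<^esub> step_arrow x y) (preds t y)"
  by (simp add: complex_map_def step_arrow_def preds_def)

lemma step_arrow_carrier: "x \<in> preds t y \<Longrightarrow> step_arrow x y \<in> carrier A"
  unfolding step_arrow_def by (rule ZA.path_2_carrier) (use edge_arc in \<open>auto simp: preds_def\<close>)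

text \<open>An arrow raises path length by one. In the last formula it closes a path
  \<open>v, lab x\<close> to a loop, which requires \<open>v = lab y\<close>.\<close>

lemma coords_mult_arrow:
  assumes a: "a \<in> carrier A" and x: "x \<in> preds t y"
  shows "ZA.cE (a \<otimes>\<^bsub>A\<^esub> step_arrow x y) v = 0"
    and "ZA.cB (a \<otimes>\<^bsub>A\<^esub> step_arrow x y) u v = (if u = lab x \<and> v = lab y then ZA.cE a u * Z t x y else 0)"
    and "ZA.cX (a \<otimes>\<^bsub>A\<^esub> step_arrow x y) v = (if v = lab y then ZA.cB a v (lab x) * Z t x y else 0)"
proof -
  have arc: "(lab x, lab y) \<in> parcs G" using x edge_arc by (auto simp: preds_def)
  have Zxy: "Z t x y = elabel R x y" using x by (simp add: preds_def out_labels_def)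
  note c = ZA.coords_mult[OF a step_arrow_carrier[OF x]]
  note s = ZA.coords_path_2[OF arc, of "elabel R x y", folded step_arrow_def]
  show "ZA.cE (a \<otimes>\<^bsub>A\<^esub> step_arrow x y) v = 0" by (simp add: c s)
  show "ZA.cB (a \<otimes>\<^bsub>A\<^esub> step_arrow x y) u v = (if u = lab x \<and> v = lab y then ZA.cE a u * Z t x y else 0)"
    by (simp add: c s Zxy)
  have "(\<Sum>u\<in>UNIV. ZA.cB a v u * (if u = lab x \<and> v = lab y then elabel R x y else 0)) =
    (\<Sum>u\<in>UNIV. if u = lab x then (if v = lab y then ZA.cB a v (lab x) * elabel R x y else 0) else 0)"
    by (intro sum.cong) auto
  then show "ZA.cX (a \<otimes>\<^bsub>A\<^esub> step_arrow x y) v = (if v = lab y then ZA.cB a v (lab x) * Z t x y else 0)"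
    by (simp add: c s Zxy)
qed

text \<open>As \<open>Z t\<close> is 0 off the edges, the sum over predecessors becomes a product
  with the full matrix. Arrow coordinates starting at \<open>u\<close> see the rows labeled
  \<open>u\<close>, loop coordinates see all rows.\<close>

lemma coords_d:
  assumes q: "q \<in> carrier (Qm (Suc t))" and y: "y \<in> V t"
  shows d_carrier_mem: "d t q y \<in> carrier A" and cE_d: "ZA.cE (d t q y) v = 0"
    and cB_d: "ZA.cB (d t q y) u v = (if v = lab y then (\<Sum>x\<in>Vl (Suc t) u. ZA.cE (q x) u * Z t x y) else 0)"
    and cX_d: "ZA.cX (d t q y) v = (if v = lab y then (\<Sum>x\<in>V (Suc t). ZA.cB (q x) v (lab x) * Z t x y) else 0)"
proof -
  have qc: "q x \<in> carrier A" if "x \<in> preds t y" for x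
    using Q.M_mem[OF q] that by (simp add: preds_def)
  have mc: "q x \<otimes>\<^bsub>A\<^esub> step_arrow x y \<in> carrier A" if "x \<in> preds t y" for x
    using qc[OF that] step_arrow_carrier[OF that] by (rule ZA.A.m_closed)
  show "d t q y \<in> carrier A" unfolding d_eq[OF y] using mc by (intro ZA.A.finsum_closed) auto
  note fs = ZA.coords_finsum[OF mc finite_preds]
  show "ZA.cE (d t q y) v = 0" unfolding d_eq[OF y] by (simp add: fs qc coords_mult_arrow)
  have Z0: "Z t x y = 0" if "x \<notin> preds t y" "x \<in> V (Suc t)" for x
    using that by (auto simp: preds_def out_labels_def)
  have sub: "preds t y \<subseteq> V (Suc t)" by (auto simp: preds_def)
  have "ZA.cB (d t q y) u v = (\<Sum>x\<in>preds t y. if u = lab x \<and> v = lab y then ZA.cE (q x) u * Z t x y else 0)"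
    unfolding d_eq[OF y] by (simp add: fs qc coords_mult_arrow)
  also have "\<dots> = (\<Sum>x\<in>V (Suc t). if u = lab x \<and> v = lab y then ZA.cE (q x) u * Z t x y else 0)"
    by (rule sum.mono_neutral_left[OF finite_level sub]) (simp add: Z0)
  also have "\<dots> = (if v = lab y then (\<Sum>x\<in>Vl (Suc t) u. ZA.cE (q x) u * Z t x y) else 0)"
    by (cases "v = lab y") (auto simp: sum.inter_filter finite_level intro!: sum.cong)
  finally show "ZA.cB (d t q y) u v = (if v = lab y then (\<Sum>x\<in>Vl (Suc t) u. ZA.cE (q x) u * Z t x y) else 0)" .
  have "ZA.cX (d t q y) v = (\<Sum>x\<in>preds t y. if v = lab y then ZA.cB (q x) v (lab x) * Z t x y else 0)"
    unfolding d_eq[OF y] by (simp add: fs qc coords_mult_arrow)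
  also have "\<dots> = (\<Sum>x\<in>V (Suc t). if v = lab y then ZA.cB (q x) v (lab x) * Z t x y else 0)"
    by (rule sum.mono_neutral_left[OF finite_level sub]) (simp add: Z0)
  finally show "ZA.cX (d t q y) v = (if v = lab y then (\<Sum>x\<in>V (Suc t). ZA.cB (q x) v (lab x) * Z t x y) else 0)"
    by auto
qed

lemma d_carrier: "q \<in> carrier (Qm (Suc t)) \<Longrightarrow> d t q \<in> carrier (Qm t)"
  using d_carrier_mem cE_d cB_d cX_d
  by (auto simp: Q.M_carrier mult_eP_iff) (simp add: complex_map_def)

lemma d_hom: "d t \<in> graded_hom A (gshift (int (Suc t)) (Qm (Suc t))) (gshift (int t) (Qm t))"
  unfolding graded_hom_def mem_Collect_eq
proof (intro conjI ballI allI)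
  show "d t \<in> carrier (gshift (int (Suc t)) (Qm (Suc t))) \<rightarrow> carrier (gshift (int t) (Qm t))"
    using d_carrier by auto
next
  fix p q assume "p \<in> carrier (gshift (int (Suc t)) (Qm (Suc t)))" "q \<in> carrier (gshift (int (Suc t)) (Qm (Suc t)))"
  then have p: "p \<in> carrier (Qm (Suc t))" and q: "q \<in> carrier (Qm (Suc t))" by simp_all
  have pq: "p \<oplus>\<^bsub>Qm (Suc t)\<^esub> q \<in> carrier (Qm (Suc t))" using p q by (rule Q.M.a_closed)
  have "d t (p \<oplus>\<^bsub>Qm (Suc t)\<^esub> q) = d t p \<oplus>\<^bsub>Qm t\<^esub> d t q"
  proof (rule Q_eqI)
    show "d t (p \<oplus>\<^bsub>Qm (Suc t)\<^esub> q) \<in> carrier (Qm t)" by (rule d_carrier[OF pq])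
    show "d t p \<oplus>\<^bsub>Qm t\<^esub> d t q \<in> carrier (Qm t)" using d_carrier[OF p] d_carrier[OF q] by (rule Q.M.a_closed)
    fix x assume x: "x \<in> V t"
    have c: "(d t p \<oplus>\<^bsub>Qm t\<^esub> d t q) x = d t p x \<oplus>\<^bsub>A\<^esub> d t q x" using x by (simp add: Q.M_add)
    note add = ZA.coords_add[OF d_carrier_mem[OF p x] d_carrier_mem[OF q x]]
    have pw: "(p \<oplus>\<^bsub>Qm (Suc t)\<^esub> q) w = p w \<oplus>\<^bsub>A\<^esub> q w" "p w \<in> carrier A" "q w \<in> carrier A" if "w \<in> V (Suc t)" for w
      using that Q.M_mem[OF p] Q.M_mem[OF q] by (simp_all add: Q.M_add)
    show "ZA.cE (d t (p \<oplus>\<^bsub>Qm (Suc t)\<^esub> q) x) (lab x) = ZA.cE ((d t p \<oplus>\<^bsub>Qm t\<^esub> d t q) x) (lab x)"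
      unfolding c add cE_d[OF pq x] cE_d[OF p x] cE_d[OF q x] by simp
    show "ZA.cB (d t (p \<oplus>\<^bsub>Qm (Suc t)\<^esub> q) x) u (lab x) = ZA.cB ((d t p \<oplus>\<^bsub>Qm t\<^esub> d t q) x) u (lab x)" for u
      unfolding c add cB_d[OF pq x] cB_d[OF p x] cB_d[OF q x]
      by (simp add: sum.distrib[symmetric] pw ZA.coords_add distrib_right)
    show "ZA.cX (d t (p \<oplus>\<^bsub>Qm (Suc t)\<^esub> q) x) (lab x) = ZA.cX ((d t p \<oplus>\<^bsub>Qm t\<^esub> d t q) x) (lab x)"
      unfolding c add cX_d[OF pq x] cX_d[OF p x] cX_d[OF q x]
      by (simp add: sum.distrib[symmetric] pw ZA.coords_add distrib_right)
  qed
  then show "d t (p \<oplus>\<^bsub>gshift (int (Suc t)) (Qm (Suc t))\<^esub> q) = d t p \<oplus>\<^bsub>gshift (int t) (Qm t)\<^esub> d t q" by simp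
next
  fix a q assume a: "a \<in> carrier A" and "q \<in> carrier (gshift (int (Suc t)) (Qm (Suc t)))"
  then have q: "q \<in> carrier (Qm (Suc t))" by simp
  have aq: "a \<odot>\<^bsub>Qm (Suc t)\<^esub> q \<in> carrier (Qm (Suc t))" using a q by (rule Q.M.smult_closed)
  have "d t (a \<odot>\<^bsub>Qm (Suc t)\<^esub> q) = a \<odot>\<^bsub>Qm t\<^esub> d t q"
  proof (rule Q.M_eqI[OF d_carrier[OF aq] Q.M.smult_closed[OF a d_carrier[OF q]]])
    fix y assume y: "y \<in> V t"
    have qc: "q x \<in> carrier A" and qa: "(a \<odot>\<^bsub>Qm (Suc t)\<^esub> q) x = a \<otimes>\<^bsub>A\<^esub> q x" if "x \<in> preds t y" for x
      using Q.M_mem[OF q] that by (simp_all add: preds_def Q.M_smult)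
    have "d t (a \<odot>\<^bsub>Qm (Suc t)\<^esub> q) y = finsum A (\<lambda>x. a \<otimes>\<^bsub>A\<^esub> (q x \<otimes>\<^bsub>A\<^esub> step_arrow x y)) (preds t y)"
      unfolding d_eq[OF y] using a qc qa step_arrow_carrier
      by (intro ZA.A.finsum_cong') (auto simp: ZA.A.m_assoc)
    also have "\<dots> = a \<otimes>\<^bsub>A\<^esub> finsum A (\<lambda>x. q x \<otimes>\<^bsub>A\<^esub> step_arrow x y) (preds t y)"
      using qc step_arrow_carrier by (intro ZA.A.finsum_rdistr[symmetric] finite_preds a) auto
    finally show "d t (a \<odot>\<^bsub>Qm (Suc t)\<^esub> q) y = (a \<odot>\<^bsub>Qm t\<^esub> d t q) y"
      using y by (simp add: Q.M_smult d_eq)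
  qed
  then show "d t (a \<odot>\<^bsub>gshift (int (Suc t)) (Qm (Suc t))\<^esub> q) = a \<odot>\<^bsub>gshift (int t) (Qm t)\<^esub> d t q" by simp
next
  fix n
  show "d t ` gm_comp (gshift (int (Suc t)) (Qm (Suc t))) n \<subseteq> gm_comp (gshift (int t) (Qm t)) n"
  proof (rule image_subsetI)
    fix q assume q: "q \<in> gm_comp (gshift (int (Suc t)) (Qm (Suc t))) n"
    define m where "m = n - int (Suc t)"
    have nt: "n - int t = m + 1" by (simp add: m_def)
    have qc: "q \<in> carrier (Qm (Suc t))" and qm: "\<And>x. x \<in> V (Suc t) \<Longrightarrow> q x \<in> gr_comp A m"
      using q by (simp_all add: Q.M_comp m_def)
    have "d t q y \<in> gr_comp A (m + 1)" if y: "y \<in> V t" for y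
      unfolding ZA.A_comp cE_d[OF qc y] cB_d[OF qc y] cX_d[OF qc y]
      using d_carrier_mem[OF qc y] qm by (auto simp: ZA.A_comp intro!: sum.neutral)
    then show "d t q \<in> gm_comp (gshift (int t) (Qm t)) n"
      using d_carrier[OF qc] by (simp add: Q.M_comp nt)
  qed
qed

subsection \<open>Exactness\<close>

text \<open>The common description of kernels and images. Loop coordinates are free. For
  \<open>t = 0\<close> only the first condition remains, and it describes the kernel of the
  augmentation.\<close>

definition cycle :: "nat \<Rightarrow> ('w \<Rightarrow> ('v list \<Rightarrow> 'k) set) \<Rightarrow> bool" where
  "cycle t q \<longleftrightarrow> (\<forall>x\<in>V t. ZA.cE (q x) (lab x) = 0) \<and>
    (\<forall>s k. t = Suc s \<longrightarrow> (\<forall>y\<in>Vl s k. (\<Sum>x\<in>V t. ZA.cB (q x) k (lab x) * Z s x y) = 0))"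

text \<open>Vanishing arrow coordinates of \<open>d t q\<close> are relations among rows with a
  fixed label, so row independence kills the idempotent coordinates of \<open>q\<close>. The loop
  coordinates give the remaining equations directly.\<close>

lemma kernel_iff_cycle:
  assumes q: "q \<in> carrier (Qm (Suc t))"
  shows "d t q = \<zero>\<^bsub>Qm t\<^esub> \<longleftrightarrow> cycle (Suc t) q"
proof
  assume zero: "d t q = \<zero>\<^bsub>Qm t\<^esub>"
  then have dy: "d t q y = \<zero>\<^bsub>A\<^esub>" if "y \<in> V t" for y using that by (simp add: Q.M_zero)
  have "ZA.cE (q x) (lab x) = 0" if x: "x \<in> V (Suc t)" for x
  proof -
    have "(\<Sum>x'\<in>Vl (Suc t) (lab x). ZA.cE (q x') (lab x) * Z t x' y) = 0" if y: "y \<in> V t" for y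
      using cB_d[OF q y, of "lab x" "lab y"] dy[OF y] by (simp add: ZA.coords_zero)
    then show ?thesis
      using Z_rows_independent[where t = t and k = "lab x" and \<alpha> = "\<lambda>x'. ZA.cE (q x') (lab x)" and w = x] x
      by simp
  qed
  moreover have "(\<Sum>x\<in>V (Suc t). ZA.cB (q x) k (lab x) * Z t x y) = 0" if y: "y \<in> Vl t k" for k y
    using cX_d[OF q, of y k] y dy[of y] by (simp add: ZA.coords_zero)
  ultimately show "cycle (Suc t) q" by (simp add: cycle_def)
next
  assume cyc: "cycle (Suc t) q"
  show "d t q = \<zero>\<^bsub>Qm t\<^esub>"
  proof (rule Q_eqI[OF d_carrier[OF q] Q.M.zero_closed])
    fix y assume y: "y \<in> V t"
    show "ZA.cE (d t q y) (lab y) = ZA.cE (\<zero>\<^bsub>Qm t\<^esub> y) (lab y)"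
      using y by (simp add: cE_d[OF q y] Q.M_zero ZA.coords_zero)
    show "ZA.cB (d t q y) u (lab y) = ZA.cB (\<zero>\<^bsub>Qm t\<^esub> y) u (lab y)" for u
      using y cyc by (simp add: cB_d[OF q y] Q.M_zero ZA.coords_zero cycle_def) (rule sum.neutral, auto)
    show "ZA.cX (d t q y) (lab y) = ZA.cX (\<zero>\<^bsub>Qm t\<^esub> y) (lab y)"
      using y cyc by (simp add: cX_d[OF q y] Q.M_zero ZA.coords_zero cycle_def)
  qed
qed

text \<open>Images are cycles by \<open>ZZ_zero\<close>. Conversely, the arrow coordinates of a
  cycle are reached because the rows span, and its arbitrary loop coordinates because the columns
  are independent, which rests on nonempty levels.\<close>

lemma image_iff_cycle:
  assumes q: "q \<in> carrier (Qm t)"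
  shows "q \<in> d t ` carrier (Qm (Suc t)) \<longleftrightarrow> cycle t q"
proof
  assume "q \<in> d t ` carrier (Qm (Suc t))"
  then obtain p where p: "p \<in> carrier (Qm (Suc t))" and qp: "q = d t p" by blast
  have "(\<Sum>x\<in>V t. ZA.cB (q x) k (lab x) * Z s x y) = 0" if s: "t = Suc s" and y: "y \<in> Vl s k" for s k y
  proof -
    have "(\<Sum>x\<in>V t. ZA.cB (q x) k (lab x) * Z s x y) =
      (\<Sum>x\<in>V t. \<Sum>w\<in>Vl (Suc t) k. ZA.cE (p w) k * (Z t w x * Z s x y))"
      by (intro sum.cong refl) (simp add: qp cB_d[OF p] sum_distrib_right mult.assoc)
    also have "\<dots> = (\<Sum>w\<in>Vl (Suc t) k. ZA.cE (p w) k * (\<Sum>x\<in>V t. Z t w x * Z s x y))"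
      by (subst sum.swap) (simp add: sum_distrib_left)
    also have "\<dots> = 0"
      using ZZ_zero[of _ s y] s y by (intro sum.neutral) auto
    finally show ?thesis .
  qed
  then show "cycle t q" using cE_d[OF p] by (simp add: cycle_def qp)
next
  assume cyc: "cycle t q"
  have ex1: "\<exists>\<alpha>. \<forall>x\<in>V t. ZA.cB (q x) k (lab x) = (\<Sum>w\<in>Vl (Suc t) k. \<alpha> w * Z t w x)" for k
  proof -
    obtain \<alpha> where "\<And>x. x \<in> V t \<Longrightarrow> ZA.cB (q x) k (lab x) = (\<Sum>w\<in>Vl (Suc t) k. \<alpha> w * Z t w x)"
    proof (rule Z_rows_span[of t k "\<lambda>x. ZA.cB (q x) k (lab x)"])
      fix x assume "x \<in> V t" "(lab x, k) \<notin> parcs G"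
      then show "ZA.cB (q x) k (lab x) = 0"
        using ZA.cB_nonarc[OF Q.M_mem[OF q]] arcs_sym by blast
    next
      fix s y assume "t = Suc s" "y \<in> Vl s k"
      then show "(\<Sum>x\<in>V t. Z s x y * ZA.cB (q x) k (lab x)) = 0"
        using cyc by (auto simp: cycle_def mult.commute[of "Z s _ _"])
    qed blast
    then show ?thesis by blast
  qed
  have ex2: "\<exists>\<beta>. \<forall>x\<in>Vl t k. (\<Sum>w\<in>V (Suc t). Z t w x * \<beta> w) = ZA.cX (q x) k" for k
  proof -
    obtain \<beta> where "\<And>x. x \<in> Vl t k \<Longrightarrow> (\<Sum>w\<in>V (Suc t). Z t w x * \<beta> w) = ZA.cX (q x) k"
    proof (rule linear_system_solvable[OF finite_level[of "Suc t"] finite_Vl[of t k], of "\<lambda>x w. Z t w x" "\<lambda>x. ZA.cX (q x) k"])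
      fix c assume "\<And>w. w \<in> V (Suc t) \<Longrightarrow> (\<Sum>x\<in>Vl t k. c x * Z t w x) = 0"
      then show "\<forall>x\<in>Vl t k. c x = 0" using Z_columns_independent[OF level_nonempty, where t = t and k = k and c = c] by blast
    qed blast
    then show ?thesis by blast
  qed
  have "\<exists>\<alpha>. \<forall>k. \<forall>x\<in>V t. ZA.cB (q x) k (lab x) = (\<Sum>w\<in>Vl (Suc t) k. \<alpha> k w * Z t w x)"
    by (rule choice) (intro allI ex1)
  then obtain \<alpha> where \<alpha>: "\<And>k x. x \<in> V t \<Longrightarrow> ZA.cB (q x) k (lab x) = (\<Sum>w\<in>Vl (Suc t) k. \<alpha> k w * Z t w x)"
    by blast
  have "\<exists>\<beta>. \<forall>k. \<forall>x\<in>Vl t k. (\<Sum>w\<in>V (Suc t). Z t w x * \<beta> k w) = ZA.cX (q x) k"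
    by (rule choice) (intro allI ex2)
  then obtain \<beta> where \<beta>: "\<And>k x. x \<in> Vl t k \<Longrightarrow> (\<Sum>w\<in>V (Suc t). Z t w x * \<beta> k w) = ZA.cX (q x) k"
    by blast
  \<comment> \<open>Both solutions fit into one element: its idempotent coordinates
    \<open>\<alpha>\<close> determine the arrow coordinates of the image, its arrow coordinates
    \<open>\<beta>\<close> the loop coordinates.\<close>
  define p where "p = mkQ (Suc t) (\<lambda>w. \<alpha> (lab w) w) (\<lambda>w u. \<beta> u w)"
  have p: "p \<in> carrier (Qm (Suc t))" unfolding p_def by (rule mkQ_carrier)
  have "d t p = q"
  proof (rule Q_eqI[OF d_carrier[OF p] q])
    fix x assume x: "x \<in> V t"
    show "ZA.cE (d t p x) (lab x) = ZA.cE (q x) (lab x)"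
      using cyc x by (simp add: cE_d[OF p x] cycle_def)
    show "ZA.cB (d t p x) u (lab x) = ZA.cB (q x) u (lab x)" for u
      unfolding cB_d[OF p x] \<alpha>[OF x] by (auto simp: p_def coords_mkQ intro!: sum.cong)
    have "(\<Sum>w\<in>V (Suc t). ZA.cB (p w) (lab x) (lab w) * Z t w x) = (\<Sum>w\<in>V (Suc t). Z t w x * \<beta> (lab x) w)"
    proof (intro sum.cong refl)
      fix w assume w: "w \<in> V (Suc t)"
      \<comment> \<open>\<open>mkQ\<close> cuts \<open>\<beta>\<close> to 0 off the arcs, where
        \<open>Z t w x\<close> is 0 as well.\<close>
      show "ZA.cB (p w) (lab x) (lab w) * Z t w x = Z t w x * \<beta> (lab x) w"
        using Z_nonzero_arc[of t w x] arcs_sym[of "lab w" "lab x"] w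
        by (cases "Z t w x = 0") (auto simp: p_def coords_mkQ)
    qed
    then show "ZA.cX (d t p x) (lab x) = ZA.cX (q x) (lab x)"
      using \<beta>[of x "lab x"] x by (simp add: cX_d[OF p x])
  qed
  then show "q \<in> d t ` carrier (Qm (Suc t))" using p by blast
qed

lemma exact: "d (Suc t) ` carrier (Qm (Suc (Suc t))) = a_kernel (Qm (Suc t)) (Qm t) (d t)"
proof -
  have "d (Suc t) ` carrier (Qm (Suc (Suc t))) \<subseteq> carrier (Qm (Suc t))" using d_carrier by blast
  then show ?thesis unfolding a_kernel_def' using image_iff_cycle kernel_iff_cycle by blast
qed

subsection \<open>The augmentation\<close>

abbreviation L :: "(('v list \<Rightarrow> 'k) set, 'k) gmodule" where "L \<equiv> simple_module G i"
abbreviation \<epsilon> :: "('w \<Rightarrow> ('v list \<Rightarrow> 'k) set) \<Rightarrow> 'k" where "\<epsilon> \<equiv> augmentation G i R"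

text \<open>The scalar by which an element acts is by definition its coordinate \<open>cE\<close> at
  \<open>i\<close>; the module laws then follow from \<open>coords_add\<close> and
  \<open>coords_mult\<close>.\<close>

lemma L_simps: "carrier L = UNIV" "\<zero>\<^bsub>L\<^esub> = 0" "x \<oplus>\<^bsub>L\<^esub> y = x + y" "a \<odot>\<^bsub>L\<^esub> x = ZA.cE a i * x"
  "gm_comp L n = (if n = 0 then UNIV else {0})"
  by (simp_all add: simple_module_def ZA.cE_def)

lemma L_abelian_group: "abelian_group L"
  by (rule abelian_groupI) (auto simp: L_simps add_ac intro: exI[of _ "- _"])

lemma L_left_module: "left_module A L"
proof -
  interpret L: abelian_group L by (rule L_abelian_group)
  have "ZA.cE \<one>\<^bsub>A\<^esub> i = 1" using ZA.cE_cl[OF ZA.PA.one_closed, of i]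
    by (simp add: ZA.A_one) (simp add: path_one pverts_UNIV)
  then show ?thesis
    by unfold_locales (auto simp: L_simps ZA.coords_add ZA.coords_mult algebra_simps)
qed

lemma L_graded: "graded_module A L"
proof -
  interpret L: abelian_group L by (rule L_abelian_group)
  have one: "finsum L c {n} = c n" for c and n :: int by (simp add: L_simps)
  have inv: "inv\<^bsub>add_monoid L\<^esub> x = - x" for x
    using L.minus_equality[of "- x" x] unfolding a_inv_def by (simp only: L_simps) simp
  have "graded_by L (gm_comp L)"
  proof (rule graded_byI[OF L_abelian_group, of _ "\<lambda>x n. if n = 0 then x else 0"])
    fix n
    show "subgroup (gm_comp L n) (add_monoid L)"
    proof (rule subgroup.intro)
      fix x assume "x \<in> gm_comp L n"
      then show "inv\<^bsub>add_monoid L\<^esub> x \<in> gm_comp L n" unfolding inv by (simp add: L_simps split: if_splits)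
    qed (auto simp: L_simps)
  next
    fix x
    have "x = finsum L (\<lambda>n. if n = 0 then x else 0) {0 :: int}" by (subst one) simp
    then show "\<exists>S. finite S \<and> (\<forall>n. (if n = 0 then x else 0) \<in> gm_comp L n) \<and>
      (\<forall>n. n \<notin> S \<longrightarrow> (if n = 0 then x else 0) = \<zero>\<^bsub>L\<^esub>) \<and> x = finsum L (\<lambda>n. if n = 0 then x else 0) S"
      by (intro exI[of _ "{0}"] conjI) (auto simp: L_simps)
  next
    fix c and S :: "int set"
    assume S: "finite S" and c: "\<And>n. c n \<in> gm_comp L n" and z: "\<And>n. n \<notin> S \<Longrightarrow> c n = \<zero>\<^bsub>L\<^esub>"
    have c0: "c n = 0" if "n \<noteq> 0" for n using c[of n] that by (simp add: L_simps)
    have "finsum L c S = finsum L c (insert 0 S)"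
      using S z by (intro L.add.finprod_mono_neutral_cong_left) (auto simp: L_simps)
    also have "\<dots> = finsum L c {0}"
      using S c0 by (intro L.add.finprod_mono_neutral_cong_left[symmetric]) (auto simp: L_simps)
    finally have "finsum L c S = c 0" by (simp add: one)
    then show "(\<lambda>n. if n = 0 then finsum L c S else 0) = c" using c0 by auto
  qed
  moreover have "a \<odot>\<^bsub>L\<^esub> x \<in> gm_comp L (m + n)" if "a \<in> gr_comp A m" "x \<in> gm_comp L n" for a x m n
    using that by (cases "n = 0") (auto simp: L_simps ZA.A_comp)
  ultimately show ?thesis using ZA.A_graded L_left_module by (simp add: graded_module_def)
qed

context
  fixes v assumes v: "V 0 = {v}" "lab v = i"
begin

lemma augmentation_eq: "\<epsilon> q = ZA.cE (q v) i"
  by (simp add: augmentation_def v L_simps)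

lemma augmentation_hom: "\<epsilon> \<in> graded_hom A (Qm 0) L"
  unfolding graded_hom_def mem_Collect_eq augmentation_eq
proof (intro conjI ballI allI)
  have v0: "v \<in> V 0" using v by simp
  fix p assume p: "p \<in> carrier (Qm 0)"
  note pv = Q.M_mem[OF p v0]
  show "ZA.cE ((a \<odot>\<^bsub>Qm 0\<^esub> p) v) i = a \<odot>\<^bsub>L\<^esub> ZA.cE (p v) i" if "a \<in> carrier A" for a
    unfolding Q.M_smult restrict_apply'[OF v0] ZA.coords_mult[OF that pv] by (simp add: L_simps)
  fix q assume "q \<in> carrier (Qm 0)"
  then show "ZA.cE ((p \<oplus>\<^bsub>Qm 0\<^esub> q) v) i = ZA.cE (p v) i \<oplus>\<^bsub>L\<^esub> ZA.cE (q v) i"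
    unfolding Q.M_add restrict_apply'[OF v0] using ZA.coords_add[OF pv Q.M_mem[OF _ v0]] by (simp add: L_simps)
next
  fix n
  have "q v \<in> gr_comp A n" if "q \<in> gm_comp (Qm 0) n" for q
    using that v unfolding Q.M_comp by blast
  then show "(\<lambda>q. ZA.cE (q v) i) ` gm_comp (Qm 0) n \<subseteq> gm_comp L n"
    by (auto simp: L_simps ZA.A_comp)
qed (simp add: L_simps)

lemma augmentation_surj: "\<epsilon> ` carrier (Qm 0) = carrier L"
proof -
  have "x \<in> \<epsilon> ` carrier (Qm 0)" for x
  proof (rule image_eqI[OF _ mkQ_carrier[of 0 "\<lambda>_. x" "\<lambda>_ _. 0"]])
    have "v \<in> V 0" using v by simp
    from coords_mkQ(1)[OF this] show "x = \<epsilon> (mkQ 0 (\<lambda>_. x) (\<lambda>_ _. 0))"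
      by (simp add: augmentation_eq v)
  qed
  then show ?thesis by (auto simp: L_simps)
qed

lemma exact_0: "d 0 ` carrier (Qm (Suc 0)) = a_kernel (Qm 0) L \<epsilon>"
proof -
  have "d 0 ` carrier (Qm (Suc 0)) \<subseteq> carrier (Qm 0)" using d_carrier by blast
  moreover have "cycle 0 q \<longleftrightarrow> \<epsilon> q = \<zero>\<^bsub>L\<^esub>" for q by (simp add: cycle_def v augmentation_eq L_simps)
  ultimately show ?thesis unfolding a_kernel_def' using image_iff_cycle by blast
qed

lemma resolution: "linear_projective_resolution TYPE('m) TYPE('n) A L Qm d \<epsilon>"
  unfolding linear_projective_resolution_def One_nat_def
  by (intro conjI allI L_graded Q.M_projective Q.M_generated d_hom augmentation_hom augmentation_surj exact_0 exact)

text \<open>An element of degree 0 has only idempotent coordinates, and these vanish on cycles,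
  whereas an indecomposable summand has a nonzero element of degree 0.\<close>

lemma summand_not_cycles:
  assumes N: "indecomposable_summand A (Qm t) N"
  shows "\<not> (\<forall>q\<in>N. cycle t q)"
proof
  assume cyc: "\<forall>q\<in>N. cycle t q"
  obtain q where q: "q \<in> N" "q \<in> gm_comp (Qm t) 0" "q \<noteq> \<zero>\<^bsub>Qm t\<^esub>"
    by (rule Q.indecomposable_summand_degree_0[OF N])
  have qc: "q \<in> carrier (Qm t)" using q(2) by (simp add: Q.M_comp)
  have "q = \<zero>\<^bsub>Qm t\<^esub>"
  proof (rule Q_eqI[OF qc Q.M.zero_closed])
    fix x assume x: "x \<in> V t"
    show "ZA.cE (q x) (lab x) = ZA.cE (\<zero>\<^bsub>Qm t\<^esub> x) (lab x)"
      using cyc q(1) x by (simp add: cycle_def Q.M_zero ZA.coords_zero)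
    show "ZA.cB (q x) u (lab x) = ZA.cB (\<zero>\<^bsub>Qm t\<^esub> x) u (lab x)" for u
      using q(2) x by (simp add: Q.M_comp ZA.A_comp Q.M_zero ZA.coords_zero)
    show "ZA.cX (q x) (lab x) = ZA.cX (\<zero>\<^bsub>Qm t\<^esub> x) (lab x)"
      using q(2) x by (simp add: Q.M_comp ZA.A_comp Q.M_zero ZA.coords_zero)
  qed
  then show False using q(3) by simp
qed

lemma minimal: "minimal_linear_projective_resolution TYPE('m) TYPE('n) A L Qm d \<epsilon>"
  unfolding minimal_linear_projective_resolution_def
proof (intro conjI allI impI resolution notI)
  fix N assume N: "indecomposable_summand A (Qm 0) N" and sub: "N \<subseteq> a_kernel (Qm 0) L \<epsilon>"
  have "\<forall>q\<in>N. cycle 0 q"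
    using sub unfolding a_kernel_def' by (auto simp: cycle_def v augmentation_eq L_simps)
  then show False using summand_not_cycles[OF N] by blast
next
  fix t N assume N: "indecomposable_summand A (Qm (Suc t)) N" and sub: "N \<subseteq> a_kernel (Qm (Suc t)) (Qm t) (d t)"
  have "\<forall>q\<in>N. cycle (Suc t) q"
    using sub kernel_iff_cycle unfolding a_kernel_def' by blast
  then show False using summand_not_cycles[OF N] by blast
qed

end

end

theorem proposition5p11:
  fixes G :: "'v::finite pair_pre_digraph" and i :: 'v
    and R :: "('w, 'v, 'k::field) resolution_graph"
  assumes "pair_graph G" and "pverts G = UNIV" and "Digraph_Component.connected (with_proj G)"
    and "chebyshev_run G i R" and "\<not> chebyshev_terminates R"
  shows "minimal_linear_projective_resolution TYPE('m) TYPE('n) (zigzag_algebra G)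
           (simple_module G i) (complex_module G R) (complex_map G R) (augmentation G i R) \<and>
         (\<forall>t. \<exists>a :: nat ^ 'v.
            (\<forall>j. has_multiplicity (zigzag_algebra G) (proj_module G j) (complex_module G R t) (a $ j)) \<and>
            (\<chi> j. int (a $ j)) =
              poly_matrix (cheb_U (int t)) (adjacency_matrix G) *v axis i 1 -
              poly_matrix (cheb_U (int t - 1)) (adjacency_matrix G) *v 0 \<and>
            (\<chi> j. int (a $ j)) = column i (poly_matrix (cheb_U (int t)) (adjacency_matrix G)))"
proof -
  interpret C: chebyshev G i R
    using assms(1,2,4) by (rule chebyshev.intro)
  have ne1: "level R s \<noteq> {}" if "s \<ge> 1" for s
    using assms(5) that by (auto simp: chebyshev_terminates_def)
  have ne: "level R s \<noteq> {}" for s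
  proof (cases s)
    case 0
    then show ?thesis by (metis C.level_0 insert_not_empty)
  next
    case (Suc r)
    then show ?thesis using ne1[of s] by simp
  qed
  \<comment> \<open>Graphs with one or two vertices are excluded by nontermination, which makes the
    coordinates of \<open>zigzag\<close> available.\<close>
  have "card (UNIV :: 'v set) \<ge> 3"
  proof (rule ccontr)
    assume "\<not> ?thesis"
    then have "card (UNIV :: 'v set) \<le> 2" by simp
    then show False using C.terminates_if_small ne1 by blast
  qed
  then interpret chebyshev_resolution G i R
    using assms(1-3) ne C.chebyshev_axioms
    by (intro chebyshev_resolution.intro zigzag.intro chebyshev_resolution_axioms.intro)
  obtain v where v: "level R 0 = {v}" "vlabel R v = i" by (rule C.level_0)
  have min: "minimal_linear_projective_resolution TYPE('m) TYPE('n) (zigzag_algebra G)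
           (simple_module G i) (complex_module G R) (complex_map G R) (augmentation G i R)"
    unfolding complex_module_eq by (rule minimal[OF v])
  have mult: "\<exists>a :: nat ^ 'v.
            (\<forall>j. has_multiplicity (zigzag_algebra G) (proj_module G j) (complex_module G R t) (a $ j)) \<and>
            (\<chi> j. int (a $ j)) =
              poly_matrix (cheb_U (int t)) (adjacency_matrix G) *v axis i 1 -
              poly_matrix (cheb_U (int t - 1)) (adjacency_matrix G) *v 0 \<and>
            (\<chi> j. int (a $ j)) = column i (poly_matrix (cheb_U (int t)) (adjacency_matrix G))" for t
  \<comment> \<open>The multiplicity of \<open>P_j\<close> is the number of vertices of level
    \<open>t\<close> labeled \<open>j\<close>.\<close>
  proof (intro exI[of _ "\<chi> j. card {x \<in> level R t. vlabel R x = j}"] conjI allI)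
    show "has_multiplicity (zigzag_algebra G) (proj_module G j) (complex_module G R t) ((\<chi> j. card {x \<in> level R t. vlabel R x = j}) $ j)" for j
      unfolding complex_module_eq using multiplicity by simp
    show "(\<chi> j. int ((\<chi> j. card {x \<in> level R t. vlabel R x = j}) $ j)) = column i (poly_matrix (cheb_U (int t)) (adjacency_matrix G))"
      by (simp add: vec_eq_iff column_def C.column_cheb_U[OF ne])
    then show "(\<chi> j. int ((\<chi> j. card {x \<in> level R t. vlabel R x = j}) $ j)) =
      poly_matrix (cheb_U (int t)) (adjacency_matrix G) *v axis i 1 -
      poly_matrix (cheb_U (int t - 1)) (adjacency_matrix G) *v 0"
      by (simp add: vec_eq_iff column_def matrix_vector_mult_def axis_def if_distrib cong: if_cong)
  qed
  show ?thesis using min mult by blast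
qed

end
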